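(* Let $N\ge1$, $p>p_F:=1+2/N$ and $r>1$. There exist constants $\gamma_3=\gamma_3(N,p,r,\alpha)>0$, $\alpha\in(0,1)$, depending only on $N,p,r,\alpha$, such that the following holds. Let $\alpha\in(0,1)$ and $T>0$. If $\mu$ is a nonnegative measurable function in $\mathbf{R}^N$ satisfying $$\sup_{z\in\mathbf{R}^N}\left(\int_{B(z;\sigma)}\mu(y)^r\,dy\right)^{\frac1r}\le\gamma_3\,\sigma^{\frac Nr-\frac2{p-1}}\qquad\text{for all }\sigma\in(0,T^{\alpha/2}),$$ then the problem $$(\mathrm{P})_\alpha:\qquad {}^{C}\partial_t^\alpha u-\Delta u=u^p\quad (t>0,\ x\in\mathbf{R}^N),\qquad u(0)=\mu\ \text{ in }\mathbf{R}^N,$$ possesses a solution in $[0,T)\times\mathbf{R}^N$. Furthermore, $$\limsup_{\alpha\to1-0}\gamma_3(N,p,r,\alpha)\in(0,\infty).$$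
   Context: $B(z;r):=\{y\in\mathbf{R}^N;\ |z-y|<r\}$. For $t>0$, $x\in\mathbf{R}^N$, $G(t,x):=(4\pi t)^{-N/2}\exp(-|x|^2/(4t))$, and for a Radon measure $\mu$ on $\mathbf{R}^N$, $e^{t\Delta}\mu(x):=\int_{\mathbf{R}^N}G(t,x-y)\,d\mu(y)$. A locally integrable function $\phi$ is identified with the Radon measure $\phi\,dx$. For $\alpha\in(0,1)$, $h_\alpha>0$ denotes the probability density function on $(0,\infty)$ characterized by $$\int_0^\infty h_\alpha(\theta)e^{z\theta}\,d\theta=E_{\alpha,1}(z),\qquad z\in\mathbf{C},\qquad\text{where } E_{\alpha,\beta}(z):=\sum_{k=0}^\infty\frac{z^k}{\Gamma(\alpha k+\beta)}$$ is the Mittag--Leffler function. It also satisfies $\int_0^\infty\alpha\theta h_\alpha(\theta)e^{z\theta}\,d\theta=E_{\alpha,\alpha}(z)$ for $z\in\mathbf{C}$ and $\int_0^\infty\theta^\delta h_\alpha(\theta)\,d\theta=\Gamma(1+\delta)/\Gamma(1+\alpha\delta)<\infty$ for $\delta>-1$. Set, for $t>0$, $$P_\alpha(t)\mu:=\int_0^\infty h_\alpha(\theta)\,e^{t^\alpha\theta\Delta}\mu\,d\theta,\qquad S_\alpha(t)\mu:=\int_0^\infty\theta h_\alpha(\theta)\,e^{t^\alpha\theta\Delta}\mu\,d\theta.$$ Here ${}^{C}\partial_t^\alpha$ is the Caputo derivative of order $\alpha$, $({}^{C}\partial_t^\alpha f)(t)=\frac{1}{\Gamma(1-\alpha)}\frac{d}{dt}\int_0^t\frac{f(s)-f(0)}{(t-s)^\alpha}\,ds$,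 but solutions are understood in the following integral sense. Definition of solution: for $T\in(0,\infty]$, a nonnegative measurable function $u$ on $(0,T)\times\mathbf{R}^N$ is a solution of $(\mathrm{P})_\alpha$ in $[0,T)\times\mathbf{R}^N$ if $$\infty>u(t,x)=[P_\alpha(t)\mu](x)+\alpha\int_0^t(t-s)^{\alpha-1}[S_\alpha(t-s)u(s)^p](x)\,ds$$ for almost all $t\in(0,T)$ and $x\in\mathbf{R}^N$. *)

theory Defs
  imports "HOL-Analysis.Analysis" "HOL-Probability.Probability"
begin

definition mittag_leffler :: "real \<Rightarrow> real \<Rightarrow> complex \<Rightarrow> complex" where
  "mittag_leffler \<alpha> \<beta> z = (\<Sum>k. z ^ k / of_real (Gamma (\<alpha> * real k + \<beta>)))"

text \<open>
  A positive probability density on \<open>(0, \<infinity>)\<close> whose Laplace transform is the Mittag-Leffler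
  function; values of \<open>h\<close> outside \<open>(0, \<infinity>)\<close> play no role. Integrability is stated separately
  because the Bochner integral of a non-integrable function is \<open>0\<close> by convention.
\<close>

definition is_mittag_leffler_density :: "real \<Rightarrow> (real \<Rightarrow> real) \<Rightarrow> bool" where
  "is_mittag_leffler_density \<alpha> h \<longleftrightarrow>
     h \<in> borel_measurable borel \<and>
     (\<forall>\<theta>>0. h \<theta> > 0) \<and>
     prob_space (density lborel (\<lambda>\<theta>. ennreal (h \<theta>) * indicator {0<..} \<theta>)) \<and>
     (\<forall>z::complex.
        set_integrable lborel {0<..} (\<lambda>\<theta>. of_real (h \<theta>) * exp (z * of_real \<theta>)) \<and>
        (LINT \<theta>:{0<..}|lborel. of_real (h \<theta>) * exp (z * of_real \<theta>)) = mittag_leffler \<alpha> 1 z)"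

text \<open>
  For \<open>0 < \<alpha> < 1\<close> such a density exists and is unique up to null sets, so the choice of a
  version does not affect the operators \<open>P_op\<close> and \<open>S_op\<close> below.
\<close>

definition h_density :: "real \<Rightarrow> real \<Rightarrow> real" where
  "h_density \<alpha> = (SOME h. is_mittag_leffler_density \<alpha> h)"

definition heat_kernel :: "real \<Rightarrow> 'a::euclidean_space \<Rightarrow> real" where
  "heat_kernel t x = (4 * pi * t) powr (- real DIM('a) / 2) * exp (- (norm x)\<^sup>2 / (4 * t))"

definition heat :: "real \<Rightarrow> 'a::euclidean_space measure \<Rightarrow> 'a \<Rightarrow> ennreal" where
  "heat t M x = (\<integral>\<^sup>+ y. ennreal (heat_kernel t (x - y)) \<partial>M)"

text \<open>The identification of a function with the measure that has it as Lebesgue density.\<close>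

definition fun_measure :: "('a::euclidean_space \<Rightarrow> ennreal) \<Rightarrow> 'a measure" where
  "fun_measure f = density lebesgue f"

definition P_op :: "real \<Rightarrow> real \<Rightarrow> 'a::euclidean_space measure \<Rightarrow> 'a \<Rightarrow> ennreal" where
  "P_op \<alpha> t M x =
     (\<integral>\<^sup>+ \<theta>\<in>{0<..}. ennreal (h_density \<alpha> \<theta>) * heat (t powr \<alpha> * \<theta>) M x \<partial>lebesgue)"

definition S_op :: "real \<Rightarrow> real \<Rightarrow> 'a::euclidean_space measure \<Rightarrow> 'a \<Rightarrow> ennreal" where
  "S_op \<alpha> t M x =
     (\<integral>\<^sup>+ \<theta>\<in>{0<..}. ennreal (\<theta> * h_density \<alpha> \<theta>) * heat (t powr \<alpha> * \<theta>) M x \<partial>lebesgue)"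

text \<open>Real powers on \<open>[0, \<infinity>]\<close>, meant for exponents \<open>q > 0\<close>.\<close>

definition ennpowr :: "ennreal \<Rightarrow> real \<Rightarrow> ennreal" where
  "ennpowr a q = (if a = \<infinity> then \<infinity> else ennreal (enn2real a powr q))"

text \<open>
  Integral solutions of the Caputo time-fractional problem with initial measure \<open>M\<close>. A solution
  is \<open>[0, \<infinity>]\<close>-valued; its finiteness almost everywhere is part of the requirement. ``Almost
  all \<open>(t, x)\<close>'' refers to Lebesgue measure on the product space.
\<close>

definition is_solution ::
  "real \<Rightarrow> real \<Rightarrow> 'a::euclidean_space measure \<Rightarrow> ereal \<Rightarrow> (real \<Rightarrow> 'a \<Rightarrow> ennreal) \<Rightarrow> bool" where
  "is_solution \<alpha> p M T u \<longleftrightarrow>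
     (\<lambda>(t, x). u t x) \<in> borel_measurable (lebesgue_on ({t. 0 < t \<and> ereal t < T} \<times> UNIV)) \<and>
     (AE (t, x) in lebesgue_on ({t. 0 < t \<and> ereal t < T} \<times> UNIV).
        u t x < \<infinity> \<and>
        u t x = P_op \<alpha> t M x +
          ennreal \<alpha> * (\<integral>\<^sup>+ s\<in>{0<..<t}. ennreal ((t - s) powr (\<alpha> - 1)) *
             S_op \<alpha> (t - s) (fun_measure (\<lambda>y. ennpowr (u s y) p)) x \<partial>lebesgue))"

end

(*
The solution is the limit of monotone iteration below a supersolution, which is obtained by
subordination. P_alpha(t) averages the heat semigroup at the operational time t^alpha theta over
the Mittag-Leffler law of theta, and the fractional Duhamel integral is an average of heat Duhamel
integrals in operational time. Hence
V(t) = 2 E[(e^{t^alpha theta Laplacian} mu^r)^{1/r}] is a supersolution: Jensen in theta gives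
V^p <= C E[...^p], after which the classical estimate with e^{sigma Laplacian} mu^r <=
C sigma^{-r/(p-1)} applies at each operational time. Operational times beyond T^alpha are controlled by
exponential moments of theta, bounded as alpha -> 1.

The law itself exists by Kanter's formula: theta = W^{1-alpha} B(U) with W exponential, U uniform on
(0, pi). Its moments k!/Gamma(1 + alpha k) come from the integral of B^k, evaluated by
integrating (1+z)^k z^{-alpha k - 1} along a curve on which the integrand is real. The Duhamel
identity in operational time is verified on mixed moments, which determine the measures involved.
*)
theory Submission
  imports Defs
begin

section \<open>The Mittag-Leffler distribution\<close>

text \<open>The exponential weight is forced by the hypothesis: it bounds balls of radius below
  T^(alpha/2) only, while t^alpha theta is unbounded for every t > 0, so the nonlinear estimate is
  needed at operational times where mu gives no further decay. The root 1/r stands inside the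
  expectation so that the final comparison of a time-weighted heat flow with its root is made for
  each theta separately. Equality of the two joint laws behind the Duhamel identity is not sought.
  It is enough to test exp(-kappa q) G(p + q), with q the operational time elapsed and p + q the
  total, which reduces uniqueness to measures on the line; the kernel q^(-b) is then a superposition
  of exponentials. Afterwards the time integral is a classical one, so alpha enters gamma_3 only
  through the exponential moment of theta. To keep that moment bounded near alpha = 1, the function
  B is bounded by e^2 for all alpha. Existence of the law must be proved because the density h is
  obtained by choice.\<close>

lemma sum_alternating_binomial_inverse:
  fixes x :: real
  assumes "\<And>j. j \<le> k \<Longrightarrow> x + real j \<noteq> 0"
  shows "(\<Sum>j\<le>k. (-1) ^ j * real (k choose j) / (x + real j)) = fact k / pochhammer x (Suc k)"
  using assms
proof (induction k arbitrary: x)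
  case 0
  then show ?case by simp
next
  case (Suc k)
  have nz: "x + real j \<noteq> 0" if "j \<le> Suc k" for j using Suc.prems that by blast
  have S1: "(\<Sum>j\<le>k. (-1) ^ j * real (k choose j) / (x + real j)) = fact k / pochhammer x (Suc k)"
    by (rule Suc.IH) (use nz in auto)
  have S2: "(\<Sum>j\<le>k. (-1) ^ j * real (k choose j) / ((x + 1) + real j)) = fact k / pochhammer (x + 1) (Suc k)"
  proof (rule Suc.IH)
    show "x + 1 + real j \<noteq> 0" if "j \<le> k" for j using nz[of "Suc j"] that by (simp add: algebra_simps)
  qed
  \<comment> \<open>Pascal's rule splits the sum into the instance at \<open>x\<close> and, after an
    index shift, minus the instance at \<open>x + 1\<close>. The identity itself is the partial
    fraction expansion of \<open>fact k / pochhammer x (Suc k)\<close>.\<close>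
  have "(\<Sum>j\<le>Suc k. (-1) ^ j * real (Suc k choose j) / (x + real j))
      = (\<Sum>j\<le>Suc k. (-1) ^ j * real (k choose j) / (x + real j))
        + (\<Sum>j\<le>Suc k. (-1) ^ j * real (if j = 0 then 0 else k choose (j - 1)) / (x + real j))"
    unfolding sum.distrib[symmetric]
    by (intro sum.cong refl) (auto simp: add_divide_distrib[symmetric] ring_distribs(1)[symmetric]
        of_nat_add[symmetric] gr0_conv_Suc simp del: of_nat_add elim!: gr0_implies_Suc split: nat.splits intro!: arg_cong2[where f="(/)"])
  also have "(\<Sum>j\<le>Suc k. (-1) ^ j * real (k choose j) / (x + real j)) = fact k / pochhammer x (Suc k)"
    using S1 by simp
  also have "(\<Sum>j\<le>Suc k. (-1) ^ j * real (if j = 0 then 0 else k choose (j - 1)) / (x + real j))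
      = - (\<Sum>j\<le>k. (-1) ^ j * real (k choose j) / ((x + 1) + real j))"
    by (subst sum.atMost_Suc_shift) (simp add: sum_negf[symmetric] algebra_simps)
  also have "\<dots> = - (fact k / pochhammer (x + 1) (Suc k))" using S2 by simp
  also have "fact k / pochhammer x (Suc k) + - (fact k / pochhammer (x + 1) (Suc k))
      = fact (Suc k) / pochhammer x (Suc (Suc k))"
  proof -
    have p: "pochhammer (x + 1) k \<noteq> 0"
      using nz by (auto simp: pochhammer_eq_0_iff) (metis Suc_le_mono add.commute add_cancel_right_right
        add_eq_0_iff less_imp_le_nat le_SucI minus_add_cancel of_nat_Suc Suc_leI add.assoc add_diff_cancel)
    have "pochhammer x (Suc k) = x * pochhammer (x + 1) k" by (simp add: pochhammer_rec)
    moreover have "pochhammer (x + 1) (Suc k) = pochhammer (x + 1) k * (x + 1 + real k)"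
      by (simp add: pochhammer_Suc)
    moreover have "pochhammer x (Suc (Suc k)) = x * (pochhammer (x + 1) k * (x + 1 + real k))"
      by (simp add: pochhammer_rec[of x] pochhammer_Suc[of "x+1" k])
    moreover have "x \<noteq> 0" "x + 1 + real k \<noteq> 0" using nz[of 0] nz[of "Suc k"] by (auto simp: algebra_simps)
    moreover have "F / (x * q) + - (F / (q * y)) = (1 + real k) * F / (x * (q * y))"
      if "x \<noteq> 0" "q \<noteq> 0" "y \<noteq> 0" "y = x + 1 + real k" for F q y :: real
      using that(1-3) by (simp add: divide_simps) (simp add: that(4) algebra_simps)
    ultimately show ?thesis using p by simp
  qed
  finally show ?case .
qed

lemma Gamma_reflection_real: "Gamma x * Gamma (1 - x) = pi / sin (pi * x)" for x :: real
proof -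
  have "complex_of_real (Gamma x * Gamma (1 - x)) = of_real (pi / sin (pi * x))"
    using Gamma_reflection_complex[of "of_real x"]
    by (simp add: Gamma_complex_of_real[symmetric] sin_of_real[symmetric])
  then show ?thesis by (simp only: of_real_eq_iff)
qed

text \<open>The right-hand side is \<open>pi\<close> times the binomial coefficient of
  \<open>k\<close> over the real number \<open>a * k\<close>. If \<open>a * k\<close> is an integer,
  all other sines vanish and only the value \<open>pi\<close> remains, which is the limit of
  \<open>sin (c * pi) / c\<close> at \<open>c = 0\<close>. Otherwise every sine is
  \<open>sin (pi * x)\<close> up to sign, with \<open>x = - (a * k)\<close>, and partial fractions
  followed by Gamma reflection evaluate the alternating sum.\<close>

lemma generalized_binomial_as_sine_sum:
  fixes a :: real and k :: nat
  assumes a: "0 < a" "a < 1"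
  shows "(\<Sum>j\<le>k. real (k choose j) *
            (if real j = a * k then pi else sin ((real j - a * k) * pi) / (real j - a * k)))
         = pi * fact k / (Gamma (1 + a * k) * Gamma (1 + (1 - a) * k))"
proof (cases "\<exists>m. real m = a * k")
  case True
  then obtain m where m: "real m = a * k" by blast
  have mk: "m \<le> k" using m a by (metis mult_right_le_one_le less_imp_le mult.commute of_nat_0_le_iff of_nat_le_iff)
  have "(\<Sum>j\<le>k. real (k choose j) *
            (if real j = a * k then pi else sin ((real j - a * k) * pi) / (real j - a * k)))
     = (\<Sum>j\<le>k. if j = m then real (k choose m) * pi else 0)"
  proof (intro sum.cong refl)
    fix j
    have "sin ((real j - real m) * pi) = 0"
      using sin_integer_2pi sin_zero_iff_int2[of "(real j - real m) * pi"]
      by (metis of_int_diff of_int_of_nat_eq)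
    then show "real (k choose j) * (if real j = a * k then pi else sin ((real j - a * k) * pi) / (real j - a * k))
        = (if j = m then real (k choose m) * pi else 0)" by (auto simp: m[symmetric])
  qed
  also have "\<dots> = real (k choose m) * pi" using mk by simp
  also have "\<dots> = pi * fact k / (fact m * fact (k - m))" using mk by (simp add: binomial_fact)
  also have "fact m = Gamma (1 + a * k)" unfolding m[symmetric] by (simp add: Gamma_fact)
  also have "fact (k - m) = Gamma (1 + (1 - a) * k)"
  proof -
    have "1 + (1 - a) * k = 1 + real (k - m)" using m mk by (simp add: algebra_simps of_nat_diff)
    then show ?thesis by (simp add: Gamma_fact)
  qed
  finally show ?thesis .
next
  case False
  define x where "x = - (a * k)"
  have nz: "x + real j \<noteq> 0" for j using False unfolding x_def by (metis add.commute add_eq_0_iff2 add.inverse_inverse)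
  have "(\<Sum>j\<le>k. real (k choose j) *
            (if real j = a * k then pi else sin ((real j - a * k) * pi) / (real j - a * k)))
     = (\<Sum>j\<le>k. sin (pi * x) * ((-1) ^ j * real (k choose j) / (x + real j)))"
  proof (intro sum.cong refl)
    fix j
    have "sin ((real j - a * k) * pi) = sin (pi * x + real j * pi)" by (simp add: x_def algebra_simps)
    also have "\<dots> = (-1) ^ j * sin (pi * x)" by (simp add: sin_add)
    finally show "real (k choose j) * (if real j = a * k then pi else sin ((real j - a * k) * pi) / (real j - a * k))
       = sin (pi * x) * ((-1) ^ j * real (k choose j) / (x + real j))"
      using False by (auto simp: x_def)
  qed
  also have "\<dots> = sin (pi * x) * (fact k / pochhammer x (Suc k))"
    unfolding sum_distrib_left[symmetric] by (subst sum_alternating_binomial_inverse) (use nz in auto)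
  also have "\<dots> = pi * fact k / (Gamma (1 + a * k) * Gamma (1 + (1 - a) * k))"
  proof -
    have xn: "x \<notin> \<int>\<^sub>\<le>\<^sub>0" using nz by (metis add.commute add.right_inverse nonpos_Ints_cases' add_eq_0_iff)
    have g: "Gamma x \<noteq> 0" using xn Gamma_eq_zero_iff by blast
    have p: "pochhammer x (Suc k) = Gamma (x + Suc k) / Gamma x"
      using pochhammer_Gamma[OF xn] by blast
    have s: "sin (pi * x) \<noteq> 0"
    proof
      assume "sin (pi * x) = 0"
      then obtain i :: int where "pi * x = of_int i * pi" using sin_zero_iff_int2 by auto
      then have "x = of_int i" by simp
      moreover have "x \<le> 0" using a by (simp add: x_def)
      ultimately have "x \<in> \<int>\<^sub>\<le>\<^sub>0" by (auto simp: nonpos_Ints_def)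
      then show False using xn by simp
    qed
    have r: "Gamma x * Gamma (1 - x) = pi / sin (pi * x)" by (rule Gamma_reflection_real)
    then have g1: "Gamma (1 - x) \<noteq> 0" using s by auto
    have "Gamma (x + Suc k) = Gamma (1 + (1 - a) * k)" by (simp add: x_def algebra_simps)
    moreover have "Gamma (1 - x) = Gamma (1 + a * k)" by (simp add: x_def)
    moreover have "sin (pi * x) * Gamma x = pi / Gamma (1 - x)" using r s g1 by (simp add: field_simps)
    moreover have "sin (pi * x) * (fact k / pochhammer x (Suc k)) = (sin (pi * x) * Gamma x) * fact k / Gamma (x + Suc k)"
      unfolding p by simp
    ultimately show ?thesis by (simp add: mult.commute)
  qed
  finally show ?thesis .
qed

text \<open>If \<open>S\<close> is positive \<open>a\<close>-stable, then
  \<open>S powr (- a)\<close> has the Mittag-Leffler law. This is the angular factor of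
  \<open>S powr (- a)\<close> in Kanter's representation of \<open>S\<close>, a power of Zolotarev's
  function.\<close>

definition kanter :: "real \<Rightarrow> real \<Rightarrow> real" where
  "kanter a \<phi> = sin \<phi> / (sin (a * \<phi>) powr a * sin ((1 - a) * \<phi>) powr (1 - a))"

lemma sin_mult_pos:
  assumes "0 < a" "a < 1" "0 < \<phi>" "\<phi> \<le> pi"
  shows "sin (a * \<phi>) > 0"
proof (rule sin_gt_zero)
  show "0 < a * \<phi>" using assms by simp
  have "a * \<phi> < 1 * \<phi>" using assms by (intro mult_strict_right_mono) auto
  then show "a * \<phi> < pi" using assms by linarith
qed

lemma kanter_pos:
  assumes "0 < a" "a < 1" "0 < \<phi>" "\<phi> < pi"
  shows "kanter a \<phi> > 0"
  using sin_mult_pos[of a \<phi>] sin_mult_pos[of "1 - a" \<phi>] sin_gt_zero[of \<phi>] assms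
  by (simp add: kanter_def)

text \<open>On the curve \<open>z = \<rho> \<phi> * cis \<phi>\<close> below, \<open>1 + z\<close> is a positive multiple of \<open>cis (a * \<phi>)\<close>, so that
  \<open>(1 + z) ^ k * z powr (- a * k)\<close> is real there, equal to \<open>kanter a \<phi> ^ k\<close>. The function \<open>F\<close> is the
  imaginary part of a primitive of \<open>(1 + z) ^ k * z powr (- a * k) / z\<close> along the curve.\<close>

lemma kanter_power_has_integral_sine_sum:
  fixes a :: real and k :: nat
  assumes a: "0 < a" "a < 1"
  shows "((\<lambda>\<phi>. kanter a \<phi> ^ k) has_integral
     (\<Sum>j\<le>k. real (k choose j) *
            (if real j = a * k then pi else sin ((real j - a * k) * pi) / (real j - a * k)))) {0..pi}"
proof -
  define \<rho> where "\<rho> \<phi> = sin (a * \<phi>) / sin ((1 - a) * \<phi>)" for \<phi> :: real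
  \<comment> \<open>Extends \<open>\<rho>\<close> continuously to 0, since the fundamental theorem
    is applied on the closed interval.\<close>
  define \<rho>0 where "\<rho>0 \<phi> = (if \<phi> = 0 then a / (1 - a) else \<rho> \<phi>)" for \<phi> :: real
  define c where "c j = real j - a * k" for j :: nat
  define F where "F \<phi> = (\<Sum>j\<le>k. real (k choose j) *
     (if c j = 0 then \<phi> else \<rho>0 \<phi> powr c j * sin (c j * \<phi>) / c j))" for \<phi> :: real
  have s1: "sin (a * \<phi>) > 0" if "0 < \<phi>" "\<phi> \<le> pi" for \<phi> using sin_mult_pos a that by simp
  have s2: "sin ((1 - a) * \<phi>) > 0" if "0 < \<phi>" "\<phi> \<le> pi" for \<phi>
    using sin_mult_pos[of "1 - a" \<phi>] a that by simp
  have \<rho>pos: "\<rho> \<phi> > 0" if "0 < \<phi>" "\<phi> \<le> pi" for \<phi> using s1 s2 that by (simp add: \<rho>_def)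
  have lim0: "(\<rho>0 \<longlongrightarrow> \<rho>0 0) (at 0)"
  proof -
    have l: "((\<lambda>x. sin (b * x) / x) \<longlongrightarrow> b) (at 0)" for b :: real
    proof -
      have "((\<lambda>x. sin (b * x)) has_real_derivative b) (at 0)"
        by (auto intro!: derivative_eq_intros)
      then show ?thesis by (simp add: has_field_derivative_iff)
    qed
    have "((\<lambda>x. (sin (a * x) / x) / (sin ((1 - a) * x) / x)) \<longlongrightarrow> a / (1 - a)) (at 0)"
      using a by (intro tendsto_divide l) auto
    then show ?thesis
      unfolding \<rho>0_def if_P[OF refl]
      by (rule Lim_transform_eventually) (auto simp: \<rho>0_def \<rho>_def eventually_at_filter)
  qed
  have cont\<rho>: "continuous_on {0..pi} \<rho>0"
    unfolding continuous_on_eq_continuous_within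
  proof
    fix x assume x: "x \<in> {0..pi}"
    show "continuous (at x within {0..pi}) \<rho>0"
    proof (cases "x = 0")
      case True
      then show ?thesis using lim0 by (auto simp: continuous_within intro: tendsto_within_subset)
    next
      case False
      have "continuous (at x) \<rho>"
        using s2[of x] x False unfolding \<rho>_def[abs_def] by (intro continuous_intros) auto
      moreover have "eventually (\<lambda>y. \<rho> y = \<rho>0 y) (nhds x)"
        using t1_space_nhds[OF False] by eventually_elim (simp add: \<rho>0_def)
      ultimately have "continuous (at x) \<rho>0" using isCont_cong by blast
      then show ?thesis using continuous_at_imp_continuous_within by blast
    qed
  qed
  have \<rho>0pos: "\<rho>0 \<phi> > 0" if "0 \<le> \<phi>" "\<phi> \<le> pi" for \<phi> using \<rho>pos that a by (auto simp: \<rho>0_def)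
  have contF: "continuous_on {0..pi} F"
    unfolding F_def
  proof (intro continuous_on_sum continuous_on_mult continuous_on_const)
    fix j
    show "continuous_on {0..pi} (\<lambda>\<phi>. if c j = 0 then \<phi> else \<rho>0 \<phi> powr c j * sin (c j * \<phi>) / c j)"
    proof (cases "c j = 0")
      case False
      have "\<rho>0 x \<noteq> 0" if "x \<in> {0..pi}" for x using \<rho>0pos[of x] that by auto
      then show ?thesis using False by (auto intro!: continuous_intros cont\<rho>)
    qed (auto intro: continuous_intros)
  qed
  have der: "(F has_vector_derivative kanter a \<phi> ^ k) (at \<phi>)" if \<phi>: "\<phi> \<in> {0<..<pi}" for \<phi>
  proof -
    \<comment> \<open>The value of this derivative is never computed: it only multiplies the
      imaginary part of \<open>Z\<close> below, which is zero.\<close>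
    have "\<exists>\<rho>'. (\<rho> has_real_derivative \<rho>') (at \<phi>)"
      unfolding \<rho>_def[abs_def] using s2[of \<phi>] \<phi> by (intro exI) (rule derivative_eq_intros refl | simp)+
    then obtain \<rho>' where d\<rho>: "(\<rho> has_real_derivative \<rho>') (at \<phi>)" by blast
    have ev: "eventually (\<lambda>y. \<rho> y = \<rho>0 y) (nhds \<phi>)"
    proof -
      have "\<phi> \<noteq> 0" using \<phi> by auto
      from t1_space_nhds[OF this] show ?thesis by eventually_elim (simp add: \<rho>0_def)
    qed
    have d\<rho>0: "(\<rho>0 has_real_derivative \<rho>') (at \<phi>)"
      using DERIV_cong_ev[OF refl ev refl] d\<rho> by blast
    have p: "\<rho> \<phi> > 0" using \<rho>pos \<phi> by auto
    have e0: "\<rho>0 \<phi> = \<rho> \<phi>" using \<phi> by (auto simp: \<rho>0_def)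
    have dj: "((\<lambda>\<phi>. if c j = 0 then \<phi> else \<rho>0 \<phi> powr c j * sin (c j * \<phi>) / c j) has_real_derivative
        \<rho>' / \<rho> \<phi> * (\<rho> \<phi> powr c j * sin (c j * \<phi>)) + \<rho> \<phi> powr c j * cos (c j * \<phi>)) (at \<phi>)" for j
    proof (cases "c j = 0")
      case True then show ?thesis using p by (auto intro!: derivative_eq_intros)
    next
      case False
      have "((\<lambda>\<phi>. \<rho>0 \<phi> powr c j) has_real_derivative c j * \<rho> \<phi> powr (c j - 1) * \<rho>') (at \<phi>)"
        using DERIV_powr[OF d\<rho>0, of "\<lambda>_. c j" 0] p e0
        by (simp add: powr_diff field_simps)
      then have "((\<lambda>\<phi>. \<rho>0 \<phi> powr c j * sin (c j * \<phi>) / c j) has_real_derivative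
         ((c j * \<rho> \<phi> powr (c j - 1) * \<rho>') * sin (c j * \<phi>) + (cos (c j * \<phi>) * c j) * \<rho>0 \<phi> powr c j) / c j) (at \<phi>)"
        by (intro DERIV_cdivide DERIV_mult) (auto intro!: derivative_eq_intros)
      moreover have "((c j * \<rho> \<phi> powr (c j - 1) * \<rho>') * sin (c j * \<phi>) + (cos (c j * \<phi>) * c j) * \<rho>0 \<phi> powr c j) / c j
        = \<rho>' / \<rho> \<phi> * (\<rho> \<phi> powr c j * sin (c j * \<phi>)) + \<rho> \<phi> powr c j * cos (c j * \<phi>)"
        using False p by (simp add: e0 powr_diff field_simps)
      ultimately show ?thesis using False by simp
    qed
    \<comment> \<open>\<open>Z\<close> is \<open>(1 + z) ^ k * z powr (- a * k)\<close> at
      \<open>z = \<rho> \<phi> * cis \<phi>\<close>, expanded by the binomial theorem. Its real and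
      imaginary parts are the cosine and sine sums in the derivative of \<open>F\<close>.\<close>
    define Z where "Z = (\<Sum>j\<le>k. of_nat (k choose j) * (of_real (\<rho> \<phi> powr c j) * cis (c j * \<phi>)))"
    define q where "q = sin \<phi> / sin ((1 - a) * \<phi>)"
    have "Z = (\<Sum>j\<le>k. of_real (\<rho> \<phi> powr (- a * k)) * cis (- a * k * \<phi>) *
        (of_nat (k choose j) * (of_real (\<rho> \<phi>) * cis \<phi>) ^ j * 1 ^ (k - j)))"
      unfolding Z_def
    proof (intro sum.cong refl)
      fix j
      have "\<rho> \<phi> powr c j = \<rho> \<phi> powr (- a * k) * \<rho> \<phi> ^ j"
        using p by (simp add: c_def powr_diff powr_minus powr_realpow field_simps)
      moreover have "cis (c j * \<phi>) = cis (- a * k * \<phi>) * cis \<phi> ^ j"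
        unfolding Complex.DeMoivre cis_mult by (rule arg_cong[where f = cis]) (simp add: c_def algebra_simps)
      ultimately show "of_nat (k choose j) * (of_real (\<rho> \<phi> powr c j) * cis (c j * \<phi>)) = of_real (\<rho> \<phi> powr (- a * k)) * cis (- a * k * \<phi>) *
        (of_nat (k choose j) * (of_real (\<rho> \<phi>) * cis \<phi>) ^ j * 1 ^ (k - j))"
        by (simp add: power_mult_distrib)
    qed
    also have "\<dots> = of_real (\<rho> \<phi> powr (- a * k)) * cis (- a * k * \<phi>) * (of_real (\<rho> \<phi>) * cis \<phi> + 1) ^ k"
      by (simp only: sum_distrib_left[symmetric] binomial_ring)
    also have "of_real (\<rho> \<phi>) * cis \<phi> + 1 = of_real q * cis (a * \<phi>)"
    proof -
      have nz: "sin ((1 - a) * \<phi>) \<noteq> 0" using s2[of \<phi>] \<phi> by auto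
      have e: "(1 - a) * \<phi> = \<phi> - a * \<phi>" by (simp add: algebra_simps)
      have r: "sin (a * \<phi>) * cos \<phi> + sin ((1 - a) * \<phi>) = sin \<phi> * cos (a * \<phi>)"
        unfolding e sin_diff by (simp add: algebra_simps)
      show ?thesis
      proof (rule complex_eqI)
        show "Re (of_real (\<rho> \<phi>) * cis \<phi> + 1) = Re (of_real q * cis (a * \<phi>))"
          using nz r by (simp add: \<rho>_def q_def field_simps)
        show "Im (of_real (\<rho> \<phi>) * cis \<phi> + 1) = Im (of_real q * cis (a * \<phi>))"
          using nz by (simp add: \<rho>_def q_def field_simps)
      qed
    qed
    also have "of_real (\<rho> \<phi> powr (- a * k)) * cis (- a * k * \<phi>) * (of_real q * cis (a * \<phi>)) ^ k
        = of_real (\<rho> \<phi> powr (- a * k) * q ^ k)"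
      by (simp add: power_mult_distrib Complex.DeMoivre cis_mult algebra_simps flip: of_real_power)
    also have "\<rho> \<phi> powr (- a * k) * q ^ k = kanter a \<phi> ^ k"
    proof -
      have "\<rho> \<phi> powr (- a * k) = (\<rho> \<phi> powr (- a)) ^ k"
        using p by (simp add: powr_realpow[symmetric] powr_powr)
      moreover have "\<rho> \<phi> powr (- a) * q = kanter a \<phi>"
        using s1[of \<phi>] s2[of \<phi>] \<phi>
        by (simp add: \<rho>_def q_def kanter_def powr_divide powr_minus powr_diff field_simps)
      ultimately show ?thesis by (simp add: power_mult_distrib[symmetric])
    qed
    finally have Z: "Z = of_real (kanter a \<phi> ^ k)" .
    have "Re Z = (\<Sum>j\<le>k. real (k choose j) * (\<rho> \<phi> powr c j * cos (c j * \<phi>)))"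
      "Im Z = (\<Sum>j\<le>k. real (k choose j) * (\<rho> \<phi> powr c j * sin (c j * \<phi>)))"
      unfolding Z_def by simp_all
    with Z have re: "(\<Sum>j\<le>k. real (k choose j) * (\<rho> \<phi> powr c j * cos (c j * \<phi>))) = kanter a \<phi> ^ k"
      and im: "(\<Sum>j\<le>k. real (k choose j) * (\<rho> \<phi> powr c j * sin (c j * \<phi>))) = 0"
      by (simp_all del: of_real_power)
    have "(F has_real_derivative (\<Sum>j\<le>k. real (k choose j) *
        (\<rho>' / \<rho> \<phi> * (\<rho> \<phi> powr c j * sin (c j * \<phi>)) + \<rho> \<phi> powr c j * cos (c j * \<phi>)))) (at \<phi>)"
      unfolding F_def by (intro DERIV_sum DERIV_cmult dj)
    also have "(\<Sum>j\<le>k. real (k choose j) *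
        (\<rho>' / \<rho> \<phi> * (\<rho> \<phi> powr c j * sin (c j * \<phi>)) + \<rho> \<phi> powr c j * cos (c j * \<phi>)))
       = \<rho>' / \<rho> \<phi> * (\<Sum>j\<le>k. real (k choose j) * (\<rho> \<phi> powr c j * sin (c j * \<phi>)))
         + (\<Sum>j\<le>k. real (k choose j) * (\<rho> \<phi> powr c j * cos (c j * \<phi>)))"
      by (simp add: sum_distrib_left sum.distrib[symmetric] algebra_simps)
    also have "\<dots> = kanter a \<phi> ^ k" by (simp add: re im)
    finally show ?thesis by (simp add: has_real_derivative_iff_has_vector_derivative)
  qed
  have "((\<lambda>\<phi>. kanter a \<phi> ^ k) has_integral (F pi - F 0)) {0..pi}"
    using contF der by (intro fundamental_theorem_of_calculus_interior) auto
  moreover have "F 0 = 0" unfolding F_def by (intro sum.neutral) auto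
  moreover have "F pi = (\<Sum>j\<le>k. real (k choose j) *
            (if real j = a * k then pi else sin ((real j - a * k) * pi) / (real j - a * k)))"
  proof -
    have "(1 - a) * pi = pi - a * pi" by (simp add: algebra_simps)
    then have "\<rho>0 pi = 1" using s1[of pi] by (simp add: \<rho>0_def \<rho>_def)
    then show ?thesis unfolding F_def by (intro sum.cong refl) (simp add: c_def)
  qed
  ultimately show ?thesis by simp
qed

lemma kanter_moment:
  assumes a: "0 < a" "a < 1"
  shows "(\<integral>\<^sup>+\<phi>. ennreal (kanter a \<phi> ^ k) * indicator {0<..<pi} \<phi> \<partial>lborel)
     = ennreal (pi * fact k / (Gamma (1 + a * k) * Gamma (1 + (1 - a) * k)))"
proof (rule nn_integral_has_integral_lebesgue')
  show "0 \<le> kanter a \<phi> ^ k" if "\<phi> \<in> {0<..<pi}" for \<phi>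
    using kanter_pos[OF a] that by (auto intro!: zero_le_power less_imp_le)
  show "((\<lambda>\<phi>. kanter a \<phi> ^ k) has_integral
     pi * fact k / (Gamma (1 + a * k) * Gamma (1 + (1 - a) * k))) {0<..<pi}"
    using kanter_power_has_integral_sine_sum[OF a, of k] generalized_binomial_as_sine_sum[OF a, of k]
    by (simp add: has_integral_Icc_iff_Ioo)
qed

text \<open>Concavity of the sine gives \<open>b * sin \<phi> \<le> sin (b * \<phi>)\<close>, which
  cancels \<open>sin \<phi>\<close> and leaves \<open>a powr a * (1 - a) powr (1 - a)\<close> in the
  denominator; each factor is at least \<open>exp (-1)\<close>. The bound must not depend on
  \<open>a\<close>, since it enters \<open>ml_exp_bound\<close> in the limit as \<open>a\<close>
  tends to 1.\<close>

lemma kanter_le: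
  assumes a: "0 < a" "a < 1" and \<phi>: "0 < \<phi>" "\<phi> < pi"
  shows "kanter a \<phi> \<le> exp 2"
proof -
  have conc: "b * sin \<phi> \<le> sin (b * \<phi>)" if b: "0 < b" "b < 1" for b
  proof -
    have "sin (b * 0) - b * sin 0 \<le> sin (b * \<phi>) - b * sin \<phi>"
    proof (rule DERIV_nonneg_imp_nondecreasing[where f = "\<lambda>x. sin (b * x) - b * sin x"])
      show "0 \<le> \<phi>" using \<phi> by simp
      show "\<exists>y. ((\<lambda>x. sin (b * x) - b * sin x) has_real_derivative y) (at x) \<and> y \<ge> 0" if x: "0 \<le> x" "x \<le> \<phi>" for x
      proof (intro exI conjI)
        show "((\<lambda>x. sin (b * x) - b * sin x) has_real_derivative (b * (cos (b * x) - cos x))) (at x)"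
          by (auto intro!: derivative_eq_intros simp: algebra_simps)
        have "b * x \<le> 1 * x" using b x by (intro mult_right_mono) auto
        then have "cos x \<le> cos (b * x)" using b x \<phi> by (intro cos_monotone_0_pi_le) auto
        then show "0 \<le> b * (cos (b * x) - cos x)" using b by simp
      qed
    qed
    then show ?thesis by simp
  qed
  have s: "sin \<phi> > 0" using \<phi> sin_gt_zero by blast
  have e: "exp (-1) \<le> b powr b" if b: "0 < b" "b < 1" for b :: real
  proof -
    have "- ln b \<le> 1 / b - 1" using ln_le_minus_one[of "1/b"] b by (simp add: ln_div)
    then have "b * (- ln b) \<le> b * (1 / b - 1)" using b by (intro mult_left_mono) auto
    then have "-1 \<le> b * ln b" using b by (simp add: algebra_simps)
    then show ?thesis using b by (simp add: powr_def)
  qed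
  have "exp (-2) * sin \<phi> = (exp (-1) * exp (-1)) * (sin \<phi> powr a * sin \<phi> powr (1 - a))"
    using s by (simp add: powr_add[symmetric] exp_add[symmetric])
  also have "\<dots> \<le> (a powr a * (1 - a) powr (1 - a)) * (sin \<phi> powr a * sin \<phi> powr (1 - a))"
    using e[of a] e[of "1 - a"] a by (intro mult_right_mono mult_mono) auto
  also have "\<dots> = (a * sin \<phi>) powr a * ((1 - a) * sin \<phi>) powr (1 - a)"
    using a s by (simp add: powr_mult)
  also have "\<dots> \<le> sin (a * \<phi>) powr a * sin ((1 - a) * \<phi>) powr (1 - a)"
    using a s conc[of a] conc[of "1 - a"] by (intro mult_mono powr_mono2) auto
  finally have "exp (-2) * sin \<phi> \<le> sin (a * \<phi>) powr a * sin ((1 - a) * \<phi>) powr (1 - a)" .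
  moreover have "sin (a * \<phi>) powr a * sin ((1 - a) * \<phi>) powr (1 - a) > 0"
    using sin_mult_pos[of a \<phi>] sin_mult_pos[of "1 - a" \<phi>] a \<phi> by simp
  ultimately show ?thesis
    by (simp add: kanter_def divide_le_eq exp_minus field_simps)
qed

section \<open>Substitution by powers and termwise integration of the exponential series\<close>

lemma nn_integral_lborel_Union_incseq:
  fixes f :: "real \<Rightarrow> ennreal"
  assumes "f \<in> borel_measurable borel" "incseq A" "\<And>n. A n \<in> sets borel"
  shows "(\<integral>\<^sup>+x. f x * indicator (\<Union>n. A n) x \<partial>lborel) = (SUP n. \<integral>\<^sup>+x. f x * indicator (A n) x \<partial>lborel)"
proof -
  have "(SUP n. emeasure (density lborel f) (A n)) = emeasure (density lborel f) (\<Union>n. A n)"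
    using assms by (intro SUP_emeasure_incseq) auto
  moreover have "emeasure (density lborel f) B = (\<integral>\<^sup>+x. f x * indicator B x \<partial>lborel)" if "B \<in> sets borel" for B
    using assms(1) that by (intro emeasure_density) auto
  ultimately show ?thesis using assms(3) by simp
qed

text \<open>Substitution on the compact intervals \<open>{l n..u n}\<close>, which stay away from 0
  so that the power is smooth there, followed by monotone convergence on both sides.\<close>

lemma nn_integral_powr_substitution:
  fixes f :: "real \<Rightarrow> ennreal"
  assumes f: "f \<in> borel_measurable borel" and b: "b > 0" and \<beta>: "\<beta> > 0"
  shows "(\<integral>\<^sup>+\<theta>. f \<theta> * indicator {0<..} \<theta> \<partial>lborel) =
    (\<integral>\<^sup>+w. f (b * w powr \<beta>) * ennreal (b * \<beta> * w powr (\<beta> - 1)) * indicator {0<..} w \<partial>lborel)"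
proof -
  note f[measurable]
  \<comment> \<open>The shift by 2 ensures \<open>l n < 1 < u n\<close> already at
    \<open>n = 0\<close>.\<close>
  define l u where "l n = 1 / (real n + 2)" and "u n = real n + 2" for n :: nat
  define g where "g w = b * w powr \<beta>" for w
  have lu1: "l n < 1" "1 < u n" for n by (simp_all add: l_def u_def)
  have l0: "l n > 0" "l n < u n" for n using less_trans[OF lu1] by (simp_all add: l_def)
  have mono: "l (Suc n) \<le> l n" "u n \<le> u (Suc n)" for n by (auto simp: l_def u_def field_simps)
  have U: "(\<Union>n. {l n..u n}) = {0<..}"
  proof (intro equalityI subsetI)
    fix x :: real assume x: "x \<in> {0<..}"
    obtain n :: nat where n: "max x (1 / x) \<le> real n" using real_arch_simple by blast
    have "l n \<le> x" "x \<le> u n" using n x by (auto simp: l_def u_def field_simps) 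
    then show "x \<in> (\<Union>n. {l n..u n})" by auto
  qed (use l0 in \<open>auto intro: less_le_trans\<close>)
  have gmono: "g x \<le> g y" if "0 < x" "x \<le> y" for x y
    using that b \<beta> by (auto simp: g_def intro!: mult_left_mono powr_mono2)
  have gpos: "g x > 0" if "0 < x" for x using that b by (simp add: g_def)
  have U2: "(\<Union>n. {g (l n)..g (u n)}) = {0<..}"
  proof (intro equalityI subsetI)
    fix x :: real assume x: "x \<in> {0<..}"
    define w where "w = (x / b) powr (1 / \<beta>)"
    have "w > 0" using x b by (simp add: w_def)
    then obtain n where "l n \<le> w" "w \<le> u n" using U by (auto simp: set_eq_iff)
    moreover have "g w = x" using x b \<beta> by (simp add: g_def w_def powr_powr)
    ultimately have "g (l n) \<le> x" "x \<le> g (u n)" using gmono[of "l n" w] gmono[of w "u n"] l0 \<open>w > 0\<close> by auto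
    then show "x \<in> (\<Union>n. {g (l n)..g (u n)})" by auto
  qed (use l0 gpos in \<open>auto intro: less_le_trans\<close>)
  have "(\<integral>\<^sup>+\<theta>. f \<theta> * indicator {0<..} \<theta> \<partial>lborel) = (SUP n. \<integral>\<^sup>+\<theta>. f \<theta> * indicator {g (l n)..g (u n)} \<theta> \<partial>lborel)"
    unfolding U2[symmetric]
  proof (intro nn_integral_lborel_Union_incseq f)
    show "incseq (\<lambda>n. {g (l n)..g (u n)})"
    proof (intro incseq_SucI)
      fix n show "{g (l n)..g (u n)} \<subseteq> {g (l (Suc n))..g (u (Suc n))}"
        using gmono[of "l (Suc n)" "l n"] gmono[of "u n" "u (Suc n)"] mono[of n] l0[of n] l0[of "Suc n"]
        by (auto intro: order_trans)
    qed
  qed auto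
  also have "\<dots> = (SUP n. \<integral>\<^sup>+w. (f (g w) * ennreal (b * \<beta> * w powr (\<beta> - 1))) * indicator {l n..u n} w \<partial>lborel)"
  proof (intro SUP_cong refl)
    fix n
    show "(\<integral>\<^sup>+\<theta>. f \<theta> * indicator {g (l n)..g (u n)} \<theta> \<partial>lborel) =
      (\<integral>\<^sup>+w. f (g w) * ennreal (b * \<beta> * w powr (\<beta> - 1)) * indicator {l n..u n} w \<partial>lborel)"
    proof (rule nn_integral_substitution_aux)
      show "(g has_real_derivative b * \<beta> * x powr (\<beta> - 1)) (at x)" if "x \<in> {l n..u n}" for x
        using that l0[of n] unfolding g_def by (auto intro!: derivative_eq_intros)
      show "continuous_on {l n..u n} (\<lambda>x. b * \<beta> * x powr (\<beta> - 1))"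
        using l0[of n] by (intro continuous_intros) auto
    qed (use b \<beta> l0 in auto)
  qed
  also have "\<dots> = (\<integral>\<^sup>+w. (f (g w) * ennreal (b * \<beta> * w powr (\<beta> - 1))) * indicator {0<..} w \<partial>lborel)"
    unfolding U[symmetric]
  proof (intro nn_integral_lborel_Union_incseq[symmetric])
    show "incseq (\<lambda>n. {l n..u n})" using mono by (intro incseq_SucI) (auto intro: order_trans)
  qed (auto simp: g_def)
  finally show ?thesis by (simp add: g_def)
qed

text \<open>\<open>exp (norm (X x))\<close> dominates each \<open>norm (X x) ^ k / fact k\<close>
  and all partial sums of these, so a single exponential moment justifies termwise
  integration.\<close>

lemma integral_exp_series:
  fixes X :: "'a \<Rightarrow> complex"
  assumes X[measurable]: "X \<in> borel_measurable M"
    and fin: "(\<integral>\<^sup>+x. ennreal (exp (norm (X x))) \<partial>M) < \<infinity>"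
  shows "integrable M (\<lambda>x. X x ^ k)" "integrable M (\<lambda>x. exp (X x))"
    and "(\<lambda>k. (\<integral>x. X x ^ k \<partial>M) / fact k) sums (\<integral>x. exp (X x) \<partial>M)"
proof -
  have E: "integrable M (\<lambda>x. exp (norm (X x)))"
    using fin by (intro integrableI_nonneg) auto
  have le: "norm (X x) ^ k / fact k \<le> exp (norm (X x))" for x k
    using sum_le_suminf[OF summable_exp_generic[of "norm (X x)"], of "{k}"]
    by (simp add: exp_def divide_inverse mult.commute)
  have le': "norm (X x ^ k) \<le> fact k * exp (norm (X x))" for x k
    using le[of x k] by (simp add: norm_power field_simps)
  have I: "integrable M (\<lambda>x. X x ^ k)" for k
    by (rule Bochner_Integration.integrable_bound[where f = "\<lambda>x. fact k * exp (norm (X x))"])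
       (use E le' in \<open>auto intro!: integrable_mult_right order_trans[OF le']\<close>)
  then show "integrable M (\<lambda>x. X x ^ k)" .
  show "integrable M (\<lambda>x. exp (X x))"
    by (rule Bochner_Integration.integrable_bound[OF E]) (auto intro!: AE_I2 order_trans[OF norm_exp] complex_Re_le_cmod)
  define f where "f k x = X x ^ k / fact k" for k x
  have fs: "f k x = X x ^ k /\<^sub>R fact k" for k x
    unfolding f_def scaleR_conv_of_real by (simp add: field_simps)
  have "(\<lambda>k. \<integral>x. f k x \<partial>M) sums (\<integral>x. (\<Sum>k. f k x) \<partial>M)"
  proof (rule sums_integral)
    show "integrable M (f k)" for k unfolding f_def using I by auto
    show "AE x in M. summable (\<lambda>k. norm (f k x))"
      unfolding fs by (intro AE_I2 summable_norm_exp)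
    have intn: "integrable M (\<lambda>x. norm (f k x))" for k using \<open>integrable M (f k)\<close> by auto
    show "summable (\<lambda>k. \<integral>x. norm (f k x) \<partial>M)"
    proof (rule bounded_imp_summable)
      fix n
      have "(\<Sum>k\<le>n. \<integral>x. norm (f k x) \<partial>M) = (\<integral>x. (\<Sum>k\<le>n. norm (f k x)) \<partial>M)"
        using intn by simp
      also have "\<dots> \<le> (\<integral>x. exp (norm (X x)) \<partial>M)"
      proof (rule integral_mono)
        show "integrable M (\<lambda>x. \<Sum>k\<le>n. norm (f k x))" using intn by auto
        fix x
        have "(\<Sum>k\<le>n. norm (f k x)) = (\<Sum>k\<le>n. norm (X x) ^ k /\<^sub>R fact k)"
          unfolding f_def norm_divide norm_power norm_fact by (simp add: field_simps)
        also have "\<dots> \<le> exp (norm (X x))"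
          unfolding exp_def by (intro sum_le_suminf summable_exp_generic) auto
        finally show "(\<Sum>k\<le>n. norm (f k x)) \<le> exp (norm (X x))" .
      qed (rule E)
      finally show "(\<Sum>k\<le>n. \<integral>x. norm (f k x) \<partial>M) \<le> (\<integral>x. exp (norm (X x)) \<partial>M)" .
    qed auto
  qed
  moreover have "(\<Sum>k. f k x) = exp (X x)" for x
    by (simp only: fs exp_def)
  ultimately show "(\<lambda>k. (\<integral>x. X x ^ k \<partial>M) / fact k) sums (\<integral>x. exp (X x) \<partial>M)"
    by (simp add: f_def)
qed

text \<open>With \<open>W\<close> standard exponential and \<open>U\<close> uniform on \<open>(0, \<pi>)\<close>, the random variable
  \<open>kanter a U * W powr (1 - a)\<close> has the Mittag-Leffler distribution; \<open>ml_density a\<close> is its density.\<close>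

definition ml_weight :: "real \<Rightarrow> real \<Rightarrow> real \<Rightarrow> real" where
  "ml_weight a \<phi> \<theta> = (let y = (\<theta> / kanter a \<phi>) powr (1 / (1 - a)) in y * exp (- y) / ((1 - a) * \<theta>))"

definition ml_density :: "real \<Rightarrow> real \<Rightarrow> real" where
  "ml_density a \<theta> = enn2real (\<integral>\<^sup>+\<phi>. ennreal (ml_weight a \<phi> \<theta> / pi) * indicator {0<..<pi} \<phi> \<partial>lborel)"

lemma measurable_kanter[measurable]: "kanter a \<in> borel_measurable borel"
  unfolding kanter_def[abs_def] by measurable

lemma measurable_ml_weight[measurable]: "(\<lambda>(\<theta>, \<phi>). ml_weight a \<phi> \<theta>) \<in> borel_measurable (borel \<Otimes>\<^sub>M borel)"
  unfolding ml_weight_def[abs_def] Let_def by measurable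

lemma measurable_ml_density[measurable]: "ml_density a \<in> borel_measurable borel"
  unfolding ml_density_def[abs_def] by measurable

lemma ml_weight_pos:
  assumes "0 < a" "a < 1" "0 < \<phi>" "\<phi> < pi" "\<theta> > 0"
  shows "ml_weight a \<phi> \<theta> > 0"
  using kanter_pos[of a \<phi>] assms by (simp add: ml_weight_def Let_def)

text \<open>From \<open>y * exp (- y) \<le> 1\<close>. The bound is free of \<open>\<phi>\<close>,
  so the integral over the angle is finite and \<open>enn2real\<close> in \<open>ml_density\<close>
  discards nothing when \<open>\<theta> > 0\<close>.\<close>

lemma ml_weight_le:
  assumes "0 < a" "a < 1" "\<theta> > 0"
  shows "ml_weight a \<phi> \<theta> \<le> 1 / ((1 - a) * \<theta>)"
proof -
  have "y * exp (- y) \<le> 1" for y :: real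
  proof -
    have "y \<le> exp y" using exp_ge_add_one_self[of y] by linarith
    then show ?thesis by (simp add: exp_minus field_simps)
  qed
  then show ?thesis using assms unfolding ml_weight_def Let_def by (intro divide_right_mono) auto
qed

lemma ml_density_finite:
  assumes a: "0 < a" "a < 1" and \<theta>: "\<theta> > 0"
  shows "(\<integral>\<^sup>+\<phi>. ennreal (ml_weight a \<phi> \<theta> / pi) * indicator {0<..<pi} \<phi> \<partial>lborel) < \<infinity>"
proof -
  have "(\<integral>\<^sup>+\<phi>. ennreal (ml_weight a \<phi> \<theta> / pi) * indicator {0<..<pi} \<phi> \<partial>lborel)
    \<le> (\<integral>\<^sup>+\<phi>. ennreal (1 / ((1 - a) * \<theta>) / pi) * indicator {0<..<pi} \<phi> \<partial>lborel)"
    by (intro nn_integral_mono mult_right_mono ennreal_leI divide_right_mono ml_weight_le a \<theta>) auto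
  also have "\<dots> < \<infinity>" by (subst nn_integral_cmult_indicator) (auto simp: ennreal_mult_less_top)
  finally show ?thesis .
qed

lemma ennreal_ml_density:
  assumes a: "0 < a" "a < 1" and \<theta>: "\<theta> > 0"
  shows "ennreal (ml_density a \<theta>) = (\<integral>\<^sup>+\<phi>. ennreal (ml_weight a \<phi> \<theta> / pi) * indicator {0<..<pi} \<phi> \<partial>lborel)"
  unfolding ml_density_def using ml_density_finite[OF a \<theta>] by (intro ennreal_enn2real) auto

text \<open>Positivity at every \<open>\<theta> > 0\<close>, not just almost everywhere, is demanded
  by \<open>is_mittag_leffler_density\<close>.\<close>

lemma ml_density_pos:
  assumes a: "0 < a" "a < 1" and \<theta>: "\<theta> > 0"
  shows "ml_density a \<theta> > 0"
proof -
  let ?J = "(\<integral>\<^sup>+\<phi>. ennreal (ml_weight a \<phi> \<theta> / pi) * indicator {0<..<pi} \<phi> \<partial>lborel)"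
  have "?J \<noteq> 0"
  proof
    assume "?J = 0"
    then have "AE \<phi> in lborel. ennreal (ml_weight a \<phi> \<theta> / pi) * indicator {0<..<pi} \<phi> = 0"
      by (subst (asm) nn_integral_0_iff_AE) auto
    then have "AE \<phi> in lborel. \<phi> \<notin> {0<..<pi}"
    proof eventually_elim
      case (elim \<phi>)
      show ?case
      proof
        assume "\<phi> \<in> {0<..<pi}"
        then show False using elim ml_weight_pos[OF a, of \<phi> \<theta>] \<theta> by (auto simp: ennreal_eq_0_iff divide_le_0_iff)
      qed
    qed
    then have "emeasure lborel {0<..<pi} = 0"
      by (subst (asm) AE_iff_measurable[of "{0<..<pi}"]) auto
    then show False by simp
  qed
  then have "ennreal (ml_density a \<theta>) \<noteq> 0" using ennreal_ml_density[OF a \<theta>] by simp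
  then show ?thesis by (simp add: ennreal_eq_0_iff not_le)
qed

text \<open>After Tonelli, each angle is handled by
  \<open>\<theta> = kanter a \<phi> * w powr (1 - a)\<close>: then \<open>y\<close> in
  \<open>ml_weight\<close> is \<open>w\<close>, and the Jacobian cancels
  \<open>w / ((1 - a) * \<theta>)\<close>, leaving the exponential density.\<close>

lemma nn_integral_ml_density:
  assumes a: "0 < a" "a < 1" and F[measurable]: "F \<in> borel_measurable borel"
  shows "(\<integral>\<^sup>+\<theta>. ennreal (ml_density a \<theta>) * F \<theta> * indicator {0<..} \<theta> \<partial>lborel) =
    (\<integral>\<^sup>+\<phi>. (\<integral>\<^sup>+w. ennreal (exp (- w)) * F (kanter a \<phi> * w powr (1 - a)) * indicator {0<..} w \<partial>lborel)
        * ennreal (1 / pi) * indicator {0<..<pi} \<phi> \<partial>lborel)"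
proof -
  let ?L = "\<lambda>\<theta> \<phi>. ennreal (ml_weight a \<phi> \<theta> / pi) * indicator {0<..<pi} \<phi> * (F \<theta> * indicator {0<..} \<theta>)"
  let ?R = "\<lambda>\<phi>. (\<integral>\<^sup>+w. ennreal (exp (- w)) * F (kanter a \<phi> * w powr (1 - a)) * indicator {0<..} w \<partial>lborel)
        * ennreal (1 / pi) * indicator {0<..<pi} \<phi>"
  have "(\<integral>\<^sup>+\<theta>. ennreal (ml_density a \<theta>) * F \<theta> * indicator {0<..} \<theta> \<partial>lborel) =
    (\<integral>\<^sup>+\<theta>. (\<integral>\<^sup>+\<phi>. ?L \<theta> \<phi> \<partial>lborel) \<partial>lborel)"
  proof (intro nn_integral_cong)
    fix \<theta> :: real
    show "ennreal (ml_density a \<theta>) * F \<theta> * indicator {0<..} \<theta> =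
      (\<integral>\<^sup>+\<phi>. ?L \<theta> \<phi> \<partial>lborel)"
      by (subst nn_integral_multc) (auto simp: indicator_def ennreal_ml_density[OF a])
  qed
  also have "\<dots> = (\<integral>\<^sup>+\<phi>. (\<integral>\<^sup>+\<theta>. ?L \<theta> \<phi> \<partial>lborel) \<partial>lborel)"
    by (rule lborel_pair.Fubini') measurable
  also have "\<dots> = (\<integral>\<^sup>+\<phi>. ?R \<phi> \<partial>lborel)"
  proof (intro nn_integral_cong)
    fix \<phi> :: real
    show "(\<integral>\<^sup>+\<theta>. ?L \<theta> \<phi> \<partial>lborel)
      = ?R \<phi>"
    proof (cases "\<phi> \<in> {0<..<pi}")
      case True
      define K where "K = kanter a \<phi>"
      have K: "K > 0" using True kanter_pos[OF a] by (simp add: K_def)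
      have "(\<integral>\<^sup>+\<theta>. ennreal (ml_weight a \<phi> \<theta> / pi) * F \<theta> * indicator {0<..} \<theta> \<partial>lborel)
        = (\<integral>\<^sup>+w. (ennreal (ml_weight a \<phi> (K * w powr (1 - a)) / pi) * F (K * w powr (1 - a))) *
            ennreal (K * (1 - a) * w powr ((1 - a) - 1)) * indicator {0<..} w \<partial>lborel)"
        using K a by (intro nn_integral_powr_substitution) auto
      also have "\<dots> = (\<integral>\<^sup>+w. ennreal (exp (- w)) * F (K * w powr (1 - a)) * indicator {0<..} w * ennreal (1 / pi) \<partial>lborel)"
      proof (intro nn_integral_cong)
        fix w :: real
        show "(ennreal (ml_weight a \<phi> (K * w powr (1 - a)) / pi) * F (K * w powr (1 - a))) *
            ennreal (K * (1 - a) * w powr ((1 - a) - 1)) * indicator {0<..} w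
          = ennreal (exp (- w)) * F (K * w powr (1 - a)) * indicator {0<..} w * ennreal (1 / pi)"
        proof (cases "w > 0")
          case w: True
          have y: "(K * w powr (1 - a) / kanter a \<phi>) powr (1 / (1 - a)) = w"
            using K w a by (simp add: K_def[symmetric] powr_powr)
          have nn: "ml_weight a \<phi> (K * w powr (1 - a)) / pi \<ge> 0"
            using ml_weight_pos[OF a, of \<phi> "K * w powr (1 - a)"] True K w by simp
          have "ml_weight a \<phi> (K * w powr (1 - a)) / pi * (K * (1 - a) * w powr ((1 - a) - 1)) = exp (- w) * (1 / pi)"
            unfolding ml_weight_def Let_def y using K w a by (simp add: powr_diff powr_minus field_simps)
          then have "ennreal (ml_weight a \<phi> (K * w powr (1 - a)) / pi) * ennreal (K * (1 - a) * w powr ((1 - a) - 1))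
             = ennreal (exp (- w)) * ennreal (1 / pi)"
            using nn K a by (subst (1 2) ennreal_mult[symmetric]) auto
          moreover have "A * F * B * I = C * F * I * D" if "A * B = C * D" for A B C D F I :: ennreal
          proof -
            have "A * F * B * I = (A * B) * (F * I)" by (simp only: mult_ac)
            also have "\<dots> = C * F * I * D" unfolding that by (simp only: mult_ac)
            finally show ?thesis .
          qed
          ultimately show ?thesis by blast
        qed simp
      qed
      also have "\<dots> = (\<integral>\<^sup>+w. ennreal (exp (- w)) * F (K * w powr (1 - a)) * indicator {0<..} w \<partial>lborel) * ennreal (1 / pi)"
        by (rule nn_integral_multc) measurable
      finally show ?thesis using True by (simp add: K_def mult.assoc)
    qed simp
  qed
  finally show ?thesis .
qed

section \<open>Moments, exponential moments and Laplace transform of the law\<close>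

definition ml_law :: "real \<Rightarrow> real measure" where
  "ml_law a = density lborel (\<lambda>\<theta>. ennreal (ml_density a \<theta>) * indicator {0<..} \<theta>)"

lemma sets_ml_law[simp, measurable_cong]: "sets (ml_law a) = sets borel"
  and space_ml_law[simp]: "space (ml_law a) = UNIV"
  by (simp_all add: ml_law_def)

lemma AE_ml_law_pos: "AE \<theta> in ml_law a. \<theta> > 0"
  unfolding ml_law_def by (subst AE_density) (auto intro!: AE_I2 split: split_indicator)

lemma nn_integral_ml_law:
  assumes a: "0 < a" "a < 1" and F[measurable]: "F \<in> borel_measurable borel"
  shows "(\<integral>\<^sup>+\<theta>. F \<theta> \<partial>ml_law a) =
    (\<integral>\<^sup>+\<phi>. (\<integral>\<^sup>+w. ennreal (exp (- w)) * F (kanter a \<phi> * w powr (1 - a)) * indicator {0<..} w \<partial>lborel)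
        * ennreal (1 / pi) * indicator {0<..<pi} \<phi> \<partial>lborel)"
proof -
  have "(\<integral>\<^sup>+\<theta>. F \<theta> \<partial>ml_law a) = (\<integral>\<^sup>+\<theta>. ennreal (ml_density a \<theta>) * F \<theta> * indicator {0<..} \<theta> \<partial>lborel)"
    unfolding ml_law_def by (subst nn_integral_density) (auto intro!: nn_integral_cong split: split_indicator)
  then show ?thesis using nn_integral_ml_density[OF a F] by simp
qed

lemma nn_integral_exp_powr:
  assumes "s > -1"
  shows "(\<integral>\<^sup>+w. ennreal (exp (- w) * w powr s) * indicator {0<..} w \<partial>lborel) = ennreal (Gamma (1 + s))"
proof -
  have "(\<integral>\<^sup>+w. ennreal (exp (- w) * w powr s) * indicator {0<..} w \<partial>lborel)
     = (\<integral>\<^sup>+w. ennreal (indicator {0..} w * w powr ((1 + s) - 1) / exp w) \<partial>lborel)"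
    by (intro nn_integral_cong) (auto simp: indicator_def exp_minus field_simps)
  then show ?thesis using Gamma_conv_nn_integral_real[of "1 + s"] assms by simp
qed

text \<open>The exponential variable contributes \<open>Gamma (1 + (1 - a) * k)\<close>, which
  cancels the second Gamma factor in \<open>kanter_moment\<close>.\<close>

lemma ml_law_moment:
  assumes a: "0 < a" "a < 1"
  shows "(\<integral>\<^sup>+\<theta>. ennreal (\<theta> ^ k) \<partial>ml_law a) = ennreal (fact k / Gamma (1 + a * k))"
proof -
  let ?L = "\<lambda>K w. ennreal (exp (- w)) * ennreal ((K * w powr (1 - a)) ^ k) * indicator {0<..} w"
  let ?R = "\<lambda>K w. ennreal (K ^ k) * (ennreal (exp (- w) * w powr ((1 - a) * k)) * indicator {0<..} w)"
  define G where "G = Gamma (1 + (1 - a) * k)"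
  have G: "G > 0" unfolding G_def using a by (intro Gamma_real_pos add_pos_nonneg) auto
  have G2: "Gamma (1 + a * k) > 0" using a by (intro Gamma_real_pos add_pos_nonneg) auto
  have inner: "(\<integral>\<^sup>+w. ?L K w \<partial>lborel)
     = ennreal (K ^ k) * ennreal G" if K: "K > 0" for K
  proof -
    have "(\<integral>\<^sup>+w. ?L K w \<partial>lborel)
      = (\<integral>\<^sup>+w. ?R K w \<partial>lborel)"
    proof (intro nn_integral_cong)
      fix w :: real
      show "?L K w
        = ?R K w"
      proof (cases "w > 0")
        case True
        have "(w powr (1 - a)) ^ k = w powr ((1 - a) * k)"
          using True by (simp add: powr_realpow[symmetric] powr_powr)
        then have "exp (- w) * (K * w powr (1 - a)) ^ k = K ^ k * (exp (- w) * w powr ((1 - a) * k))"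
          by (simp add: power_mult_distrib)
        then show ?thesis using True K by (simp add: ennreal_mult[symmetric])
      qed simp
    qed
    also have "\<dots> = ennreal (K ^ k) * ennreal G"
    proof -
      have "(1 - a) * k \<ge> 0" using a by simp
      then show ?thesis
        by (subst nn_integral_cmult) (simp_all add: nn_integral_exp_powr G_def)
    qed
    finally show ?thesis .
  qed
  have "(\<integral>\<^sup>+\<theta>. ennreal (\<theta> ^ k) \<partial>ml_law a) =
     (\<integral>\<^sup>+\<phi>. ennreal (kanter a \<phi> ^ k) * indicator {0<..<pi} \<phi> * ennreal (G / pi) \<partial>lborel)"
    unfolding nn_integral_ml_law[OF a, of "\<lambda>\<theta>. ennreal (\<theta> ^ k)", simplified]
  proof (intro nn_integral_cong)
    fix \<phi> :: real
    show "(\<integral>\<^sup>+w. ennreal (exp (- w)) * ennreal ((kanter a \<phi> * w powr (1 - a)) ^ k) * indicator {0<..} w \<partial>lborel)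
        * ennreal (1 / pi) * indicator {0<..<pi} \<phi> = ennreal (kanter a \<phi> ^ k) * indicator {0<..<pi} \<phi> * ennreal (G / pi)"
    proof (cases "\<phi> \<in> {0<..<pi}")
      case True
      have "ennreal G * ennreal (1 / pi) = ennreal (G / pi)" using G by (simp add: ennreal_mult[symmetric])
      then show ?thesis using True inner[OF kanter_pos[OF a, of \<phi>]] by (simp add: mult.assoc)
    qed simp
  qed
  also have "\<dots> = ennreal (pi * fact k / (Gamma (1 + a * k) * G)) * ennreal (G / pi)"
    by (subst nn_integral_multc) (simp_all add: kanter_moment[OF a] G_def)
  also have "\<dots> = ennreal (fact k / Gamma (1 + a * k))"
    using G G2 by (subst ennreal_mult[symmetric]) (auto simp: field_simps)
  finally show ?thesis .
qed

lemma prob_space_ml_law: "0 < a \<Longrightarrow> a < 1 \<Longrightarrow> prob_space (ml_law a)"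
  by (rule prob_spaceI) (use ml_law_moment[of a 0] in simp)

text \<open>That this stays bounded as \<open>a\<close> tends to \<open>1\<close> is what makes the limsup in the theorem positive.\<close>

definition ml_exp_bound :: "real \<Rightarrow> real \<Rightarrow> real" where
  "ml_exp_bound a c = 2 * exp (c * exp 2 * (2 * c * exp 2) powr ((1 - a) / a))"

lemma ml_law_exp_moment:
  assumes a: "0 < a" "a < 1" and c: "c > 0"
  shows "(\<integral>\<^sup>+\<theta>. ennreal (exp (c * \<theta>)) \<partial>ml_law a) \<le> ennreal (ml_exp_bound a c)"
proof -
  let ?L = "\<lambda>\<phi> w. ennreal (exp (- w)) * ennreal (exp (c * (kanter a \<phi> * w powr (1 - a)))) * indicator {0<..} w"
  define d where "d = c * exp 2"
  define D where "D = d * (2 * d) powr ((1 - a) / a)"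
  have d: "d > 0" using c by (simp add: d_def)
  \<comment> \<open>Split at \<open>w = (2 * d) powr (1 / a)\<close>: below it the power is at most
    its value there, which gives \<open>D\<close>; above it \<open>2 * d \<le> w powr a\<close>, so
    that half of \<open>w\<close> suffices. The other half of the decay survives as
    \<open>exp (- w / 2)\<close>, whose integral is the leading factor 2 of
    \<open>ml_exp_bound\<close>.\<close>
  have key: "d * w powr (1 - a) \<le> w / 2 + D" if w: "w > 0" for w
  proof (cases "w \<le> (2 * d) powr (1 / a)")
    case True
    then have "w powr (1 - a) \<le> ((2 * d) powr (1 / a)) powr (1 - a)"
      using w a by (intro powr_mono2) auto
    also have "\<dots> = (2 * d) powr ((1 - a) / a)" by (simp add: powr_powr)
    finally have "d * w powr (1 - a) \<le> D" using d by (simp add: D_def)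
    then show ?thesis using w by simp
  next
    case False
    then have "((2 * d) powr (1 / a)) powr a \<le> w powr a" using a by (intro powr_mono2) auto
    then have "2 * d \<le> w powr a" using a d by (simp add: powr_powr)
    then have "2 * d * w powr (1 - a) \<le> w powr a * w powr (1 - a)" by (intro mult_right_mono) auto
    also have "\<dots> = w" using w by (simp add: powr_add[symmetric])
    finally show ?thesis using d by (simp add: D_def add_increasing2)
  qed
  have gam: "(\<integral>\<^sup>+w. ennreal (exp (- w / 2)) * indicator {0<..} w \<partial>lborel) = ennreal 2"
  proof -
    have "(\<integral>\<^sup>+w. ennreal (exp (- w / 2)) * indicator {0<..} w \<partial>lborel)
      = (\<integral>\<^sup>+w. ennreal (exp (- (2 * w powr 1) / 2)) * ennreal (2 * 1 * w powr (1 - 1)) * indicator {0<..} w \<partial>lborel)"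
      by (rule nn_integral_powr_substitution) auto
    also have "\<dots> = (\<integral>\<^sup>+w. ennreal 2 * (ennreal (exp (- w) * w powr 0) * indicator {0<..} w) \<partial>lborel)"
      by (intro nn_integral_cong) (auto simp: ennreal_mult indicator_def mult.commute)
    also have "\<dots> = ennreal 2"
      by (subst nn_integral_cmult) (simp_all add: nn_integral_exp_powr[of 0, simplified])
    finally show ?thesis .
  qed
  have "(\<integral>\<^sup>+\<theta>. ennreal (exp (c * \<theta>)) \<partial>ml_law a) \<le>
     (\<integral>\<^sup>+\<phi>. ennreal (2 * exp D / pi) * indicator {0<..<pi} \<phi> \<partial>lborel)"
    unfolding nn_integral_ml_law[OF a, of "\<lambda>\<theta>. ennreal (exp (c * \<theta>))", simplified]
  proof (intro nn_integral_mono)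
    fix \<phi> :: real
    show "(\<integral>\<^sup>+w. ?L \<phi> w \<partial>lborel)
        * ennreal (1 / pi) * indicator {0<..<pi} \<phi> \<le> ennreal (2 * exp D / pi) * indicator {0<..<pi} \<phi>"
    proof (cases "\<phi> \<in> {0<..<pi}")
      case True
      have "(\<integral>\<^sup>+w. ?L \<phi> w \<partial>lborel)
        \<le> (\<integral>\<^sup>+w. ennreal (exp D) * (ennreal (exp (- w / 2)) * indicator {0<..} w) \<partial>lborel)"
      proof (intro nn_integral_mono)
        fix w :: real
        show "?L \<phi> w
          \<le> ennreal (exp D) * (ennreal (exp (- w / 2)) * indicator {0<..} w)"
        proof (cases "w > 0")
          case w: True
          have "c * (kanter a \<phi> * w powr (1 - a)) \<le> c * (exp 2 * w powr (1 - a))"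
            using c kanter_le[OF a, of \<phi>] True by (intro mult_left_mono mult_right_mono) auto
          also have "\<dots> = d * w powr (1 - a)" by (simp add: d_def)
          also have "\<dots> \<le> w / 2 + D" by (rule key[OF w])
          finally have "exp (- w) * exp (c * (kanter a \<phi> * w powr (1 - a))) \<le> exp D * exp (- w / 2)"
            by (simp add: exp_add[symmetric])
          then show ?thesis using w by (simp add: ennreal_mult[symmetric])
        qed simp
      qed
      also have "\<dots> = ennreal (exp D) * ennreal 2" by (subst nn_integral_cmult) (simp_all only: gam, measurable)
      finally have "(\<integral>\<^sup>+w. ?L \<phi> w \<partial>lborel)
         * ennreal (1 / pi) \<le> ennreal (exp D) * ennreal 2 * ennreal (1 / pi)" by (rule mult_right_mono) simp
      also have "\<dots> = ennreal (2 * exp D / pi)"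
        unfolding ennreal_mult'[symmetric, OF exp_ge_zero]
        by (subst ennreal_mult[symmetric]) (auto simp: mult.commute)
      finally show ?thesis using True by simp
    qed simp
  qed
  also have "\<dots> = ennreal (2 * exp D / pi) * ennreal pi"
    by (subst nn_integral_cmult_indicator) auto
  also have "\<dots> = ennreal (2 * exp D)" by (subst ennreal_mult[symmetric]) auto
  finally show ?thesis by (simp add: ml_exp_bound_def D_def d_def mult.assoc)
qed

lemma ml_law_exp_finite:
  assumes a: "0 < a" "a < 1"
  shows "(\<integral>\<^sup>+\<theta>. ennreal (exp (c * \<theta>)) \<partial>ml_law a) < \<infinity>"
proof -
  \<comment> \<open>\<open>\<bar>c\<bar> + 1\<close> is positive, as the moment bound requires, and
    gives a larger integrand because \<open>\<theta> > 0\<close>.\<close>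
  have "(\<integral>\<^sup>+\<theta>. ennreal (exp (c * \<theta>)) \<partial>ml_law a) \<le> (\<integral>\<^sup>+\<theta>. ennreal (exp ((\<bar>c\<bar> + 1) * \<theta>)) \<partial>ml_law a)"
    using AE_ml_law_pos[of a] by (intro nn_integral_mono_AE, eventually_elim) (auto intro!: ennreal_leI mult_right_mono)
  also have "\<dots> \<le> ennreal (ml_exp_bound a (\<bar>c\<bar> + 1))" by (intro ml_law_exp_moment a) auto
  also have "\<dots> < \<infinity>" by simp
  finally show ?thesis .
qed

lemma ml_law_moment_integral:
  assumes a: "0 < a" "a < 1"
  shows "has_bochner_integral (ml_law a) (\<lambda>\<theta>. \<theta> ^ k) (fact k / Gamma (1 + a * k))"
proof (rule has_bochner_integral_nn_integral)
  show "AE \<theta> in ml_law a. 0 \<le> \<theta> ^ k" using AE_ml_law_pos by eventually_elim simp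
  have "Gamma (1 + a * k) > 0" using a by (intro Gamma_real_pos add_pos_nonneg) auto
  then show "0 \<le> fact k / Gamma (1 + a * k)" by simp
qed (simp_all add: ml_law_moment[OF a])

text \<open>The factorials in the moments cancel those of the exponential series, which leaves the
  Mittag-Leffler series for every complex argument.\<close>

lemma ml_law_laplace:
  fixes z :: complex
  assumes a: "0 < a" "a < 1"
  shows "integrable (ml_law a) (\<lambda>\<theta>. exp (z * of_real \<theta>))"
    and "(\<integral>\<theta>. exp (z * of_real \<theta>) \<partial>ml_law a) = mittag_leffler a 1 z"
proof -
  have fin: "(\<integral>\<^sup>+\<theta>. ennreal (exp (norm (z * complex_of_real \<theta>))) \<partial>ml_law a) < \<infinity>"
  proof -
    have "(\<integral>\<^sup>+\<theta>. ennreal (exp (norm (z * complex_of_real \<theta>))) \<partial>ml_law a) = (\<integral>\<^sup>+\<theta>. ennreal (exp (norm z * \<theta>)) \<partial>ml_law a)"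
      using AE_ml_law_pos[of a] by (intro nn_integral_cong_AE, eventually_elim) (simp add: norm_mult)
    then show ?thesis using ml_law_exp_finite[OF a] by simp
  qed
  have m: "(\<lambda>\<theta>. z * complex_of_real \<theta>) \<in> borel_measurable (ml_law a)" by measurable
  note S = integral_exp_series[OF m fin]
  show "integrable (ml_law a) (\<lambda>\<theta>. exp (z * of_real \<theta>))" by (rule S)
  have "(\<integral>\<theta>. (z * complex_of_real \<theta>) ^ k \<partial>ml_law a) / fact k = z ^ k / of_real (Gamma (a * k + 1))" for k
  proof -
    have "(\<integral>\<theta>. (z * complex_of_real \<theta>) ^ k \<partial>ml_law a) = (\<integral>\<theta>. z ^ k * complex_of_real (\<theta> ^ k) \<partial>ml_law a)"
      by (simp add: power_mult_distrib)
    also have "\<dots> = z ^ k * complex_of_real (fact k / Gamma (1 + a * k))"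
      using has_bochner_integral_integral_eq[OF ml_law_moment_integral[OF a, of k]]
      by (simp only: integral_mult_right_zero integral_complex_of_real)
    finally show ?thesis by (simp add: add.commute)
  qed
  then have "(\<lambda>k. z ^ k / of_real (Gamma (a * k + 1))) sums (\<integral>\<theta>. exp (z * of_real \<theta>) \<partial>ml_law a)"
    using S(3) by simp
  then show "(\<integral>\<theta>. exp (z * of_real \<theta>) \<partial>ml_law a) = mittag_leffler a 1 z"
    by (simp add: mittag_leffler_def sums_iff)
qed

section \<open>Identification of the law with the chosen density\<close>

lemma set_integral_density_complex:
  fixes f :: "real \<Rightarrow> complex"
  assumes [measurable]: "h \<in> borel_measurable borel" "f \<in> borel_measurable borel" and pos: "\<And>\<theta>. \<theta> > 0 \<Longrightarrow> h \<theta> > 0"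
  defines "D \<equiv> density lborel (\<lambda>\<theta>. ennreal (h \<theta>) * indicator {0<..} \<theta>)"
  shows "set_integrable lborel {0<..} (\<lambda>\<theta>. of_real (h \<theta>) * f \<theta>) \<longleftrightarrow> integrable D f"
    and "(LINT \<theta>:{0<..}|lborel. of_real (h \<theta>) * f \<theta>) = (\<integral>\<theta>. f \<theta> \<partial>D)"
proof -
  have D: "D = density lborel (\<lambda>\<theta>. ennreal (h \<theta> * indicator {0<..} \<theta>))"
    unfolding D_def by (intro density_cong) (auto intro!: AE_I2 split: split_indicator)
  have nn: "AE \<theta> in lborel. 0 \<le> h \<theta> * indicator {0<..} \<theta>"
    using pos by (auto intro!: AE_I2 less_imp_le split: split_indicator)
  have e: "(h \<theta> * indicator {0<..} \<theta>) *\<^sub>R f \<theta> = indicator {0<..} \<theta> *\<^sub>R (of_real (h \<theta>) * f \<theta>)" for \<theta>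
    by (auto split: split_indicator simp: scaleR_conv_of_real)
  show "set_integrable lborel {0<..} (\<lambda>\<theta>. of_real (h \<theta>) * f \<theta>) \<longleftrightarrow> integrable D f"
    unfolding D set_integrable_def by (subst integrable_density) (use nn e in auto)
  show "(LINT \<theta>:{0<..}|lborel. of_real (h \<theta>) * f \<theta>) = (\<integral>\<theta>. f \<theta> \<partial>D)"
    unfolding D set_lebesgue_integral_def by (subst integral_density) (use nn e in auto)
qed

lemma is_mittag_leffler_density_ml_density:
  assumes a: "0 < a" "a < 1"
  shows "is_mittag_leffler_density a (ml_density a)"
  unfolding is_mittag_leffler_density_def
proof (intro conjI allI impI)
  show "prob_space (density lborel (\<lambda>\<theta>. ennreal (ml_density a \<theta>) * indicator {0<..} \<theta>))"
    using prob_space_ml_law[OF a] by (simp add: ml_law_def)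
  fix z :: complex
  note S = set_integral_density_complex[OF measurable_ml_density[of a], of "\<lambda>\<theta>. exp (z * complex_of_real \<theta>)",
      folded ml_law_def, OF _ ml_density_pos[OF a]]
  show "set_integrable lborel {0<..} (\<lambda>\<theta>. of_real (ml_density a \<theta>) * exp (z * of_real \<theta>))"
    using S(1) ml_law_laplace(1)[OF a] by simp
  show "(LINT \<theta>:{0<..}|lborel. of_real (ml_density a \<theta>) * exp (z * of_real \<theta>)) = mittag_leffler a 1 z"
    using S(2) ml_law_laplace(2)[OF a] by simp
qed (use ml_density_pos[OF a] in auto)

text \<open>\<open>h_density\<close> is an arbitrary choice, so it is accessible only through its
  defining property. \<open>ml_density\<close> shows that the choice succeeds, the Laplace identity
  at imaginary arguments fixes the characteristic function, and Levy's theorem makes the law equal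
  to \<open>ml_law\<close>.\<close>

lemma density_h_density:
  assumes a: "0 < a" "a < 1"
  shows "h_density a \<in> borel_measurable borel"
    and "\<And>\<theta>. \<theta> > 0 \<Longrightarrow> h_density a \<theta> > 0"
    and "density lborel (\<lambda>\<theta>. ennreal (h_density a \<theta>) * indicator {0<..} \<theta>) = ml_law a"
proof -
  have H: "is_mittag_leffler_density a (h_density a)"
    using someI[of "is_mittag_leffler_density a", OF is_mittag_leffler_density_ml_density[OF a]]
    by (simp add: h_density_def)
  then show m[measurable]: "h_density a \<in> borel_measurable borel" and p: "\<And>\<theta>. \<theta> > 0 \<Longrightarrow> h_density a \<theta> > 0"
    by (auto simp: is_mittag_leffler_density_def)
  let ?D = "density lborel (\<lambda>\<theta>. ennreal (h_density a \<theta>) * indicator {0<..} \<theta>)"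
  show "?D = ml_law a"
  proof (rule Levy_uniqueness)
    show "real_distribution ?D"
      using H by (auto simp: is_mittag_leffler_density_def real_distribution_def real_distribution_axioms_def)
    show "real_distribution (ml_law a)"
      using prob_space_ml_law[OF a] by (auto simp: real_distribution_def real_distribution_axioms_def)
    show "char ?D = char (ml_law a)"
    proof
      fix t :: real
      have e: "iexp (t * x) = exp ((\<i> * of_real t) * complex_of_real x)" for x by (simp add: mult.assoc)
      have "char ?D t = (\<integral>\<theta>. exp ((\<i> * of_real t) * complex_of_real \<theta>) \<partial>?D)" unfolding char_def e ..
      also have "\<dots> = mittag_leffler a 1 (\<i> * of_real t)"
        using H set_integral_density_complex(2)[OF m, of "\<lambda>\<theta>. exp ((\<i> * of_real t) * complex_of_real \<theta>)", OF _ p]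
        by (simp add: is_mittag_leffler_density_def)
      also have "\<dots> = char (ml_law a) t" unfolding char_def e using ml_law_laplace(2)[OF a] by simp
      finally show "char ?D t = char (ml_law a) t" .
    qed
  qed
qed

section \<open>Fractional Duhamel integrals in operational time\<close>

text \<open>The case \<open>u = 0\<close> equates the total masses; dividing by that mass, when it
  is positive, reduces the claim to Levy's theorem for probability laws.\<close>

lemma finite_measure_eq_char:
  fixes M N :: "real measure"
  assumes M: "finite_measure M" "sets M = sets borel" and N: "finite_measure N" "sets N = sets borel"
    and eq: "\<And>u. (\<integral>x. iexp (u * x) \<partial>M) = (\<integral>x. iexp (u * x) \<partial>N)"
  shows "M = N"
proof -
  interpret M: finite_measure M by fact
  interpret N: finite_measure N by fact
  note M(2)[measurable_cong] N(2)[measurable_cong]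
  have sp: "space M = UNIV" "space N = UNIV" using M(2) N(2) by (metis space_borel sets_eq_imp_space_eq)+
  define m where "m = measure M UNIV"
  have "measure N UNIV = m" using eq[of 0] sp by (simp add: m_def)
  then have mN: "emeasure N UNIV = ennreal m" using N.emeasure_eq_measure by simp
  have mM: "emeasure M UNIV = ennreal m" using M.emeasure_eq_measure by (simp add: m_def)
  show ?thesis
  proof (cases "m = 0")
    case True
    show ?thesis
    proof (rule measure_eqI)
      fix A assume "A \<in> sets M"
      have "emeasure M A \<le> emeasure M UNIV" "emeasure N A \<le> emeasure N UNIV"
        using sp by (metis emeasure_space)+
      then show "emeasure M A = emeasure N A" using True mM mN by simp
    qed (use M N in simp)
  next
    case False
    then have m: "m > 0" by (simp add: m_def less_le)
    define nrm where "nrm K = density K (\<lambda>_. ennreal (1 / m))" for K :: "real measure"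
    have prob: "real_distribution (nrm K)" if K: "sets K = sets borel" "emeasure K UNIV = ennreal m" for K
    proof -
      have "space K = UNIV" using K(1) by (metis space_borel sets_eq_imp_space_eq)
      then have "emeasure (nrm K) (space (nrm K)) = 1"
        using K m by (simp add: nrm_def emeasure_density_const ennreal_mult[symmetric])
      then have "prob_space (nrm K)" by (rule prob_spaceI)
      then show ?thesis using K by (auto simp: real_distribution_def real_distribution_axioms_def nrm_def)
    qed
    have ch: "char (nrm K) u = (\<integral>x. iexp (u * x) \<partial>K) /\<^sub>R m" if K: "sets K = sets borel" for K u
    proof -
      note K[measurable_cong]
      have "char (nrm K) u = (\<integral>x. (1 / m) *\<^sub>R iexp (u * x) \<partial>K)"
        unfolding char_def nrm_def using m by (subst integral_density) auto
      then show ?thesis by (simp add: divide_inverse)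
    qed
    have "nrm M = nrm N"
      by (rule Levy_uniqueness) (use M N mM mN prob ch eq in \<open>auto simp: fun_eq_iff\<close>)
    moreover have "emeasure K A = ennreal m * emeasure (nrm K) A" if "A \<in> sets K" for K A
    proof -
      have "ennreal m * (ennreal (1 / m) * emeasure K A) = emeasure K A"
        using m by (simp add: mult.assoc[symmetric] ennreal_mult[symmetric])
      then show ?thesis using that by (simp add: nrm_def emeasure_density_const)
    qed
    ultimately show ?thesis using M N by (intro measure_eqI) auto
  qed
qed

text \<open>The right-hand side is a series of mixed moments with nonnegative coefficients. Hence
  finiteness of exponential moments passes from one pair of functions to any other pair with the
  same mixed moments.\<close>

lemma nn_integral_exp_add_eq:
  assumes [measurable]: "a \<in> borel_measurable M" "b \<in> borel_measurable M" 
    and nn: "AE x in M. 0 \<le> a x \<and> 0 \<le> b x" and c: "c \<ge> 0"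
  shows "(\<integral>\<^sup>+x. ennreal (exp (c * (a x + b x))) \<partial>M) =
    (\<Sum>n. \<Sum>j\<le>n. ennreal (c ^ n / fact n * (n choose j)) * (\<integral>\<^sup>+x. ennreal (a x ^ j * b x ^ (n - j)) \<partial>M))"
proof -
  have "(\<integral>\<^sup>+x. ennreal (exp (c * (a x + b x))) \<partial>M) =
    (\<integral>\<^sup>+x. (\<Sum>n. \<Sum>j\<le>n. ennreal (c ^ n / fact n * (n choose j)) * ennreal (a x ^ j * b x ^ (n - j))) \<partial>M)"
    using nn
  proof (intro nn_integral_cong_AE, eventually_elim)
    case (elim x)
    have "ennreal (exp (c * (a x + b x))) = (\<Sum>n. ennreal ((c * (a x + b x)) ^ n /\<^sub>R fact n))"
      using elim c exp_converges[of "c * (a x + b x)"]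
      by (intro suminf_ennreal_eq[symmetric]) (auto intro!: mult_nonneg_nonneg)
    also have "\<dots> = (\<Sum>n. \<Sum>j\<le>n. ennreal (c ^ n / fact n * (n choose j)) * ennreal (a x ^ j * b x ^ (n - j)))"
    proof (intro suminf_cong)
      fix n
      have "(c * (a x + b x)) ^ n /\<^sub>R fact n = (\<Sum>j\<le>n. (c ^ n / fact n * (n choose j)) * (a x ^ j * b x ^ (n - j)))"
        unfolding power_mult_distrib binomial_ring
        by (simp add: sum_distrib_left sum_divide_distrib divide_inverse mult_ac)
      also have "ennreal \<dots> = (\<Sum>j\<le>n. ennreal (c ^ n / fact n * (n choose j)) * ennreal (a x ^ j * b x ^ (n - j)))"
      proof -
        have "ennreal (\<Sum>j\<le>n. (c ^ n / fact n * (n choose j)) * (a x ^ j * b x ^ (n - j)))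
          = (\<Sum>j\<le>n. ennreal ((c ^ n / fact n * (n choose j)) * (a x ^ j * b x ^ (n - j))))"
          using elim c by (intro sum_ennreal[symmetric]) (auto intro!: mult_nonneg_nonneg)
        also have "\<dots> = (\<Sum>j\<le>n. ennreal (c ^ n / fact n * (n choose j)) * ennreal (a x ^ j * b x ^ (n - j)))"
          using elim c by (intro sum.cong refl ennreal_mult) (auto intro!: mult_nonneg_nonneg)
        finally show ?thesis .
      qed
      finally show "ennreal ((c * (a x + b x)) ^ n /\<^sub>R fact n) =
        (\<Sum>j\<le>n. ennreal (c ^ n / fact n * (n choose j)) * ennreal (a x ^ j * b x ^ (n - j)))" .
    qed
    finally show ?case .
  qed
  also have "\<dots> = (\<Sum>n. \<Sum>j\<le>n. ennreal (c ^ n / fact n * (n choose j)) * (\<integral>\<^sup>+x. ennreal (a x ^ j * b x ^ (n - j)) \<partial>M))"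
    by (simp add: nn_integral_suminf nn_integral_sum nn_integral_cmult)
  finally show ?thesis .
qed

text \<open>Only mixed moments occur on the right, so they determine the joint transform at all
  complex arguments. Finite exponential moments supply the domination and the integrability of all
  the monomials.\<close>

lemma integral_exp_linear_combination:
  fixes p q :: complex
  assumes [measurable]: "a \<in> borel_measurable M" "b \<in> borel_measurable M" 
    and nn: "AE x in M. 0 \<le> a x \<and> 0 \<le> b x"
    and fin: "\<And>c. c \<ge> 0 \<Longrightarrow> (\<integral>\<^sup>+x. ennreal (exp (c * (a x + b x))) \<partial>M) < \<infinity>"
  shows "integrable M (\<lambda>x. exp (p * of_real (a x) + q * of_real (b x)))"
    and "(\<integral>x. exp (p * of_real (a x) + q * of_real (b x)) \<partial>M) =
      (\<Sum>n. (\<Sum>j\<le>n. of_nat (n choose j) * p ^ j * q ^ (n - j) *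
         of_real (enn2real (\<integral>\<^sup>+x. ennreal (a x ^ j * b x ^ (n - j)) \<partial>M))) / fact n)"
proof -
  define X where "X x = p * complex_of_real (a x) + q * complex_of_real (b x)" for x
  have X[measurable]: "X \<in> borel_measurable M" unfolding X_def by measurable
  define c where "c = norm p + norm q"
  have finX: "(\<integral>\<^sup>+x. ennreal (exp (norm (X x))) \<partial>M) < \<infinity>"
  proof -
    have "(\<integral>\<^sup>+x. ennreal (exp (norm (X x))) \<partial>M) \<le> (\<integral>\<^sup>+x. ennreal (exp (c * (a x + b x))) \<partial>M)"
      using nn
    proof (intro nn_integral_mono_AE, eventually_elim)
      case (elim x)
      have "norm (X x) \<le> norm p * a x + norm q * b x"
        unfolding X_def using elim by (intro order_trans[OF norm_triangle_ineq]) (simp add: norm_mult)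
      also have "\<dots> \<le> c * (a x + b x)" using elim by (simp add: c_def algebra_simps)
      finally show ?case by (intro ennreal_leI) simp
    qed
    also have "\<dots> < \<infinity>" by (rule fin) (simp add: c_def)
    finally show ?thesis .
  qed
  note S = integral_exp_series[OF X finX]
  show "integrable M (\<lambda>x. exp (p * of_real (a x) + q * of_real (b x)))" using S(2) by (simp add: X_def)
  have int: "integrable M (\<lambda>x. a x ^ j * b x ^ k)" for j k
  proof (rule integrableI_nonneg)
    show nn': "AE x in M. 0 \<le> a x ^ j * b x ^ k" using nn by eventually_elim simp
    have "(\<integral>\<^sup>+x. ennreal (a x ^ j * b x ^ k) \<partial>M) \<le> (\<integral>\<^sup>+x. ennreal (fact (j + k)) * ennreal (exp (1 * (a x + b x))) \<partial>M)"
      using nn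
    proof (intro nn_integral_mono_AE, eventually_elim)
      case (elim x)
      have "a x ^ j * b x ^ k \<le> (a x + b x) ^ j * (a x + b x) ^ k"
        using elim by (intro mult_mono power_mono) auto
      also have "\<dots> = (a x + b x) ^ (j + k)" by (simp add: power_add)
      also have "\<dots> \<le> fact (j + k) * exp (a x + b x)"
        using sum_le_suminf[OF summable_exp_generic[of "a x + b x"], of "{j + k}"] elim
        by (simp add: exp_def field_simps)
      finally show ?case by (simp add: ennreal_mult'[symmetric])
    qed
    also have "\<dots> < \<infinity>" using fin[of 1] by (subst nn_integral_cmult) (auto simp: ennreal_mult_less_top)
    finally show "(\<integral>\<^sup>+x. ennreal (a x ^ j * b x ^ k) \<partial>M) < \<infinity>" .
  qed measurable
  have eq: "(\<integral>x. a x ^ j * b x ^ k \<partial>M) = enn2real (\<integral>\<^sup>+x. ennreal (a x ^ j * b x ^ k) \<partial>M)" for j k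
  proof (rule integral_eq_nn_integral)
    show "AE x in M. 0 \<le> a x ^ j * b x ^ k" using nn by eventually_elim simp
  qed measurable
  have "(\<integral>x. X x ^ n \<partial>M) = (\<Sum>j\<le>n. of_nat (n choose j) * p ^ j * q ^ (n - j) *
         of_real (enn2real (\<integral>\<^sup>+x. ennreal (a x ^ j * b x ^ (n - j)) \<partial>M)))" for n
  proof -
    have "X x ^ n = (\<Sum>j\<le>n. (of_nat (n choose j) * p ^ j * q ^ (n - j)) * complex_of_real (a x ^ j * b x ^ (n - j)))" for x
      unfolding X_def binomial_ring by (simp add: power_mult_distrib mult_ac)
    then have "(\<integral>x. X x ^ n \<partial>M) = (\<Sum>j\<le>n. \<integral>x. (of_nat (n choose j) * p ^ j * q ^ (n - j)) * complex_of_real (a x ^ j * b x ^ (n - j)) \<partial>M)"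
      using int by (simp only: Bochner_Integration.integral_sum integrable_mult_right integrable_of_real)
    also have "\<dots> = (\<Sum>j\<le>n. of_nat (n choose j) * p ^ j * q ^ (n - j) *
         of_real (enn2real (\<integral>\<^sup>+x. ennreal (a x ^ j * b x ^ (n - j)) \<partial>M)))"
      unfolding integral_mult_right_zero integral_complex_of_real eq ..
    finally show ?thesis .
  qed
  then show "(\<integral>x. exp (p * of_real (a x) + q * of_real (b x)) \<partial>M) =
      (\<Sum>n. (\<Sum>j\<le>n. of_nat (n choose j) * p ^ j * q ^ (n - j) *
         of_real (enn2real (\<integral>\<^sup>+x. ennreal (a x ^ j * b x ^ (n - j)) \<partial>M))) / fact n)"
    using S(3) by (simp add: sums_iff X_def)
qed

text \<open>The weight \<open>exp (- \<kappa> * b)\<close> is put into the measure, which is then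
  pushed forward along \<open>a + b\<close>. The result is a finite measure on the line whose
  characteristic function is the joint transform at \<open>\<i> * u\<close> and
  \<open>\<i> * u - \<kappa>\<close>, hence is fixed by the mixed moments.\<close>

lemma nn_integral_exp_minus_mult_eq_if_moments_eq:
  fixes M1 :: "'a measure" and M2 :: "'b measure"
  assumes m1[measurable]: "a1 \<in> borel_measurable M1" "b1 \<in> borel_measurable M1"
    and m2[measurable]: "a2 \<in> borel_measurable M2" "b2 \<in> borel_measurable M2"
    and nn1: "AE x in M1. 0 \<le> a1 x \<and> 0 \<le> b1 x" and nn2: "AE x in M2. 0 \<le> a2 x \<and> 0 \<le> b2 x"
    and mom: "\<And>j k. (\<integral>\<^sup>+x. ennreal (a1 x ^ j * b1 x ^ k) \<partial>M1) = (\<integral>\<^sup>+x. ennreal (a2 x ^ j * b2 x ^ k) \<partial>M2)"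
    and fin1: "\<And>c. c \<ge> 0 \<Longrightarrow> (\<integral>\<^sup>+x. ennreal (exp (c * (a1 x + b1 x))) \<partial>M1) < \<infinity>"
    and \<kappa>: "\<kappa> \<ge> 0" and G[measurable]: "G \<in> borel_measurable borel"
  shows "(\<integral>\<^sup>+x. ennreal (exp (- \<kappa> * b1 x)) * G (a1 x + b1 x) \<partial>M1) =
    (\<integral>\<^sup>+x. ennreal (exp (- \<kappa> * b2 x)) * G (a2 x + b2 x) \<partial>M2)"
proof -
  have fin2: "(\<integral>\<^sup>+x. ennreal (exp (c * (a2 x + b2 x))) \<partial>M2) < \<infinity>" if "c \<ge> 0" for c
    using fin1[OF that] unfolding nn_integral_exp_add_eq[OF m1 nn1 that] nn_integral_exp_add_eq[OF m2 nn2 that] mom .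
  define D1 where "D1 = distr (density M1 (\<lambda>x. ennreal (exp (- \<kappa> * b1 x)))) borel (\<lambda>x. a1 x + b1 x)"
  define D2 where "D2 = distr (density M2 (\<lambda>x. ennreal (exp (- \<kappa> * b2 x)))) borel (\<lambda>x. a2 x + b2 x)"
  have "D1 = D2"
  proof (rule finite_measure_eq_char)
    have fm: "finite_measure (distr (density M (\<lambda>x. ennreal (exp (- \<kappa> * b x)))) borel (\<lambda>x. a x + b x))"
      if [measurable]: "a \<in> borel_measurable M" "b \<in> borel_measurable M" and nn: "AE x in M. 0 \<le> a x \<and> 0 \<le> b x"
       and f: "(\<integral>\<^sup>+x. ennreal (exp (0 * (a x + b x))) \<partial>M) < \<infinity>" for a b and M :: "'c measure"
    proof (rule finite_measureI)
      have "emeasure (distr (density M (\<lambda>x. ennreal (exp (- \<kappa> * b x)))) borel (\<lambda>x. a x + b x)) UNIV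
        = (\<integral>\<^sup>+x. ennreal (exp (- \<kappa> * b x)) \<partial>M)"
        by (subst emeasure_distr, measurable, subst emeasure_density)
           (auto intro!: nn_integral_cong split: split_indicator)
      also have "\<dots> \<le> (\<integral>\<^sup>+x. ennreal (exp (0 * (a x + b x))) \<partial>M)"
        using nn by (intro nn_integral_mono_AE, eventually_elim) (auto intro!: mult_nonneg_nonneg \<kappa>)
      finally show "emeasure (distr (density M (\<lambda>x. ennreal (exp (- \<kappa> * b x)))) borel (\<lambda>x. a x + b x))
         (space (distr (density M (\<lambda>x. ennreal (exp (- \<kappa> * b x)))) borel (\<lambda>x. a x + b x))) \<noteq> \<infinity>"
        using f by auto
    qed
    show "finite_measure D1" unfolding D1_def by (rule fm[OF m1 nn1 fin1]) simp
    show "finite_measure D2" unfolding D2_def by (rule fm[OF m2 nn2 fin2]) simp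
    fix u :: real
    have ch: "(\<integral>x. iexp (u * x) \<partial>(distr (density M (\<lambda>x. ennreal (exp (- \<kappa> * b x)))) borel (\<lambda>x. a x + b x)))
       = (\<integral>x. exp ((\<i> * u) * of_real (a x) + (\<i> * u - \<kappa>) * of_real (b x)) \<partial>M)"
      if [measurable]: "a \<in> borel_measurable M" "b \<in> borel_measurable M" for a b and M :: "'c measure"
    proof -
      have "exp (- \<kappa> * b x) *\<^sub>R iexp (u * (a x + b x)) = exp ((\<i> * u) * of_real (a x) + (\<i> * u - \<kappa>) * of_real (b x))" for x
        unfolding scaleR_conv_of_real exp_of_real[symmetric] exp_add[symmetric] by (simp add: algebra_simps)
      then show ?thesis
        by (subst integral_distr, measurable, subst integral_density) auto
    qed
    show "(\<integral>x. iexp (u * x) \<partial>D1) = (\<integral>x. iexp (u * x) \<partial>D2)"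
      unfolding D1_def D2_def ch[OF m1] ch[OF m2]
      using integral_exp_linear_combination(2)[of a1 M1 b1, OF m1 nn1 fin1]
        integral_exp_linear_combination(2)[of a2 M2 b2, OF m2 nn2 fin2] by (simp add: mom)
  qed (simp_all add: D1_def D2_def)
  have nd: "(\<integral>\<^sup>+x. G x \<partial>(distr (density M (\<lambda>x. ennreal (exp (- \<kappa> * b x)))) borel (\<lambda>x. a x + b x)))
     = (\<integral>\<^sup>+x. ennreal (exp (- \<kappa> * b x)) * G (a x + b x) \<partial>M)"
    if [measurable]: "a \<in> borel_measurable M" "b \<in> borel_measurable M" for a b and M :: "'c measure"
    by (subst nn_integral_distr, measurable, subst nn_integral_density) auto
  show ?thesis using \<open>D1 = D2\<close> nd[OF m1] nd[OF m2] unfolding D1_def D2_def by simp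
qed

lemma nn_integral_beta_kernel:
  fixes x y t :: real
  assumes "x > 0" "y > 0" "t > 0"
  shows "(\<integral>\<^sup>+s. ennreal ((t - s) powr (x - 1) * s powr (y - 1)) * indicator {0<..<t} s \<partial>lborel)
    = ennreal (t powr (x + y - 1) * (Gamma x * Gamma y / Gamma (x + y)))"
proof -
  have B: "(\<integral>\<^sup>+s. ennreal (s powr (y - 1) * (1 - s) powr (x - 1)) * indicator {0<..<1} s \<partial>lborel) = ennreal (Beta y x)"
    using has_integral_Beta_real[of y x] assms
    by (intro nn_integral_has_integral_lebesgue') (auto simp: has_integral_Icc_iff_Ioo)
  have Bpos: "Beta y x \<ge> 0" using assms by (simp add: Beta_def)
  have "(\<integral>\<^sup>+s. ennreal ((t - s) powr (x - 1) * s powr (y - 1)) * indicator {0<..<t} s \<partial>lborel)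
    = ennreal t * (\<integral>\<^sup>+s. ennreal ((t - (0 + t * s)) powr (x - 1) * (0 + t * s) powr (y - 1)) * indicator {0<..<t} (0 + t * s) \<partial>lborel)"
    using assms by (subst nn_integral_real_affine[where c = t and t = 0]) auto
  also have "(\<integral>\<^sup>+s. ennreal ((t - (0 + t * s)) powr (x - 1) * (0 + t * s) powr (y - 1)) * indicator {0<..<t} (0 + t * s) \<partial>lborel)
    = (\<integral>\<^sup>+s. ennreal (t powr (x + y - 2)) * (ennreal (s powr (y - 1) * (1 - s) powr (x - 1)) * indicator {0<..<1} s) \<partial>lborel)"
  proof (intro nn_integral_cong)
    fix s :: real
    show "ennreal ((t - (0 + t * s)) powr (x - 1) * (0 + t * s) powr (y - 1)) * indicator {0<..<t} (0 + t * s)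
      = ennreal (t powr (x + y - 2)) * (ennreal (s powr (y - 1) * (1 - s) powr (x - 1)) * indicator {0<..<1} s)"
    proof (cases "s \<in> {0<..<1}")
      case True
      have "t - t * s = t * (1 - s)" by (simp add: algebra_simps)
      then have "(t - t * s) powr (x - 1) * (t * s) powr (y - 1)
         = (t powr (x - 1) * t powr (y - 1)) * (s powr (y - 1) * (1 - s) powr (x - 1))"
        using True assms by (simp add: powr_mult)
      also have "t powr (x - 1) * t powr (y - 1) = t powr (x + y - 2)"
        by (simp add: powr_add[symmetric] algebra_simps)
      finally show ?thesis using True assms by (simp add: ennreal_mult)
    next
      case False
      then have "t * s \<notin> {0<..<t}" using assms by (auto simp: zero_less_mult_iff)
      then show ?thesis using False by simp
    qed
  qed
  also have "\<dots> = ennreal (t powr (x + y - 2)) * ennreal (Beta y x)"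
    by (subst nn_integral_cmult) (simp_all add: B)
  also have "ennreal t * (ennreal (t powr (x + y - 2)) * ennreal (Beta y x)) = ennreal (t * t powr (x + y - 2) * Beta y x)"
    using assms Bpos by (simp add: ennreal_mult mult.assoc)
  also have "t * t powr (x + y - 2) = t powr (x + y - 1)"
    using assms powr_add[of t 1 "x + y - 2"] by (simp add: algebra_simps)
  also have "Beta y x = Gamma x * Gamma y / Gamma (x + y)" by (simp add: Beta_def add.commute mult.commute)
  finally show ?thesis .
qed

lemma nn_integral_beta_kernel_nat:
  assumes "t > 0"
  shows "(\<integral>\<^sup>+s. ennreal ((t - s) ^ j * s ^ k) * indicator {0<..<t} s \<partial>lborel)
    = ennreal (t ^ (j + k + 1) * (fact j * fact k / fact (j + k + 1)))"
proof -
  have "(\<integral>\<^sup>+s. ennreal ((t - s) ^ j * s ^ k) * indicator {0<..<t} s \<partial>lborel)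
    = (\<integral>\<^sup>+s. ennreal ((t - s) powr ((1 + real j) - 1) * s powr ((1 + real k) - 1)) * indicator {0<..<t} s \<partial>lborel)"
    by (intro nn_integral_cong) (auto simp: powr_realpow split: split_indicator)
  also have "\<dots> = ennreal (t powr ((1 + real j) + (1 + real k) - 1) * (Gamma (1 + real j) * Gamma (1 + real k) / Gamma ((1 + real j) + (1 + real k))))"
    using assms by (intro nn_integral_beta_kernel) auto
  also have "(1 + real j) + (1 + real k) - 1 = real (j + k + 1)" by simp
  also have "(1 + real j) + (1 + real k) = 1 + real (j + k + 1)" by simp
  finally show ?thesis unfolding Gamma_fact powr_realpow[OF assms] .
qed

section \<open>The Duhamel identity in operational time\<close>

context
  fixes a t :: real
  assumes a: "0 < a" "a < 1" and t: "t > 0"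
begin

interpretation L: prob_space "ml_law a" by (rule prob_space_ml_law[OF a])
interpretation LL: pair_prob_space "ml_law a" "ml_law a" ..
interpretation LB: pair_sigma_finite "ml_law a" "lborel :: real measure" ..
interpretation BLL: pair_sigma_finite "lborel :: real measure" "ml_law a \<Otimes>\<^sub>M ml_law a" ..

private abbreviation "P1 \<equiv> ml_law a \<Otimes>\<^sub>M (lborel :: real measure)"
private abbreviation "P2 \<equiv> (lborel :: real measure) \<Otimes>\<^sub>M (ml_law a \<Otimes>\<^sub>M ml_law a)"
text \<open>Index 1 describes a Duhamel integral run in operational time up to
  \<open>t powr a * \<theta>\<close>, index 2 the fractional one: \<open>q\<close> is the
  operational time elapsed, \<open>p\<close> the time remaining, \<open>w\<close> the weight. The
  factor \<open>\<phi>\<close> in \<open>w2\<close> is the size bias of \<open>S_op\<close>, which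
  averages with \<open>\<theta> * h_density a \<theta>\<close>.\<close>

private definition "w1 = (\<lambda>(\<theta>::real, \<tau>::real). indicator {0<..<t powr a * \<theta>} \<tau> :: ennreal)"
private definition "w2 = (\<lambda>(s::real, \<phi>::real, \<theta>::real). ennreal (a * (t - s) powr (a - 1)) * indicator {0<..<t} s * ennreal \<phi>)"
private definition "p1 = (\<lambda>(\<theta>::real, \<tau>::real). t powr a * \<theta> - \<tau>)"
private definition "q1 = (\<lambda>(\<theta>::real, \<tau>::real). \<tau>)"
private definition "p2 = (\<lambda>(s::real, \<phi>::real, \<theta>::real). (t - s) powr a * \<phi>)"
private definition "q2 = (\<lambda>(s::real, \<phi>::real, \<theta>::real). s powr a * \<theta>)"

private lemma measurable_w1: "w1 \<in> borel_measurable P1" 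
proof -
  have "w1 = (\<lambda>x. indicator {y. 0 < snd y \<and> snd y < t powr a * fst y} x)"
    by (auto simp: w1_def fun_eq_iff split: split_indicator)
  then show ?thesis by simp
qed

private lemma measurable_coordinates: "w2 \<in> borel_measurable P2" "p1 \<in> borel_measurable P1" "q1 \<in> borel_measurable P1"
  "p2 \<in> borel_measurable P2" "q2 \<in> borel_measurable P2"
  unfolding w2_def p1_def q1_def p2_def q2_def by measurable

private lemma nn_integral_P1:
  assumes [measurable]: "F \<in> borel_measurable P1"
  shows "(\<integral>\<^sup>+x. w1 x * F x \<partial>P1) = (\<integral>\<^sup>+\<theta>. (\<integral>\<^sup>+\<tau>. F (\<theta>, \<tau>) * indicator {0<..<t powr a * \<theta>} \<tau> \<partial>lborel) \<partial>ml_law a)"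
proof -
  note measurable_w1[measurable]
  have "(\<integral>\<^sup>+x. w1 x * F x \<partial>P1) = (\<integral>\<^sup>+\<theta>. (\<integral>\<^sup>+\<tau>. w1 (\<theta>, \<tau>) * F (\<theta>, \<tau>) \<partial>lborel) \<partial>ml_law a)"
    by (rule lborel.nn_integral_fst[symmetric]) measurable
  then show ?thesis by (simp add: w1_def mult.commute)
qed

private lemma nn_integral_P2:
  assumes [measurable]: "F \<in> borel_measurable P2"
  shows "(\<integral>\<^sup>+x. w2 x * F x \<partial>P2) = (\<integral>\<^sup>+s. ennreal (a * (t - s) powr (a - 1)) * indicator {0<..<t} s *
      (\<integral>\<^sup>+\<phi>. ennreal \<phi> * (\<integral>\<^sup>+\<theta>. F (s, \<phi>, \<theta>) \<partial>ml_law a) \<partial>ml_law a) \<partial>lborel)"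
proof -
  note measurable_coordinates[measurable]
  have "(\<integral>\<^sup>+x. w2 x * F x \<partial>P2) = (\<integral>\<^sup>+s. (\<integral>\<^sup>+y. w2 (s, y) * F (s, y) \<partial>(ml_law a \<Otimes>\<^sub>M ml_law a)) \<partial>lborel)"
    by (rule LL.P.nn_integral_fst[symmetric]) measurable
  also have "\<dots> = (\<integral>\<^sup>+s. (\<integral>\<^sup>+\<phi>. (\<integral>\<^sup>+\<theta>. w2 (s, \<phi>, \<theta>) * F (s, \<phi>, \<theta>) \<partial>ml_law a) \<partial>ml_law a) \<partial>lborel)"
    by (intro nn_integral_cong L.nn_integral_fst[symmetric]) measurable
  also have "\<dots> = (\<integral>\<^sup>+s. ennreal (a * (t - s) powr (a - 1)) * indicator {0<..<t} s *
      (\<integral>\<^sup>+\<phi>. ennreal \<phi> * (\<integral>\<^sup>+\<theta>. F (s, \<phi>, \<theta>) \<partial>ml_law a) \<partial>ml_law a) \<partial>lborel)"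
    by (intro nn_integral_cong) (simp add: w2_def nn_integral_cmult mult.assoc)
  finally show ?thesis .
qed

private lemma AE_P1: "AE x in density P1 w1. 0 \<le> p1 x \<and> 0 \<le> q1 x"
  by (subst AE_density[OF measurable_w1]) (auto intro!: AE_I2 simp: w1_def p1_def q1_def indicator_def of_bool_def split: if_splits)

private lemma AE_law2: "AE x in P2. fst (snd x) > 0 \<and> snd (snd x) > 0"
proof -
  have "AE y in ml_law a \<Otimes>\<^sub>M ml_law a. fst y > 0 \<and> snd y > 0"
  proof (rule LL.AE_pair_measure)
    show "AE x in ml_law a. AE y in ml_law a. fst (x, y) > 0 \<and> snd (x, y) > 0"
      using AE_ml_law_pos[of a]
    proof eventually_elim
      case (elim x)
      then show ?case using AE_ml_law_pos[of a] by simp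
    qed
  qed measurable
  then have "AE x in lborel. AE y in ml_law a \<Otimes>\<^sub>M ml_law a. fst (snd (x::real, y)) > 0 \<and> snd (snd (x, y)) > 0"
    by simp
  then show ?thesis by (intro BLL.AE_pair_measure) measurable
qed

private lemma AE_P2: "AE x in density P2 w2. 0 \<le> p2 x \<and> 0 \<le> q2 x"
  using AE_law2 by (subst AE_density[OF measurable_coordinates(1)], eventually_elim) (auto simp: p2_def q2_def)

text \<open>Both sides equal \<open>j! k! t powr (a n) / Gamma (1 + a n)\<close> with \<open>n = j + k + 1\<close>.\<close>

private lemma moments_eq:
  "(\<integral>\<^sup>+x. ennreal (p1 x ^ j * q1 x ^ k) \<partial>density P1 w1) = (\<integral>\<^sup>+x. ennreal (p2 x ^ j * q2 x ^ k) \<partial>density P2 w2)"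
proof -
  let ?P = "\<lambda>j s k. ((t - s) powr a) ^ j * (s powr a) ^ k"
  note measurable_w1[measurable] measurable_coordinates[measurable]
  define n where "n = j + k + 1"
  have G0: "Gamma (1 + a * m) > 0" for m :: nat using a by (intro Gamma_real_pos add_pos_nonneg) auto
  have "(\<integral>\<^sup>+x. ennreal (p1 x ^ j * q1 x ^ k) \<partial>density P1 w1)
     = (\<integral>\<^sup>+\<theta>. (\<integral>\<^sup>+\<tau>. ennreal ((t powr a * \<theta> - \<tau>) ^ j * \<tau> ^ k) * indicator {0<..<t powr a * \<theta>} \<tau> \<partial>lborel) \<partial>ml_law a)"
    by (subst nn_integral_density) (auto simp: nn_integral_P1 p1_def q1_def)
  also have "\<dots> = (\<integral>\<^sup>+\<theta>. ennreal ((t powr a) ^ n * (fact j * fact k / fact n)) * ennreal (\<theta> ^ n) \<partial>ml_law a)"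
    using AE_ml_law_pos[of a]
  proof (intro nn_integral_cong_AE, eventually_elim)
    case (elim \<theta>)
    then show ?case
      using t nn_integral_beta_kernel_nat[of "t powr a * \<theta>" j k, folded n_def]
      by (simp add: ennreal_mult[symmetric] power_mult_distrib mult_ac)
  qed
  also have "\<dots> = ennreal ((t powr a) ^ n * (fact j * fact k / fact n)) * ennreal (fact n / Gamma (1 + a * n))"
    by (simp add: nn_integral_cmult ml_law_moment[OF a])
  also have "\<dots> = ennreal ((t powr a) ^ n * (fact j * fact k / Gamma (1 + a * n)))"
    using G0[of n] by (simp add: ennreal_mult[symmetric])
  finally have m1: "(\<integral>\<^sup>+x. ennreal (p1 x ^ j * q1 x ^ k) \<partial>density P1 w1)
     = ennreal ((t powr a) ^ n * (fact j * fact k / Gamma (1 + a * n)))" .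
  \<comment> \<open>The moment of order \<open>Suc j\<close>, not \<open>j\<close>: the size bias in
    \<open>w2\<close> supplies one more factor \<open>\<phi>\<close>.\<close>
  define C1 where "C1 = fact (Suc j) / Gamma (1 + a * Suc j)"
  define C2 where "C2 = fact k / Gamma (1 + a * k)"
  have C: "C1 \<ge> 0" "C2 \<ge> 0" unfolding C1_def C2_def using less_imp_le[OF G0] by (simp_all del: of_nat_Suc)
  have in2: "(\<integral>\<^sup>+\<phi>. ennreal \<phi> * (\<integral>\<^sup>+\<theta>. ennreal (((t - s) powr a * \<phi>) ^ j * (s powr a * \<theta>) ^ k) \<partial>ml_law a) \<partial>ml_law a)
     = ennreal (?P j s k * (C1 * C2))" for s
  proof -
    have "(\<integral>\<^sup>+\<phi>. ennreal \<phi> * (\<integral>\<^sup>+\<theta>. ennreal (((t - s) powr a * \<phi>) ^ j * (s powr a * \<theta>) ^ k) \<partial>ml_law a) \<partial>ml_law a)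
      = (\<integral>\<^sup>+\<phi>. ennreal (?P j s k * C2) * ennreal (\<phi> ^ Suc j) \<partial>ml_law a)"
      using AE_ml_law_pos[of a]
    proof (intro nn_integral_cong_AE, eventually_elim)
      case (elim \<phi>)
      have "(\<integral>\<^sup>+\<theta>. ennreal (((t - s) powr a * \<phi>) ^ j * (s powr a * \<theta>) ^ k) \<partial>ml_law a)
        = (\<integral>\<^sup>+\<theta>. ennreal (((t - s) powr a * \<phi>) ^ j * (s powr a) ^ k) * ennreal (\<theta> ^ k) \<partial>ml_law a)"
        using elim by (intro nn_integral_cong) (simp add: power_mult_distrib ennreal_mult'[symmetric] ennreal_mult''[symmetric] mult_ac)
      also have "\<dots> = ennreal (((t - s) powr a * \<phi>) ^ j * (s powr a) ^ k) * ennreal C2"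
        by (simp add: nn_integral_cmult ml_law_moment[OF a] C2_def)
      finally show ?case
        using elim C by (simp add: ennreal_mult[symmetric] power_mult_distrib mult_ac)
    qed
    also have "\<dots> = ennreal (?P j s k * C2) * ennreal C1"
      by (subst nn_integral_cmult) (simp_all only: ml_law_moment[OF a] C1_def, measurable)
    also have "\<dots> = ennreal (?P j s k * (C1 * C2))"
      using C by (simp add: ennreal_mult[symmetric] mult_ac)
    finally show ?thesis .
  qed
  have "(\<integral>\<^sup>+x. ennreal (p2 x ^ j * q2 x ^ k) \<partial>density P2 w2)
    = (\<integral>\<^sup>+s. ennreal (a * (t - s) powr (a - 1)) * indicator {0<..<t} s * ennreal (?P j s k * (C1 * C2)) \<partial>lborel)"
    by (subst nn_integral_density) (auto simp: nn_integral_P2 p2_def q2_def in2)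
  also have "\<dots> = (\<integral>\<^sup>+s. ennreal (a * (C1 * C2)) * (ennreal ((t - s) powr (a * Suc j - 1) * s powr ((1 + a * k) - 1)) * indicator {0<..<t} s) \<partial>lborel)"
  proof (intro nn_integral_cong)
    fix s
    show "ennreal (a * (t - s) powr (a - 1)) * indicator {0<..<t} s * ennreal (?P j s k * (C1 * C2))
      = ennreal (a * (C1 * C2)) * (ennreal ((t - s) powr (a * Suc j - 1) * s powr ((1 + a * k) - 1)) * indicator {0<..<t} s)"
    proof (cases "s \<in> {0<..<t}")
      case True
      then have s: "s > 0" "t - s > 0" by auto
      have "(t - s) powr (a * Suc j - 1) = (t - s) powr (a - 1) * ((t - s) powr a) ^ j"
        using s by (simp add: powr_realpow[symmetric] powr_powr powr_add[symmetric] algebra_simps)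
      moreover have "s powr ((1 + a * k) - 1) = (s powr a) ^ k"
        using s by (simp add: powr_realpow[symmetric] powr_powr)
      ultimately show ?thesis using True s a C by (simp add: ennreal_mult[symmetric] mult_ac)
    qed simp
  qed
  also have "\<dots> = ennreal (a * (C1 * C2)) * ennreal (t powr (a * Suc j + (1 + a * k) - 1) *
      (Gamma (a * Suc j) * Gamma (1 + a * k) / Gamma (a * Suc j + (1 + a * k))))"
    using a t by (subst nn_integral_cmult, simp) (subst nn_integral_beta_kernel; (simp add: add_pos_nonneg)?)
  also have "a * Suc j + (1 + a * k) - 1 = a * n" by (simp add: n_def algebra_simps)
  also have "a * Suc j + (1 + a * k) = 1 + a * n" by (simp add: n_def algebra_simps)
  also have "ennreal (a * (C1 * C2)) * ennreal (t powr (a * n) * (Gamma (a * Suc j) * Gamma (1 + a * k) / Gamma (1 + a * n)))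
     = ennreal ((t powr a) ^ n * (fact j * fact k / Gamma (1 + a * n)))"
  proof -
    have p: "Gamma (a * Suc j) > 0" using a by (intro Gamma_real_pos) auto
    \<comment> \<open>The functional equation of Gamma absorbs the leading factor \<open>a\<close>
      of the fractional kernel and turns \<open>fact (Suc j)\<close> into
      \<open>fact j\<close>.\<close>
    have "Gamma (1 + a * Suc j) = (a * Suc j) * Gamma (a * Suc j)"
    proof -
      have "a * Suc j > 0" using a by simp
      then have "a * Suc j \<notin> \<int>\<^sub>\<le>\<^sub>0" using nonpos_Ints_nonpos by fastforce
      then show ?thesis using Gamma_plus1[of "a * Suc j"] by (simp add: add.commute)
    qed
    then have "a * C1 * Gamma (a * Suc j) = fact j"
    proof -
      have "a * ((N * F) / ((a * N) * g)) * g = F" if "g > 0" "N > 0" for N F g :: real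
        using that a by (simp add: field_simps)
      from this[OF p, of "real (Suc j)" "fact j"] show ?thesis
        using \<open>Gamma (1 + a * Suc j) = (a * Suc j) * Gamma (a * Suc j)\<close>
        unfolding C1_def fact_Suc by simp
    qed
    moreover have "C2 * Gamma (1 + a * k) = fact k" using G0[of k] by (simp add: C2_def)
    moreover have "a * (C1 * C2) * (t powr (a * n) * (Gamma (a * Suc j) * Gamma (1 + a * k) / Gamma (1 + a * n)))
      = t powr (a * n) * ((a * C1 * Gamma (a * Suc j)) * (C2 * Gamma (1 + a * k)) / Gamma (1 + a * n))"
      by (simp add: field_simps)
    moreover have "t powr (a * n) = (t powr a) ^ n" using t by (simp add: powr_realpow[symmetric] powr_powr)
    ultimately have "a * (C1 * C2) * (t powr (a * n) * (Gamma (a * Suc j) * Gamma (1 + a * k) / Gamma (1 + a * n)))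
       = (t powr a) ^ n * (fact j * fact k / Gamma (1 + a * n))" by simp
    then show ?thesis using C a by (subst ennreal_mult'[symmetric]) auto
  qed
  finally show ?thesis using m1 by simp
qed

private lemma exp_finite:
  assumes c: "c \<ge> 0"
  shows "(\<integral>\<^sup>+x. ennreal (exp (c * (p1 x + q1 x))) \<partial>density P1 w1) < \<infinity>"
proof -
  note measurable_w1[measurable] measurable_coordinates[measurable]
  \<comment> \<open>One unit is added to \<open>c\<close> because integrating over
    \<open>\<tau>\<close> yields the length \<open>t powr a * \<theta>\<close>, which is at most its
    own exponential.\<close>
  define d where "d = (c + 1) * t powr a"
  have "(\<integral>\<^sup>+x. ennreal (exp (c * (p1 x + q1 x))) \<partial>density P1 w1)
     = (\<integral>\<^sup>+\<theta>. (\<integral>\<^sup>+\<tau>. ennreal (exp (c * (t powr a * \<theta>))) * indicator {0<..<t powr a * \<theta>} \<tau> \<partial>lborel) \<partial>ml_law a)"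
    by (subst nn_integral_density) (auto simp: nn_integral_P1 p1_def q1_def)
  also have "\<dots> \<le> (\<integral>\<^sup>+\<theta>. ennreal (exp (d * \<theta>)) \<partial>ml_law a)"
    using AE_ml_law_pos[of a]
  proof (intro nn_integral_mono_AE, eventually_elim)
    case (elim \<theta>)
    define \<sigma> where "\<sigma> = t powr a * \<theta>"
    have \<sigma>: "\<sigma> > 0" using elim t by (simp add: \<sigma>_def)
    have "exp (c * \<sigma>) * \<sigma> \<le> exp (c * \<sigma>) * exp \<sigma>"
      using exp_ge_add_one_self[of \<sigma>] by (intro mult_left_mono) (linarith, simp)
    also have "\<dots> = exp (d * \<theta>)" by (simp add: exp_add[symmetric] d_def \<sigma>_def algebra_simps)
    finally show ?case
      using \<sigma> by (simp add: nn_integral_cmult_indicator \<sigma>_def[symmetric] ennreal_mult[symmetric])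
  qed
  also have "\<dots> < \<infinity>" by (rule ml_law_exp_finite[OF a])
  finally show ?thesis .
qed

private lemma exponential_identity:
  assumes \<kappa>: "\<kappa> \<ge> 0" and [measurable]: "G \<in> borel_measurable borel"
  shows "(\<integral>\<^sup>+x. w1 x * (ennreal (exp (- \<kappa> * q1 x)) * G (p1 x + q1 x)) \<partial>P1)
    = (\<integral>\<^sup>+x. w2 x * (ennreal (exp (- \<kappa> * q2 x)) * G (p2 x + q2 x)) \<partial>P2)"
proof -
  note measurable_w1[measurable] measurable_coordinates[measurable]
  have "(\<integral>\<^sup>+x. ennreal (exp (- \<kappa> * q1 x)) * G (p1 x + q1 x) \<partial>density P1 w1)
    = (\<integral>\<^sup>+x. ennreal (exp (- \<kappa> * q2 x)) * G (p2 x + q2 x) \<partial>density P2 w2)"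
    by (rule nn_integral_exp_minus_mult_eq_if_moments_eq)
       (use AE_P1 AE_P2 moments_eq exp_finite \<kappa> in simp_all)
  then show ?thesis by (simp add: nn_integral_density)
qed

text \<open>By Tonelli, nonnegative superpositions of the weights
  \<open>exp (- \<kappa> * q)\<close> inherit the identity. This is how a negative power of
  \<open>q\<close>, which moments do not reach directly, comes in.\<close>

private lemma superposed_identity:
  fixes k j G :: "real \<Rightarrow> ennreal"
  assumes \<epsilon>: "\<epsilon> \<ge> 0" and [measurable]: "G \<in> borel_measurable borel" "k \<in> borel_measurable borel"
  defines "j \<equiv> \<lambda>\<tau>. (\<integral>\<^sup>+v. k v * ennreal (exp (- (v + \<epsilon>) * \<tau>)) * indicator {0<..} v \<partial>lborel)"
  shows "(\<integral>\<^sup>+x. w1 x * (j (q1 x) * G (p1 x + q1 x)) \<partial>P1) = (\<integral>\<^sup>+x. w2 x * (j (q2 x) * G (p2 x + q2 x)) \<partial>P2)"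
proof -
  have gen: "(\<integral>\<^sup>+x. w x * (j (q x) * G (p x + q x)) \<partial>P)
     = (\<integral>\<^sup>+v. k v * indicator {0<..} v * (\<integral>\<^sup>+x. w x * (ennreal (exp (- (v + \<epsilon>) * q x)) * G (p x + q x)) \<partial>P) \<partial>lborel)"
    if P: "sigma_finite_measure P" and [measurable]: "w \<in> borel_measurable P" "p \<in> borel_measurable P" "q \<in> borel_measurable P"
    for P :: "'x measure" and w p q
  proof -
  let ?h = "\<lambda>v x. k v * indicator {0<..} v * (w x * (ennreal (exp (- (v + \<epsilon>) * q x)) * G (p x + q x)))"
    interpret P: sigma_finite_measure P by fact
    interpret PB: pair_sigma_finite P "lborel :: real measure" ..
    have "(\<integral>\<^sup>+x. w x * (j (q x) * G (p x + q x)) \<partial>P)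
       = (\<integral>\<^sup>+x. (\<integral>\<^sup>+v. ?h v x \<partial>lborel) \<partial>P)"
    proof (intro nn_integral_cong)
      fix x
      have "w x * (j (q x) * G (p x + q x)) = (w x * G (p x + q x)) * j (q x)" by (simp only: mult_ac)
      also have "\<dots> = (\<integral>\<^sup>+v. (w x * G (p x + q x)) * (k v * ennreal (exp (- (v + \<epsilon>) * q x)) * indicator {0<..} v) \<partial>lborel)"
        unfolding j_def by (rule nn_integral_cmult[symmetric]) measurable
      also have "\<dots> = (\<integral>\<^sup>+v. ?h v x \<partial>lborel)"
        by (simp only: mult_ac)
      finally show "w x * (j (q x) * G (p x + q x)) = \<dots>" .
    qed
    also have "\<dots> = (\<integral>\<^sup>+v. (\<integral>\<^sup>+x. ?h v x \<partial>P) \<partial>lborel)"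
      by (rule PB.Fubini'[symmetric]) measurable
    also have "\<dots> = (\<integral>\<^sup>+v. k v * indicator {0<..} v * (\<integral>\<^sup>+x. w x * (ennreal (exp (- (v + \<epsilon>) * q x)) * G (p x + q x)) \<partial>P) \<partial>lborel)"
      by (intro nn_integral_cong nn_integral_cmult) measurable
    finally show ?thesis .
  qed
  have s1: "sigma_finite_measure P1" and s2: "sigma_finite_measure P2"
    by unfold_locales
  show ?thesis
    unfolding gen[OF s1 measurable_w1 measurable_coordinates(2,3)] gen[OF s2 measurable_coordinates(1,4,5)]
  proof (intro nn_integral_cong)
    fix v :: real
    show "k v * indicator {0<..} v * (\<integral>\<^sup>+x. w1 x * (ennreal (exp (- (v + \<epsilon>) * q1 x)) * G (p1 x + q1 x)) \<partial>P1)
      = k v * indicator {0<..} v * (\<integral>\<^sup>+x. w2 x * (ennreal (exp (- (v + \<epsilon>) * q2 x)) * G (p2 x + q2 x)) \<partial>P2)"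
      using exponential_identity[of "v + \<epsilon>" G] \<epsilon> by (cases "v > 0") auto
  qed
qed

text \<open>For each \<open>t\<close>, the left-hand side is the Duhamel integral in the fractional time \<open>s\<close>, and the
  right-hand side is the average over \<open>\<theta>\<close> of the Duhamel integral in the operational time \<open>t powr a * \<theta>\<close>
  of the heat semigroup. This replaces the semigroup property, which \<open>P_op\<close> lacks.\<close>

lemma ml_convolution_identity:
  fixes G :: "real \<Rightarrow> ennreal" and b \<epsilon> :: real
  assumes b: "b > 0" and \<epsilon>: "\<epsilon> \<ge> 0" and [measurable]: "G \<in> borel_measurable borel"
  defines "j \<equiv> \<lambda>\<tau>. ennreal (\<tau> powr (- b) * exp (- \<epsilon> * \<tau>))"
  shows "(\<integral>\<^sup>+s. ennreal (a * (t - s) powr (a - 1)) * indicator {0<..<t} s *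
       (\<integral>\<^sup>+\<phi>. ennreal \<phi> * (\<integral>\<^sup>+\<theta>. j (s powr a * \<theta>) * G ((t - s) powr a * \<phi> + s powr a * \<theta>) \<partial>ml_law a) \<partial>ml_law a) \<partial>lborel)
    = (\<integral>\<^sup>+\<theta>. (\<integral>\<^sup>+\<tau>. j \<tau> * indicator {0<..<t powr a * \<theta>} \<tau> \<partial>lborel) * G (t powr a * \<theta>) \<partial>ml_law a)"
proof -
  let ?G = "\<lambda>s. (\<integral>\<^sup>+\<phi>. ennreal \<phi> * (\<integral>\<^sup>+\<theta>. j (s powr a * \<theta>) * G ((t - s) powr a * \<phi> + s powr a * \<theta>) \<partial>ml_law a) \<partial>ml_law a)"
  let ?j = "\<lambda>\<tau>. ennreal (\<tau> powr (- b) * exp (- \<epsilon> * \<tau>) / Gamma b)"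
  let ?e = "\<lambda>\<tau> v. exp (- (1 / \<tau> * v powr 1 + \<epsilon>) * \<tau>)"
  note measurable_w1[measurable] measurable_coordinates[measurable]
  \<comment> \<open>With this weight the superposition of \<open>exp (- v * \<tau>)\<close> is the
    Gamma integral for \<open>\<tau> powr (- b)\<close>.\<close>
  define k where "k v = ennreal (v powr (b - 1) / Gamma b)" for v :: real
  have [measurable]: "k \<in> borel_measurable borel" unfolding k_def by measurable
  have Gb: "Gamma b > 0" using b by (rule Gamma_real_pos)
  define J where "J \<tau> = (\<integral>\<^sup>+v. k v * ennreal (exp (- (v + \<epsilon>) * \<tau>)) * indicator {0<..} v \<partial>lborel)" for \<tau>
  have [measurable]: "J \<in> borel_measurable borel" unfolding J_def by measurable
  \<comment> \<open>Only for positive \<open>\<tau>\<close>: at 0 the integral \<open>J\<close> is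
    infinite, whereas \<open>0 powr (- b) = 0\<close>. The difference is invisible below, where
    either an indicator or positivity of \<open>\<theta>\<close> almost everywhere excludes
    it.\<close>
  have Jj: "J \<tau> = j \<tau>" if \<tau>: "\<tau> > 0" for \<tau>
  proof -
    have "J \<tau> = (\<integral>\<^sup>+v. k (1 / \<tau> * v powr 1) * ennreal (?e \<tau> v) * ennreal (1 / \<tau> * 1 * v powr (1 - 1)) * indicator {0<..} v \<partial>lborel)"
      unfolding J_def using \<tau> by (intro nn_integral_powr_substitution) auto
    also have "\<dots> = (\<integral>\<^sup>+v. ?j \<tau> * (ennreal (exp (- v) * v powr (b - 1)) * indicator {0<..} v) \<partial>lborel)"
    proof (intro nn_integral_cong)
      fix v :: real
      show "k (1 / \<tau> * v powr 1) * ennreal (?e \<tau> v) * ennreal (1 / \<tau> * 1 * v powr (1 - 1)) * indicator {0<..} v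
        = ?j \<tau> * (ennreal (exp (- v) * v powr (b - 1)) * indicator {0<..} v)"
      proof (cases "v > 0")
        case True
        have e: "?e \<tau> v = exp (- v) * exp (- \<epsilon> * \<tau>)"
          using True \<tau> by (simp add: exp_add[symmetric] algebra_simps)
        have "(1 / \<tau> * v powr 1) powr (b - 1) / Gamma b * (exp (- v) * exp (- \<epsilon> * \<tau>)) * (1 / \<tau> * 1 * v powr (1 - 1))
          = (\<tau> powr (- b) * exp (- \<epsilon> * \<tau>) / Gamma b) * (exp (- v) * v powr (b - 1))"
          using True \<tau> Gb by (simp add: powr_divide powr_diff powr_minus field_simps)
        then show ?thesis using True \<tau> Gb unfolding k_def e
          by (simp add: ennreal_mult[symmetric] del: powr_one)
      qed simp
    qed
    also have "\<dots> = ?j \<tau> * ennreal (Gamma b)"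
      using nn_integral_exp_powr[of "b - 1"] b by (subst nn_integral_cmult) auto
    also have "\<dots> = j \<tau>" using Gb by (simp add: j_def ennreal_mult[symmetric])
    finally show ?thesis .
  qed
  have main: "(\<integral>\<^sup>+x. w1 x * (J (q1 x) * G (p1 x + q1 x)) \<partial>P1) = (\<integral>\<^sup>+x. w2 x * (J (q2 x) * G (p2 x + q2 x)) \<partial>P2)"
    unfolding J_def by (rule superposed_identity) (use \<epsilon> in simp_all)
  have [measurable]: "j \<in> borel_measurable borel" unfolding j_def by measurable
  have "(\<integral>\<^sup>+x. w2 x * (J (q2 x) * G (p2 x + q2 x)) \<partial>P2) = (\<integral>\<^sup>+x. w2 x * (j (q2 x) * G (p2 x + q2 x)) \<partial>P2)"
    using AE_law2
  proof (intro nn_integral_cong_AE, eventually_elim)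
    case (elim x)
    obtain s \<phi> \<theta> where x: "x = (s, \<phi>, \<theta>)" by (cases x)
    show ?case using elim Jj[of "s powr a * \<theta>"] by (cases "s \<in> {0<..<t}") (auto simp: x w2_def q2_def)
  qed
  also have "\<dots> = (\<integral>\<^sup>+s. ennreal (a * (t - s) powr (a - 1)) * indicator {0<..<t} s *
       ?G s \<partial>lborel)"
    by (subst nn_integral_P2) (simp_all add: p2_def q2_def)
  finally have r: "(\<integral>\<^sup>+x. w2 x * (J (q2 x) * G (p2 x + q2 x)) \<partial>P2) = \<dots>" .
  have "(\<integral>\<^sup>+x. w1 x * (J (q1 x) * G (p1 x + q1 x)) \<partial>P1)
     = (\<integral>\<^sup>+\<theta>. (\<integral>\<^sup>+\<tau>. J \<tau> * G (t powr a * \<theta>) * indicator {0<..<t powr a * \<theta>} \<tau> \<partial>lborel) \<partial>ml_law a)"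
    by (subst nn_integral_P1) (simp_all add: p1_def q1_def)
  also have "\<dots> = (\<integral>\<^sup>+\<theta>. (\<integral>\<^sup>+\<tau>. j \<tau> * indicator {0<..<t powr a * \<theta>} \<tau> \<partial>lborel) * G (t powr a * \<theta>) \<partial>ml_law a)"
  proof (intro nn_integral_cong)
    fix \<theta> :: real
    have "(\<integral>\<^sup>+\<tau>. J \<tau> * G (t powr a * \<theta>) * indicator {0<..<t powr a * \<theta>} \<tau> \<partial>lborel)
       = (\<integral>\<^sup>+\<tau>. j \<tau> * indicator {0<..<t powr a * \<theta>} \<tau> * G (t powr a * \<theta>) \<partial>lborel)"
      by (intro nn_integral_cong) (auto simp: Jj split: split_indicator)
    also have "\<dots> = (\<integral>\<^sup>+\<tau>. j \<tau> * indicator {0<..<t powr a * \<theta>} \<tau> \<partial>lborel) * G (t powr a * \<theta>)"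
      by (rule nn_integral_multc) measurable
    finally show "(\<integral>\<^sup>+\<tau>. J \<tau> * G (t powr a * \<theta>) * indicator {0<..<t powr a * \<theta>} \<tau> \<partial>lborel) = \<dots>" .
  qed
  finally show ?thesis using main r by simp
qed

end

section \<open>The heat semigroup\<close>

lemma nn_integral_lborel_reflect:
  fixes f :: "'a::euclidean_space \<Rightarrow> ennreal"
  assumes [measurable]: "f \<in> borel_measurable borel"
  shows "(\<integral>\<^sup>+y. f (x - y) \<partial>lborel) = (\<integral>\<^sup>+y. f y \<partial>lborel)"
proof -
  have "(\<integral>\<^sup>+y. f y \<partial>lborel) = (\<integral>\<^sup>+y. f y \<partial>density (distr lborel borel (\<lambda>y. x + (-1) *\<^sub>R y)) (\<lambda>_. ennreal (\<bar>-1\<bar> ^ DIM('a))))"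
    by (subst lborel_affine[of "-1" x]) auto
  also have "\<dots> = (\<integral>\<^sup>+y. f (x - y) \<partial>lborel)"
    by (subst nn_integral_density) (auto simp: nn_integral_distr)
  finally show ?thesis ..
qed

lemma measurable_heat_kernel[measurable]:
  "(\<lambda>(t, x). heat_kernel t (x :: 'a::euclidean_space)) \<in> borel_measurable (borel \<Otimes>\<^sub>M borel)"
  unfolding heat_kernel_def[abs_def] by measurable

lemma heat_kernel_nonneg[simp]: "heat_kernel t x \<ge> 0"
  by (simp add: heat_kernel_def)

lemma heat_kernel_eq_prod:
  fixes x :: "'a::euclidean_space"
  assumes t: "t > 0"
  shows "heat_kernel t x = (\<Prod>b\<in>Basis. normal_density 0 (sqrt (2 * t)) (x \<bullet> b))"
proof -
  have "(\<Prod>b\<in>Basis. normal_density 0 (sqrt (2 * t)) (x \<bullet> b))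
    = (\<Prod>b\<in>(Basis::'a set). 1 / sqrt (4 * pi * t)) * (\<Prod>b\<in>Basis. exp (- (x \<bullet> b)\<^sup>2 / (4 * t)))"
    unfolding prod.distrib[symmetric] using t by (intro prod.cong refl) (simp add: normal_density_def mult_ac)
  also have "(\<Prod>b\<in>Basis. exp (- (x \<bullet> b)\<^sup>2 / (4 * t))) = exp (- (norm x)\<^sup>2 / (4 * t))"
  proof -
    have "(norm x)\<^sup>2 = (\<Sum>b\<in>Basis. (x \<bullet> b)\<^sup>2)"
      unfolding power2_norm_eq_inner by (subst euclidean_inner) (simp add: power2_eq_square)
    then show ?thesis
      by (simp add: exp_sum[symmetric] sum_divide_distrib[symmetric] sum_negf)
  qed
  also have "(\<Prod>b\<in>(Basis::'a set). 1 / sqrt (4 * pi * t)) = (4 * pi * t) powr (- real DIM('a) / 2)"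
  proof -
    have "1 / sqrt (4 * pi * t) = (4 * pi * t) powr (-1/2)"
      using t by (simp add: powr_minus_divide powr_half_sqrt[symmetric])
    then show ?thesis using t by (simp add: powr_realpow[symmetric] powr_powr)
  qed
  finally show ?thesis by (simp add: heat_kernel_def)
qed

lemma nn_integral_heat_kernel:
  assumes t: "t > 0"
  shows "(\<integral>\<^sup>+y. ennreal (heat_kernel t (y :: 'a::euclidean_space)) \<partial>lborel) = 1"
proof -
  have s: "sqrt (2 * t) > 0" using t by simp
  have "(\<integral>\<^sup>+x. ennreal (normal_density 0 (sqrt (2 * t)) x) \<partial>lborel) = 1"
    using prob_space.emeasure_space_1[OF prob_space_normal_density[OF s, of 0]]
    by (simp add: emeasure_density)
  then have "(\<integral>\<^sup>+y. (\<Prod>b\<in>Basis. ennreal (normal_density 0 (sqrt (2 * t)) ((y::'a) \<bullet> b))) \<partial>lborel) = 1"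
    by (subst nn_integral_lborel_prod) auto
  then show ?thesis by (simp add: heat_kernel_eq_prod[OF t] prod_ennreal)
qed

lemma nn_integral_heat_kernel_diff:
  assumes t: "t > 0"
  shows "(\<integral>\<^sup>+y. ennreal (heat_kernel t (x - y :: 'a::euclidean_space)) \<partial>lborel) = 1"
  using nn_integral_lborel_reflect[of "\<lambda>y::'a. ennreal (heat_kernel t y)" x] nn_integral_heat_kernel[OF t] by simp

text \<open>Completing the square: \<open>m\<close> is the mean and \<open>s * t / (s + t)\<close>
  the time parameter of the Gaussian in \<open>z\<close>. The semigroup law follows by integrating
  out \<open>z\<close>.\<close>

lemma heat_kernel_mult:
  fixes x y z :: "'a::euclidean_space"
  assumes s: "s > 0" and t: "t > 0"
  defines "m \<equiv> (t / (s + t)) *\<^sub>R x + (s / (s + t)) *\<^sub>R y"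
  shows "heat_kernel s (x - z) * heat_kernel t (z - y) = heat_kernel (s + t) (x - y) * heat_kernel (s * t / (s + t)) (m - z)"
proof -
  define A B where "A = x - z" and "B = z - y"
  have xy: "x - y = A + B" by (simp add: A_def B_def)
  have "(s + t) *\<^sub>R m = t *\<^sub>R x + s *\<^sub>R y" using s t by (simp add: m_def scaleR_add_right)
  then have "(s + t) *\<^sub>R (m - z) = t *\<^sub>R A - s *\<^sub>R B"
    by (simp add: scaleR_diff_right A_def B_def) (simp add: algebra_simps)
  then have mz: "m - z = (1 / (s + t)) *\<^sub>R (t *\<^sub>R A - s *\<^sub>R B)"
    using s t by (metis add_pos_pos divide_inverse mult_1 scaleR_left_imp_eq scaleR_one scaleR_scaleR less_numeral_extra(3) left_inverse)
  define p q c where "p = A \<bullet> A" and "q = B \<bullet> B" and "c = A \<bullet> B"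
  have n1: "(norm (A + B))\<^sup>2 = p + q + 2 * c"
    by (simp add: power2_norm_eq_inner inner_add p_def q_def c_def inner_commute)
  have n2: "(norm (m - z))\<^sup>2 = (t\<^sup>2 * p + s\<^sup>2 * q - 2 * s * t * c) / (s + t)\<^sup>2"
  proof -
    have "(norm (t *\<^sub>R A - s *\<^sub>R B))\<^sup>2 = t\<^sup>2 * p + s\<^sup>2 * q - 2 * s * t * c"
      unfolding power2_norm_eq_inner p_def q_def c_def
      by (simp add: inner_diff inner_commute[of B A] power2_eq_square algebra_simps)
    then show ?thesis unfolding mz norm_scaleR power_mult_distrib by (simp add: power_divide)
  qed
  have e: "- (norm A)\<^sup>2 / (4 * s) + - (norm B)\<^sup>2 / (4 * t)
     = - (norm (A + B))\<^sup>2 / (4 * (s + t)) + - (norm (m - z))\<^sup>2 / (4 * (s * t / (s + t)))"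
  proof -
    have "p / s + q / t = (p + q + 2 * c) / (s + t) + ((t\<^sup>2 * p + s\<^sup>2 * q - 2 * s * t * c) / (s + t)\<^sup>2) / (s * t / (s + t))"
    proof -
      define w where "w = s + t"
      have w: "w > 0" using s t by (simp add: w_def)
      have "((t\<^sup>2 * p + s\<^sup>2 * q - 2 * s * t * c) / w\<^sup>2) / (s * t / w) = (t\<^sup>2 * p + s\<^sup>2 * q - 2 * s * t * c) / (w * s * t)"
        using w s t by (simp add: field_simps power2_eq_square)
      moreover have "(p + q + 2 * c) / w + (t\<^sup>2 * p + s\<^sup>2 * q - 2 * s * t * c) / (w * s * t)
         = ((p + q + 2 * c) * s * t + (t\<^sup>2 * p + s\<^sup>2 * q - 2 * s * t * c)) / (w * s * t)"
        using w s t by (simp add: field_simps)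
      moreover have "(p + q + 2 * c) * s * t + (t\<^sup>2 * p + s\<^sup>2 * q - 2 * s * t * c) = w * (p * t + q * s)"
        by (simp add: w_def algebra_simps power2_eq_square)
      moreover have "w * (p * t + q * s) / (w * s * t) = p / s + q / t"
        using w s t by (simp add: field_simps)
      ultimately show ?thesis by (simp add: w_def)
    qed
    moreover have "- a / (4 * u) = - (1/4) * (a / u)" for a u :: real by simp
    ultimately show ?thesis unfolding n1 n2 by (simp only: power2_norm_eq_inner p_def[symmetric] q_def[symmetric] distrib_left[symmetric])
  qed
  have k: "(4 * pi * s) powr d * (4 * pi * t) powr d = (4 * pi * (s + t)) powr d * (4 * pi * (s * t / (s + t))) powr d" for d
  proof -
    have "(4 * pi * s) * (4 * pi * t) = (4 * pi * (s + t)) * (4 * pi * (s * t / (s + t)))"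
      using s t by (simp add: field_simps)
    moreover have "u powr d * v powr d = (u * v) powr d" if "u > 0" "v > 0" for u v :: real
      using that by (simp add: powr_mult)
    ultimately show ?thesis using s t by (simp add: mult_ac)
  qed
  have "heat_kernel s A * heat_kernel t B = ((4 * pi * s) powr (- real DIM('a) / 2) * (4 * pi * t) powr (- real DIM('a) / 2))
      * exp (- (norm A)\<^sup>2 / (4 * s) + - (norm B)\<^sup>2 / (4 * t))"
    unfolding heat_kernel_def exp_add by (simp only: mult_ac)
  also have "\<dots> = heat_kernel (s + t) (A + B) * heat_kernel (s * t / (s + t)) (m - z)"
    unfolding heat_kernel_def k e exp_add by (simp only: mult_ac)
  finally show ?thesis by (simp add: xy A_def[symmetric] B_def[symmetric])
qed

lemma heat_kernel_semigroup:
  fixes x y :: "'a::euclidean_space"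
  assumes s: "s > 0" and t: "t > 0"
  shows "(\<integral>\<^sup>+z. ennreal (heat_kernel s (x - z)) * ennreal (heat_kernel t (z - y)) \<partial>lborel) = ennreal (heat_kernel (s + t) (x - y))"
proof -
  have st: "s * t / (s + t) > 0" using s t by simp
  have "(\<integral>\<^sup>+z. ennreal (heat_kernel s (x - z)) * ennreal (heat_kernel t (z - y)) \<partial>lborel)
    = (\<integral>\<^sup>+z. ennreal (heat_kernel (s + t) (x - y)) * ennreal (heat_kernel (s * t / (s + t)) ((t / (s + t)) *\<^sub>R x + (s / (s + t)) *\<^sub>R y - z)) \<partial>lborel)"
    by (simp add: ennreal_mult[symmetric] heat_kernel_mult[OF s t])
  also have "\<dots> = ennreal (heat_kernel (s + t) (x - y))"
    by (subst nn_integral_cmult) (simp_all add: nn_integral_heat_kernel_diff[OF st])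
  finally show ?thesis .
qed

text \<open>The action of \<open>heat\<close> on functions, with \<open>lborel\<close> in place of
  the completed measure so that Tonelli and joint measurability apply to Borel functions.\<close>

definition heat_fun :: "real \<Rightarrow> ('a::euclidean_space \<Rightarrow> ennreal) \<Rightarrow> 'a \<Rightarrow> ennreal" where
  "heat_fun t f x = (\<integral>\<^sup>+y. ennreal (heat_kernel t (x - y)) * f y \<partial>lborel)"

lemma heat_fun_measure:
  fixes f :: "'a::euclidean_space \<Rightarrow> ennreal"
  assumes [measurable]: "f \<in> borel_measurable borel"
  shows "heat t (fun_measure f) x = heat_fun t f x"
proof -
  have "heat t (fun_measure f) x = (\<integral>\<^sup>+y. f y * ennreal (heat_kernel t (x - y)) \<partial>lebesgue)"
    unfolding heat_def fun_measure_def
    by (rule nn_integral_density) (auto intro!: measurable_completion)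
  then show ?thesis by (simp add: heat_fun_def nn_integral_completion mult.commute)
qed

lemma measurable_heat_fun[measurable (raw)]:
  fixes f :: "'b \<Rightarrow> 'a::euclidean_space \<Rightarrow> ennreal"
  assumes [measurable]: "(\<lambda>(z, y). f z y) \<in> borel_measurable (M \<Otimes>\<^sub>M borel)" "g \<in> borel_measurable M" "h \<in> borel_measurable M"
  shows "(\<lambda>z. heat_fun (g z) (f z) (h z)) \<in> borel_measurable M"
  unfolding heat_fun_def by measurable

lemma heat_fun_mono: "(\<And>y. f y \<le> g y) \<Longrightarrow> heat_fun t f x \<le> heat_fun t g x"
  unfolding heat_fun_def by (intro nn_integral_mono mult_left_mono) auto

lemma heat_fun_semigroup:
  fixes f :: "'a::euclidean_space \<Rightarrow> ennreal"
  assumes s: "s > 0" and t: "t > 0" and [measurable]: "f \<in> borel_measurable borel"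
  shows "heat_fun s (heat_fun t f) x = heat_fun (s + t) f x"
proof -
  have "heat_fun s (heat_fun t f) x
     = (\<integral>\<^sup>+z. (\<integral>\<^sup>+y. ennreal (heat_kernel s (x - z)) * ennreal (heat_kernel t (z - y)) * f y \<partial>lborel) \<partial>lborel)"
    unfolding heat_fun_def by (intro nn_integral_cong) (simp add: nn_integral_cmult[symmetric] mult.assoc)
  also have "\<dots> = (\<integral>\<^sup>+y. (\<integral>\<^sup>+z. ennreal (heat_kernel s (x - z)) * ennreal (heat_kernel t (z - y)) * f y \<partial>lborel) \<partial>lborel)"
    by (rule lborel_pair.Fubini') measurable
  also have "\<dots> = heat_fun (s + t) f x"
    unfolding heat_fun_def
    by (intro nn_integral_cong) (simp add: nn_integral_multc heat_kernel_semigroup[OF s t])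
  finally show ?thesis .
qed

text \<open>Doubling the time pays for moving the centre by at most the square root of
  \<open>s\<close>: the square of \<open>norm (x - z)\<close> is at most twice that of
  \<open>norm (x - y)\<close> plus \<open>2 * s\<close>. The power of 2 is the ratio of the
  normalizations, and \<open>exp (1/4)\<close> is the cost of the term \<open>2 * s\<close>.\<close>

lemma heat_kernel_harnack:
  fixes x y z :: "'a::euclidean_space"
  assumes s: "s > 0" and r: "dist y z < \<rho>" "\<rho>\<^sup>2 \<le> s"
  shows "heat_kernel s (x - y) \<le> 2 powr (real DIM('a) / 2) * exp (1/4) * heat_kernel (2 * s) (x - z)"
proof -
  define d where "d = - real DIM('a) / 2"
  have "norm (x - z) \<le> norm (x - y) + \<rho>"
    using norm_triangle_ineq[of "x - y" "y - z"] r by (simp add: dist_norm)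
  then have "(norm (x - z))\<^sup>2 \<le> (norm (x - y) + \<rho>)\<^sup>2" by (intro power_mono) auto
  also have "\<dots> \<le> 2 * (norm (x - y))\<^sup>2 + 2 * \<rho>\<^sup>2"
    using sum_squares_bound[of "norm (x - y)" \<rho>] by (simp add: power2_sum)
  also have "\<dots> \<le> 2 * (norm (x - y))\<^sup>2 + 2 * s" using r by simp
  finally have "- (norm (x - y))\<^sup>2 / (4 * s) \<le> 1/4 + - (norm (x - z))\<^sup>2 / (4 * (2 * s))"
    using s by (simp add: field_simps)
  then have e: "exp (- (norm (x - y))\<^sup>2 / (4 * s)) \<le> exp (1/4) * exp (- (norm (x - z))\<^sup>2 / (4 * (2 * s)))"
    by (simp add: exp_add[symmetric])
  have c: "(4 * pi * s) powr d = 2 powr (- d) * (4 * pi * (2 * s)) powr d"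
  proof -
    have "4 * pi * (2 * s) = 2 * (4 * pi * s)" by simp
    then have "(4 * pi * (2 * s)) powr d = 2 powr d * (4 * pi * s) powr d" using s by (simp only: powr_mult)
    then show ?thesis by (simp add: powr_minus field_simps)
  qed
  have "heat_kernel s (x - y) \<le> (4 * pi * s) powr d * (exp (1/4) * exp (- (norm (x - z))\<^sup>2 / (4 * (2 * s))))"
    unfolding heat_kernel_def d_def by (intro mult_left_mono e) auto
  also have "\<dots> = 2 powr (- d) * exp (1/4) * heat_kernel (2 * s) (x - z)"
    unfolding heat_kernel_def d_def[symmetric] c by (simp only: mult_ac)
  finally show ?thesis by (simp add: d_def)
qed

text \<open>In place of a covering by balls, the integral is averaged over all centres
  \<open>z\<close> within \<open>\<rho>\<close> of \<open>y\<close>. The Harnack inequality moves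
  the kernel from \<open>y\<close> to \<open>z\<close>, Tonelli exposes the mass of
  \<open>ball z \<rho>\<close>, and the kernel at time \<open>2 * s\<close> integrates to 1.\<close>

lemma heat_fun_le_local_mass:
  fixes f :: "'a::euclidean_space \<Rightarrow> ennreal"
  assumes s: "s > 0" and \<rho>: "\<rho> > 0" "\<rho>\<^sup>2 \<le> s" and [measurable]: "f \<in> borel_measurable borel"
    and A: "\<And>z. (\<integral>\<^sup>+y\<in>ball z \<rho>. f y \<partial>lborel) \<le> A"
  shows "ennreal (unit_ball_vol DIM('a) * \<rho> ^ DIM('a)) * heat_fun s f x \<le> ennreal (2 powr (real DIM('a) / 2) * exp (1/4)) * A"
proof -
  define C where "C = 2 powr (real DIM('a) / 2) * exp (1/4)"
  define V where "V = ennreal (unit_ball_vol (real DIM('a)) * \<rho> ^ DIM('a))"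
  have V: "V = emeasure lborel (ball y \<rho>)" for y :: 'a using \<rho> by (simp add: emeasure_ball V_def)
  have [measurable]: "Measurable.pred (borel \<Otimes>\<^sub>M borel) (\<lambda>(y, z::'a). z \<in> ball y \<rho>)"
    unfolding mem_ball by measurable
  let ?I = "\<lambda>(y::'a) z. ennreal (C * heat_kernel (2 * s) (x - z)) * (f y * indicator (ball z \<rho>) y)"
  have "V * heat_fun s f x = (\<integral>\<^sup>+y. (\<integral>\<^sup>+z. ennreal (heat_kernel s (x - y)) * f y * indicator (ball y \<rho>) z \<partial>lborel) \<partial>lborel)"
    unfolding heat_fun_def
  proof (subst nn_integral_cmult[symmetric], measurable, intro nn_integral_cong)
    fix y
    show "V * (ennreal (heat_kernel s (x - y)) * f y) = (\<integral>\<^sup>+z. ennreal (heat_kernel s (x - y)) * f y * indicator (ball y \<rho>) z \<partial>lborel)"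
      by (subst nn_integral_cmult_indicator) (simp_all add: V[of y] mult.commute)
  qed
  also have "\<dots> \<le> (\<integral>\<^sup>+y. (\<integral>\<^sup>+z. ?I y z \<partial>lborel) \<partial>lborel)"
  proof (intro nn_integral_mono)
    fix y z :: 'a
    show "ennreal (heat_kernel s (x - y)) * f y * indicator (ball y \<rho>) z \<le> ?I y z"
    proof (cases "dist y z < \<rho>")
      case True
      then have "ennreal (heat_kernel s (x - y)) * f y \<le> ennreal (C * heat_kernel (2 * s) (x - z)) * f y"
        unfolding C_def using heat_kernel_harnack[OF s True \<rho>(2), of x] by (intro mult_right_mono ennreal_leI) auto
      then show ?thesis using True by (simp add: dist_commute)
    qed simp
  qed
  also have "\<dots> = (\<integral>\<^sup>+z. (\<integral>\<^sup>+y. ?I y z \<partial>lborel) \<partial>lborel)"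
    by (rule lborel_pair.Fubini') measurable
  also have "\<dots> \<le> (\<integral>\<^sup>+z. ennreal C * A * ennreal (heat_kernel (2 * s) (x - z)) \<partial>lborel)"
  proof (intro nn_integral_mono)
    fix z
    have "(\<integral>\<^sup>+y. ?I y z \<partial>lborel)
      = ennreal (C * heat_kernel (2 * s) (x - z)) * (\<integral>\<^sup>+y\<in>ball z \<rho>. f y \<partial>lborel)"
      by (rule nn_integral_cmult) measurable
    also have "\<dots> \<le> ennreal (C * heat_kernel (2 * s) (x - z)) * A" by (intro mult_left_mono A) simp
    also have "\<dots> = ennreal C * A * ennreal (heat_kernel (2 * s) (x - z))" by (simp add: C_def ennreal_mult' mult_ac)
    finally show "(\<integral>\<^sup>+y. ?I y z \<partial>lborel) \<le> \<dots>" .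
  qed
  also have "\<dots> = ennreal C * A"
    using s by (subst nn_integral_cmult) (simp_all add: nn_integral_heat_kernel_diff)
  finally show ?thesis by (simp add: C_def V_def)
qed

section \<open>Powers and Jensen's inequality on the extended half-line\<close>

lemma ennpowr_ennreal: "x \<ge> 0 \<Longrightarrow> ennpowr (ennreal x) q = ennreal (x powr q)"
  by (simp add: ennpowr_def)

lemma ennpowr_top[simp]: "ennpowr \<top> q = \<top>"
  by (simp add: ennpowr_def)

lemma ennpowr_0[simp]: "ennpowr 0 q = 0"
  by (simp add: ennpowr_def)

lemma ennpowr_1[simp]: "ennpowr a 1 = a"
  by (cases a) (auto simp: ennpowr_ennreal)

lemma measurable_ennpowr[measurable (raw)]:
  assumes [measurable]: "f \<in> borel_measurable M"
  shows "(\<lambda>x. ennpowr (f x) q) \<in> borel_measurable M"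
  unfolding ennpowr_def by measurable

lemma ennpowr_mono: "a \<le> b \<Longrightarrow> q > 0 \<Longrightarrow> ennpowr a q \<le> ennpowr b q"
  by (cases a; cases b) (auto simp: ennpowr_ennreal intro!: ennreal_leI powr_mono2 simp: top_unique)

lemma ennpowr_mult: "q > 0 \<Longrightarrow> ennpowr (a * b) q = ennpowr a q * ennpowr b q"
proof -
  have *: "ennpowr (\<top> * b) q = \<top> * ennpowr b q" if q: "q > 0" for b
  proof (cases b)
    case (real x)
    then show ?thesis by (cases "x = 0") (auto simp: ennpowr_ennreal ennreal_top_mult)
  qed simp
  assume q: "q > 0"
  show ?thesis
  proof (cases a)
    case a: (real x)
    show ?thesis
    proof (cases b)
      case (real y)
      then show ?thesis using a by (simp add: ennreal_mult[symmetric] ennpowr_ennreal powr_mult)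
    next
      case top
      then show ?thesis using *[OF q, of a] by (simp add: mult.commute)
    qed
  next
    case top
    then show ?thesis using *[OF q, of b] by simp
  qed
qed

lemma ennpowr_ennpowr: "ennpowr (ennpowr a p) q = ennpowr a (p * q)"
  by (cases a) (auto simp: ennpowr_ennreal powr_powr)

text \<open>The power with exponent \<open>1 / q\<close> is a monotone inverse, so
  \<open>ennpowr\<close> is an order isomorphism of the extended half-line and commutes with
  suprema.\<close>

lemma ennpowr_SUP:
  assumes q: "q > 0" and "I \<noteq> {}"
  shows "ennpowr (SUP i\<in>I. f i) q = (SUP i\<in>I. ennpowr (f i) q)"
proof (rule antisym)
  show "(SUP i\<in>I. ennpowr (f i) q) \<le> ennpowr (SUP i\<in>I. f i) q"
    using q by (intro SUP_least ennpowr_mono SUP_upper) auto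
  have inv: "ennpowr (ennpowr a q) (1 / q) = a" "ennpowr (ennpowr a (1 / q)) q = a" for a
    using q by (simp_all add: ennpowr_ennpowr)
  have "(SUP i\<in>I. f i) \<le> ennpowr (SUP i\<in>I. ennpowr (f i) q) (1 / q)"
  proof (rule SUP_least)
    fix i assume i: "i \<in> I"
    have "f i = ennpowr (ennpowr (f i) q) (1 / q)" by (simp only: inv)
    also have "\<dots> \<le> ennpowr (SUP i\<in>I. ennpowr (f i) q) (1 / q)"
      using q i by (intro ennpowr_mono SUP_upper) auto
    finally show "f i \<le> ennpowr (SUP i\<in>I. ennpowr (f i) q) (1 / q)" .
  qed
  then have "ennpowr (SUP i\<in>I. f i) q \<le> ennpowr (ennpowr (SUP i\<in>I. ennpowr (f i) q) (1 / q)) q"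
    using q by (rule ennpowr_mono)
  then show "ennpowr (SUP i\<in>I. f i) q \<le> (SUP i\<in>I. ennpowr (f i) q)" by (simp only: inv)
qed

text \<open>The tangent line of \<open>y powr p\<close> at \<open>A\<close>, which yields Jensen's inequality without
  integrability side conditions.\<close>

lemma young_tangent:
  fixes y A p :: real
  assumes "y \<ge> 0" "A > 0" "p > 1"
  shows "y \<le> A powr (1 - p) / p * y powr p + (1 - 1 / p) * A"
proof -
  define q where "q = p / (p - 1)"
  have q: "q > 1" "1 / p + 1 / q = 1" using assms by (auto simp: q_def field_simps)
  have "(y / A) * 1 \<le> (y / A) powr p / p + 1 powr q / q"
    using assms q by (intro Youngs_inequality) auto
  also have "1 powr q / q = 1 - 1 / p" using q by simp
  finally have "A * (y / A) \<le> A * ((y / A) powr p / p + (1 - 1 / p))" using assms by (intro mult_left_mono) auto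
  moreover have "A * (y / A) powr p = A powr (1 - p) * y powr p"
    using assms by (simp add: powr_divide powr_diff)
  ultimately show ?thesis using assms by (simp add: algebra_simps)
qed

lemma nn_integral_jensen:
  fixes y :: "'a \<Rightarrow> ennreal"
  assumes [measurable]: "y \<in> borel_measurable M" and p: "p \<ge> 1" and K: "K > 0" "emeasure M (space M) \<le> ennreal K"
  shows "ennpowr (\<integral>\<^sup>+x. y x \<partial>M) p \<le> ennreal (K powr (p - 1)) * (\<integral>\<^sup>+x. ennpowr (y x) p \<partial>M)"
proof (cases "p = 1")
  case True
  then show ?thesis using K by simp
next
  case False
  then have p1: "p > 1" using p by simp
  define F where "F = (\<integral>\<^sup>+x. ennpowr (y x) p \<partial>M)"
  show ?thesis
  proof (cases F)
    case top
    then show ?thesis using K by (simp add: F_def[symmetric] ennreal_mult_top)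
  next
    case (real f)
    show ?thesis
    proof (cases "f = 0")
      case True
      then have "AE x in M. ennpowr (y x) p = 0"
        using real unfolding F_def by (subst nn_integral_0_iff_AE[symmetric]) auto
      then have "AE x in M. y x = 0"
      proof eventually_elim
        case (elim x)
        then show ?case by (cases "y x") (auto simp: ennpowr_ennreal)
      qed
      then have "(\<integral>\<^sup>+x. y x \<partial>M) = 0" by (subst nn_integral_0_iff_AE) auto
      then show ?thesis by simp
    next
      case False
      then have f: "f > 0" using real by simp
      \<comment> \<open>The best tangent point: \<open>A powr p = f / K\<close> makes the two terms
        of the integrated tangent line add up to \<open>A * K\<close>. It has to be positive, whence
        the separate case \<open>f = 0\<close>.\<close>
      define A where "A = (f / K) powr (1 / p)"
      have A: "A > 0" using f K by (simp add: A_def)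
      have Ap: "A powr p = f / K" using f K p1 by (simp add: A_def powr_powr)
      have "y x \<le> ennreal (A powr (1 - p) / p) * ennpowr (y x) p + ennreal ((1 - 1 / p) * A)" for x
      proof (cases "y x")
        case (real u)
        then have "ennreal u \<le> ennreal (A powr (1 - p) / p * u powr p + (1 - 1 / p) * A)"
          using young_tangent[of u A p] A p1 by (intro ennreal_leI) auto
        also have "\<dots> = ennreal (A powr (1 - p) / p) * ennreal (u powr p) + ennreal ((1 - 1 / p) * A)"
          using A p1 by (subst ennreal_plus) (auto simp: ennreal_mult'[symmetric] intro!: mult_nonneg_nonneg)
        finally show ?thesis using real by (simp add: ennpowr_ennreal)
      next
        case top
        then show ?thesis using A p1 by (simp add: ennreal_mult_top)
      qed
      then have "(\<integral>\<^sup>+x. y x \<partial>M) \<le> (\<integral>\<^sup>+x. ennreal (A powr (1 - p) / p) * ennpowr (y x) p + ennreal ((1 - 1 / p) * A) \<partial>M)"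
        by (intro nn_integral_mono)
      also have "\<dots> = ennreal (A powr (1 - p) / p) * F + ennreal ((1 - 1 / p) * A) * emeasure M (space M)"
        by (simp add: nn_integral_add nn_integral_cmult F_def)
      also have "\<dots> \<le> ennreal (A powr (1 - p) / p) * F + ennreal ((1 - 1 / p) * A) * ennreal K"
        by (intro add_left_mono mult_left_mono K) auto
      also have "\<dots> = ennreal (A powr (1 - p) / p * f + (1 - 1 / p) * A * K)"
      proof -
        have "ennreal c1 * ennreal f + ennreal c2 * ennreal K = ennreal (c1 * f + c2 * K)"
          if "c1 \<ge> 0" "c2 \<ge> 0" for c1 c2
          using that K real by (simp add: ennreal_plus ennreal_mult)
        then show ?thesis using A p1 real by simp
      qed
      also have "A powr (1 - p) / p * f + (1 - 1 / p) * A * K = A * K"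
      proof -
        have "A powr (1 - p) * f = A powr (1 - p) * A powr p * K" using Ap K by simp
        also have "\<dots> = A * K" using A by (simp add: powr_add[symmetric])
        finally have "A powr (1 - p) / p * f = A * K / p" by (simp add: field_simps)
        then show ?thesis by (simp add: algebra_simps)
      qed
      finally have "ennpowr (\<integral>\<^sup>+x. y x \<partial>M) p \<le> ennpowr (ennreal (A * K)) p" using p1 by (intro ennpowr_mono) auto
      also have "\<dots> = ennreal (K powr (p - 1) * f)"
        using A K Ap f by (simp add: ennpowr_ennreal powr_mult powr_diff)
      also have "\<dots> = ennreal (K powr (p - 1)) * F" using real by (simp add: ennreal_mult)
      finally show ?thesis by (simp add: F_def)
    qed
  qed
qed

text \<open>Hoelder's inequality, obtained from Jensen's for the measure with density
  \<open>\<omega> = exp (g / (p - 1))\<close>; the exponent is the one for which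
  \<open>\<omega> powr (1 - p) = exp (- g)\<close>. It gains a factor \<open>exp (- g)\<close>
  inside the integral at the price of an exponential moment.\<close>

lemma nn_integral_weighted_jensen:
  fixes y :: "'a \<Rightarrow> ennreal" and g :: "'a \<Rightarrow> real"
  assumes [measurable]: "y \<in> borel_measurable M" "g \<in> borel_measurable M" and p: "p > 1"
    and K: "K > 0" "(\<integral>\<^sup>+x. ennreal (exp (g x / (p - 1))) \<partial>M) \<le> ennreal K"
  shows "ennpowr (\<integral>\<^sup>+x. y x \<partial>M) p \<le> ennreal (K powr (p - 1)) * (\<integral>\<^sup>+x. ennpowr (y x) p * ennreal (exp (- g x)) \<partial>M)"
proof -
  define \<omega> where "\<omega> x = exp (g x / (p - 1))" for x
  have [measurable]: "\<omega> \<in> borel_measurable M" unfolding \<omega>_def by measurable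
  define N where "N = density M (\<lambda>x. ennreal (\<omega> x))"
  have \<omega>: "\<omega> x > 0" for x by (simp add: \<omega>_def)
  have "emeasure N (space N) \<le> ennreal K"
    using K(2) by (simp add: N_def emeasure_density \<omega>_def)
  then have "ennpowr (\<integral>\<^sup>+x. ennreal (1 / \<omega> x) * y x \<partial>N) p \<le> ennreal (K powr (p - 1)) * (\<integral>\<^sup>+x. ennpowr (ennreal (1 / \<omega> x) * y x) p \<partial>N)"
    using p K by (intro nn_integral_jensen) (auto simp: N_def)
  also have "(\<integral>\<^sup>+x. ennreal (1 / \<omega> x) * y x \<partial>N) = (\<integral>\<^sup>+x. y x \<partial>M)"
    unfolding N_def using \<omega>
    by (subst nn_integral_density) (auto simp: mult.assoc[symmetric] ennreal_mult[symmetric] less_imp_le less_imp_neq[THEN not_sym])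
  also have "(\<integral>\<^sup>+x. ennpowr (ennreal (1 / \<omega> x) * y x) p \<partial>N) = (\<integral>\<^sup>+x. ennpowr (y x) p * ennreal (exp (- g x)) \<partial>M)"
    unfolding N_def
  proof (subst nn_integral_density, measurable, intro nn_integral_cong)
    fix x
    have "\<omega> x * (1 / \<omega> x) powr p = exp (- g x)"
    proof -
      have "\<omega> x * (1 / \<omega> x) powr p = exp (g x / (p - 1) + p * (- (g x / (p - 1))))"
        unfolding exp_add by (simp add: \<omega>_def exp_minus[symmetric] divide_inverse[of 1] powr_def)
      also have "g x / (p - 1) + p * (- (g x / (p - 1))) = - ((p - 1) * (g x / (p - 1)))"
          by (simp only: left_diff_distrib mult_minus_right mult_1)
        also have "\<dots> = - g x" using p by simp
      finally show ?thesis .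
    qed
    then have "ennreal (\<omega> x) * ennreal ((1 / \<omega> x) powr p) = ennreal (exp (- g x))"
      using \<omega>[of x] by (simp add: ennreal_mult[symmetric])
    then show "ennreal (\<omega> x) * ennpowr (ennreal (1 / \<omega> x) * y x) p = ennpowr (y x) p * ennreal (exp (- g x))"
      using p \<omega>[of x] by (simp add: ennpowr_mult ennpowr_ennreal mult.assoc[symmetric] mult.commute)
  qed
  finally show ?thesis .
qed

section \<open>Solutions from supersolutions\<close>

definition P_fun :: "real \<Rightarrow> real \<Rightarrow> ('a::euclidean_space \<Rightarrow> ennreal) \<Rightarrow> 'a \<Rightarrow> ennreal" where
  "P_fun \<alpha> t f x = (\<integral>\<^sup>+\<theta>. heat_fun (t powr \<alpha> * \<theta>) f x \<partial>ml_law \<alpha>)"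

definition S_fun :: "real \<Rightarrow> real \<Rightarrow> ('a::euclidean_space \<Rightarrow> ennreal) \<Rightarrow> 'a \<Rightarrow> ennreal" where
  "S_fun \<alpha> t f x = (\<integral>\<^sup>+\<theta>. ennreal \<theta> * heat_fun (t powr \<alpha> * \<theta>) f x \<partial>ml_law \<alpha>)"

lemma nn_integral_h_density:
  assumes \<alpha>: "0 < \<alpha>" "\<alpha> < 1" and [measurable]: "F \<in> borel_measurable borel"
  shows "(\<integral>\<^sup>+\<theta>\<in>{0<..}. ennreal (h_density \<alpha> \<theta>) * F \<theta> \<partial>lebesgue) = (\<integral>\<^sup>+\<theta>. F \<theta> \<partial>ml_law \<alpha>)"
proof -
  note density_h_density(1)[OF \<alpha>, measurable]
  have "(\<integral>\<^sup>+\<theta>. F \<theta> \<partial>ml_law \<alpha>) = (\<integral>\<^sup>+\<theta>. ennreal (h_density \<alpha> \<theta>) * indicator {0<..} \<theta> * F \<theta> \<partial>lborel)"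
    unfolding density_h_density(3)[OF \<alpha>, symmetric] by (rule nn_integral_density) measurable
  then show ?thesis by (simp add: nn_integral_completion mult_ac)
qed

lemma P_op_fun_measure:
  fixes f :: "'a::euclidean_space \<Rightarrow> ennreal"
  assumes \<alpha>: "0 < \<alpha>" "\<alpha> < 1" and [measurable]: "f \<in> borel_measurable borel"
  shows "P_op \<alpha> t (fun_measure f) x = P_fun \<alpha> t f x"
  unfolding P_op_def P_fun_def heat_fun_measure[OF assms(3)] by (rule nn_integral_h_density[OF \<alpha>]) measurable

lemma S_op_fun_measure:
  fixes f :: "'a::euclidean_space \<Rightarrow> ennreal"
  assumes \<alpha>: "0 < \<alpha>" "\<alpha> < 1" and [measurable]: "f \<in> borel_measurable borel"
  shows "S_op \<alpha> t (fun_measure f) x = S_fun \<alpha> t f x"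
proof -
  have "S_op \<alpha> t (fun_measure f) x = (\<integral>\<^sup>+\<theta>\<in>{0<..}. ennreal (h_density \<alpha> \<theta>) * (ennreal \<theta> * heat_fun (t powr \<alpha> * \<theta>) f x) \<partial>lebesgue)"
    unfolding S_op_def heat_fun_measure[OF assms(3)]
  proof (intro nn_integral_cong)
    fix \<theta> :: real
    show "ennreal (\<theta> * h_density \<alpha> \<theta>) * heat_fun (t powr \<alpha> * \<theta>) f x * indicator {0<..} \<theta>
      = ennreal (h_density \<alpha> \<theta>) * (ennreal \<theta> * heat_fun (t powr \<alpha> * \<theta>) f x) * indicator {0<..} \<theta>"
      using density_h_density(2)[OF \<alpha>, of \<theta>] by (cases "\<theta> > 0") (simp_all add: ennreal_mult mult_ac)
  qed
  also have "\<dots> = S_fun \<alpha> t f x" unfolding S_fun_def by (rule nn_integral_h_density[OF \<alpha>]) measurable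
  finally show ?thesis .
qed

definition duhamel :: "real \<Rightarrow> real \<Rightarrow> ('a::euclidean_space \<Rightarrow> ennreal) \<Rightarrow> (real \<Rightarrow> 'a \<Rightarrow> ennreal) \<Rightarrow> real \<Rightarrow> 'a \<Rightarrow> ennreal" where
  "duhamel \<alpha> p f u t x = P_fun \<alpha> t f x + ennreal \<alpha> *
     (\<integral>\<^sup>+s. ennreal ((t - s) powr (\<alpha> - 1)) * S_fun \<alpha> (t - s) (\<lambda>y. ennpowr (u s y) p) x * indicator {0<..<t} s \<partial>lborel)"

lemma measurable_P_fun[measurable (raw)]:
  fixes f :: "'b \<Rightarrow> 'a::euclidean_space \<Rightarrow> ennreal"
  assumes \<alpha>: "0 < \<alpha>" "\<alpha> < 1"
    and [measurable]: "(\<lambda>(z, y). f z y) \<in> borel_measurable (M \<Otimes>\<^sub>M borel)" "g \<in> borel_measurable M" "h \<in> borel_measurable M"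
  shows "(\<lambda>z. P_fun \<alpha> (g z) (f z) (h z)) \<in> borel_measurable M"
proof -
  interpret prob_space "ml_law \<alpha>" by (rule prob_space_ml_law[OF \<alpha>])
  show ?thesis unfolding P_fun_def by measurable
qed

lemma measurable_S_fun[measurable (raw)]:
  fixes f :: "'b \<Rightarrow> 'a::euclidean_space \<Rightarrow> ennreal"
  assumes \<alpha>: "0 < \<alpha>" "\<alpha> < 1"
    and [measurable]: "(\<lambda>(z, y). f z y) \<in> borel_measurable (M \<Otimes>\<^sub>M borel)" "g \<in> borel_measurable M" "h \<in> borel_measurable M"
  shows "(\<lambda>z. S_fun \<alpha> (g z) (f z) (h z)) \<in> borel_measurable M"
proof -
  interpret prob_space "ml_law \<alpha>" by (rule prob_space_ml_law[OF \<alpha>])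
  show ?thesis unfolding S_fun_def by measurable
qed

lemma measurable_duhamel:
  fixes f :: "'a::euclidean_space \<Rightarrow> ennreal"
  assumes \<alpha>: "0 < \<alpha>" "\<alpha> < 1"
    and [measurable]: "f \<in> borel_measurable borel" "(\<lambda>(t, x). u t x) \<in> borel_measurable (borel \<Otimes>\<^sub>M borel)"
  shows "(\<lambda>(t, x). duhamel \<alpha> p f u t x) \<in> borel_measurable (borel \<Otimes>\<^sub>M borel)"
proof -
  note [measurable (raw)] = measurable_P_fun[OF \<alpha>] measurable_S_fun[OF \<alpha>]
  have [measurable]: "Measurable.pred ((borel \<Otimes>\<^sub>M borel) \<Otimes>\<^sub>M lborel) (\<lambda>z. snd z \<in> {0<..<fst (fst z :: real \<times> 'a)})"
    unfolding greaterThanLessThan_iff by measurable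
  show ?thesis unfolding duhamel_def by measurable
qed

lemma heat_fun_SUP:
  fixes f :: "nat \<Rightarrow> 'a::euclidean_space \<Rightarrow> ennreal"
  assumes "incseq f" and [measurable]: "\<And>n. f n \<in> borel_measurable borel"
  shows "heat_fun t (\<lambda>y. SUP n. f n y) x = (SUP n. heat_fun t (f n) x)"
  unfolding heat_fun_def SUP_mult_left_ennreal[symmetric]
  by (subst nn_integral_monotone_convergence_SUP[symmetric])
     (use assms(1) in \<open>auto simp: incseq_def le_fun_def SUP_mult_left_ennreal intro!: mult_left_mono\<close>)

lemma S_fun_SUP:
  fixes f :: "nat \<Rightarrow> 'a::euclidean_space \<Rightarrow> ennreal"
  assumes "incseq f" and [measurable]: "\<And>n. f n \<in> borel_measurable borel"
  shows "S_fun \<alpha> t (\<lambda>y. SUP n. f n y) x = (SUP n. S_fun \<alpha> t (f n) x)"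
  unfolding S_fun_def heat_fun_SUP[OF assms]
  by (subst nn_integral_monotone_convergence_SUP[symmetric])
     (use assms(1) in \<open>auto simp: incseq_def le_fun_def SUP_mult_left_ennreal intro!: mult_left_mono heat_fun_mono\<close>)

text \<open>Continuity along increasing sequences, which makes the supremum of the iterates a fixed
  point. It rests on monotone convergence in the space variable, in \<open>\<theta>\<close> and in
  \<open>s\<close>, and on \<open>ennpowr_SUP\<close> for the nonlinearity.\<close>

lemma duhamel_SUP:
  fixes f :: "'a::euclidean_space \<Rightarrow> ennreal" and u :: "nat \<Rightarrow> real \<Rightarrow> 'a \<Rightarrow> ennreal"
  assumes \<alpha>: "0 < \<alpha>" "\<alpha> < 1" and p: "p > 0" and inc: "incseq u"
    and [measurable]: "\<And>n. (\<lambda>(t, x). u n t x) \<in> borel_measurable (borel \<Otimes>\<^sub>M borel)"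
  shows "duhamel \<alpha> p f (\<lambda>t x. SUP n. u n t x) t x = (SUP n. duhamel \<alpha> p f (u n) t x)"
proof -
  let ?S = "\<lambda>n s. S_fun \<alpha> (t - s) (\<lambda>y. ennpowr (u n s y) p) x"
  note [measurable (raw)] = measurable_P_fun[OF \<alpha>] measurable_S_fun[OF \<alpha>]
  have um: "u m s y \<le> u n s y" if "m \<le> n" for m n s y using inc that by (auto simp: incseq_def le_fun_def)
  define g where "g n s = ennreal ((t - s) powr (\<alpha> - 1)) * ?S n s * indicator {0<..<t} s" for n s
  have [measurable]: "g n \<in> borel_measurable lborel" for n unfolding g_def by measurable
  have incg: "incseq g"
    unfolding incseq_def le_fun_def g_def S_fun_def
    by (intro allI impI mult_right_mono mult_left_mono nn_integral_mono heat_fun_mono ennpowr_mono um p) auto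
  have "ennreal ((t - s) powr (\<alpha> - 1)) * S_fun \<alpha> (t - s) (\<lambda>y. ennpowr (SUP n. u n s y) p) x * indicator {0<..<t} s = (SUP n. g n s)" for s
  proof -
    have "S_fun \<alpha> (t - s) (\<lambda>y. ennpowr (SUP n. u n s y) p) x = (SUP n. ?S n s)"
      using p by (subst S_fun_SUP[symmetric]) (auto simp: ennpowr_SUP incseq_def le_fun_def intro!: ennpowr_mono um)
    then show ?thesis unfolding g_def by (simp add: SUP_mult_left_ennreal SUP_mult_right_ennreal)
  qed
  then have "duhamel \<alpha> p f (\<lambda>t x. SUP n. u n t x) t x = P_fun \<alpha> t f x + ennreal \<alpha> * (SUP n. \<integral>\<^sup>+s. g n s \<partial>lborel)"
    unfolding duhamel_def by (simp add: nn_integral_monotone_convergence_SUP[OF incg])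
  also have "\<dots> = (SUP n. duhamel \<alpha> p f (u n) t x)"
    unfolding duhamel_def g_def[symmetric] by (simp add: SUP_mult_left_ennreal ennreal_SUP_add_right)
  finally show ?thesis .
qed

text \<open>Causality: only times in \<open>(0, t)\<close> enter, so a comparison valid below
  \<open>T\<close> can be iterated below \<open>T\<close>.\<close>

lemma duhamel_mono:
  assumes "p > 0" "\<And>s y. 0 < s \<Longrightarrow> s < t \<Longrightarrow> u s y \<le> v s y"
  shows "duhamel \<alpha> p f u t x \<le> duhamel \<alpha> p f v t x"
  unfolding duhamel_def S_fun_def
proof (intro add_left_mono mult_left_mono nn_integral_mono)
  fix s
  show "ennreal ((t - s) powr (\<alpha> - 1)) * (\<integral>\<^sup>+\<theta>. ennreal \<theta> * heat_fun ((t - s) powr \<alpha> * \<theta>) (\<lambda>y. ennpowr (u s y) p) x \<partial>ml_law \<alpha>) * indicator {0<..<t} s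
    \<le> ennreal ((t - s) powr (\<alpha> - 1)) * (\<integral>\<^sup>+\<theta>. ennreal \<theta> * heat_fun ((t - s) powr \<alpha> * \<theta>) (\<lambda>y. ennpowr (v s y) p) x \<partial>ml_law \<alpha>) * indicator {0<..<t} s"
    by (cases "s \<in> {0<..<t}") (auto intro!: mult_left_mono nn_integral_mono heat_fun_mono ennpowr_mono assms)
qed auto

text \<open>The equation for \<open>u\<close> holds at all \<open>t\<close> and \<open>x\<close>,
  possibly with infinite values, because the iterates started at 0 increase whatever
  \<open>V\<close> is. The supersolution serves to bound them for times in
  \<open>(0, T)\<close>.\<close>

lemma ex_fixed_point_below_supersolution:
  fixes f :: "'a::euclidean_space \<Rightarrow> ennreal"
  assumes \<alpha>: "0 < \<alpha>" "\<alpha> < 1" and p: "p > 0" and f: "f \<in> borel_measurable borel"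
    and V: "\<And>t x. 0 < t \<Longrightarrow> t < T \<Longrightarrow> duhamel \<alpha> p f V t x \<le> V t x"
  obtains u where "(\<lambda>(t, x). u t x) \<in> borel_measurable (borel \<Otimes>\<^sub>M borel)"
    and "\<And>t x. 0 < t \<Longrightarrow> t < T \<Longrightarrow> u t x \<le> V t x"
    and "\<And>t x. u t x = duhamel \<alpha> p f u t x"
proof
  define U where "U n = (duhamel \<alpha> p f ^^ n) (\<lambda>_ _. 0)" for n
  have U0: "U 0 = (\<lambda>_ _. 0)" and USuc: "U (Suc n) = duhamel \<alpha> p f (U n)" for n by (simp_all add: U_def)
  have meas: "(\<lambda>(t, x). U n t x) \<in> borel_measurable (borel \<Otimes>\<^sub>M borel)" for n
  proof (induction n)
    case (Suc n)
    then show ?case unfolding USuc by (intro measurable_duhamel \<alpha> f)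
  qed (simp add: U0)
  have "U n \<le> U (Suc n)" for n
  proof (induction n)
    case (Suc n)
    show ?case unfolding le_fun_def USuc[of "Suc n"]
    proof (intro allI)
      fix t x
      have "U (Suc n) t x = duhamel \<alpha> p f (U n) t x" by (simp add: USuc)
      also have "\<dots> \<le> duhamel \<alpha> p f (U (Suc n)) t x" using Suc by (intro duhamel_mono p) (auto simp: le_fun_def)
      finally show "U (Suc n) t x \<le> duhamel \<alpha> p f (U (Suc n)) t x" .
    qed
  qed (simp add: U0 le_fun_def)
  then have inc: "incseq U" by (rule incseq_SucI)
  have le: "U n t x \<le> V t x" if "0 < t" "t < T" for n t x
    using that
  proof (induction n arbitrary: t x)
    case (Suc n)
    have "U (Suc n) t x \<le> duhamel \<alpha> p f V t x" unfolding USuc using Suc by (intro duhamel_mono p) auto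
    also have "\<dots> \<le> V t x" using Suc by (intro V)
    finally show ?case .
  qed (simp add: U0)
  show "(\<lambda>(t, x). SUP n. U n t x) \<in> borel_measurable (borel \<Otimes>\<^sub>M borel)" using meas by measurable
  show "(SUP n. U n t x) \<le> V t x" if "0 < t" "t < T" for t x using le[OF that] by (intro SUP_least)
  show "(SUP n. U n t x) = duhamel \<alpha> p f (\<lambda>t x. SUP n. U n t x) t x" for t x
  proof -
    have "duhamel \<alpha> p f (\<lambda>t x. SUP n. U n t x) t x = (SUP n. U (Suc n) t x)"
      unfolding USuc by (rule duhamel_SUP[OF \<alpha> p inc meas])
    also have "\<dots> = (SUP n. U n t x)"
    proof (rule antisym)
      show "(SUP n. U n t x) \<le> (SUP n. U (Suc n) t x)"
        using inc by (intro SUP_mono) (auto simp: incseq_Suc_iff le_fun_def)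
      show "(SUP n. U (Suc n) t x) \<le> (SUP n. U n t x)" by (intro SUP_mono) auto
    qed
    finally show ?thesis ..
  qed
qed

section \<open>Powers of operational time with exponential damping\<close>

lemma ennreal_le_divide:
  assumes "c > 0" "d \<ge> 0" "ennreal c * x \<le> ennreal d"
  shows "x \<le> ennreal (d / c)"
proof -
  have "ennreal (1 / c) * (ennreal c * x) \<le> ennreal (1 / c) * ennreal d" using assms by (intro mult_left_mono) auto
  then show ?thesis using assms by (simp add: mult.assoc[symmetric] ennreal_mult[symmetric])
qed

text \<open>Dropping the exponential gives the bound with \<open>\<sigma>\<close> and the constant
  \<open>1 / (1 - b)\<close>, written as a Gamma quotient; extending the range to infinity gives the
  bound with \<open>Q\<close>. The sum of the constants covers both cases.\<close>

lemma nn_integral_damped_power_le: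
  fixes b Q \<sigma> :: real
  assumes b: "b < 1" and Q: "Q > 0" and \<sigma>: "\<sigma> > 0"
  shows "(\<integral>\<^sup>+\<tau>. ennreal (\<tau> powr (- b) * exp (- (1 / Q) * \<tau>)) * indicator {0<..<\<sigma>} \<tau> \<partial>lborel)
    \<le> ennreal ((Gamma (1 - b) / Gamma (2 - b) + Gamma (1 - b)) * min \<sigma> Q powr (1 - b))" (is "?I \<le> _")
proof -
  let ?l = "\<lambda>w. (Q * w powr 1) powr (- b) * exp (- (1 / Q) * (Q * w powr 1))"
  let ?r = "\<lambda>w. (ennreal (exp (- w) * w powr (- b)) * indicator {0<..} w)"
  have G: "Gamma (1 - b) > 0" "Gamma (2 - b) > 0" using b by (auto intro: Gamma_real_pos)
  have "?I \<le> (\<integral>\<^sup>+\<tau>. ennreal ((\<sigma> - \<tau>) powr (1 - 1) * \<tau> powr ((1 - b) - 1)) * indicator {0<..<\<sigma>} \<tau> \<partial>lborel)"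
    using Q by (intro nn_integral_mono) (auto split: split_indicator intro!: ennreal_leI mult_left_le)
  also have "\<dots> = ennreal (\<sigma> powr (1 + (1 - b) - 1) * (Gamma 1 * Gamma (1 - b) / Gamma (1 + (1 - b))))"
    using b \<sigma> by (intro nn_integral_beta_kernel) auto
  finally have I1: "?I \<le> ennreal (Gamma (1 - b) / Gamma (2 - b) * \<sigma> powr (1 - b))"
    by (simp add: mult.commute)
  have "?I \<le> (\<integral>\<^sup>+\<tau>. ennreal (\<tau> powr (- b) * exp (- (1 / Q) * \<tau>)) * indicator {0<..} \<tau> \<partial>lborel)"
    by (intro nn_integral_mono) (auto split: split_indicator)
  also have "\<dots> = (\<integral>\<^sup>+w. ennreal (?l w) * ennreal (Q * 1 * w powr (1 - 1)) * indicator {0<..} w \<partial>lborel)"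
    using Q by (intro nn_integral_powr_substitution) auto
  also have "\<dots> = (\<integral>\<^sup>+w. ennreal (Q powr (1 - b)) * ?r w \<partial>lborel)"
  proof (intro nn_integral_cong)
    fix w :: real
    show "ennreal (?l w) * ennreal (Q * 1 * w powr (1 - 1)) * indicator {0<..} w
      = ennreal (Q powr (1 - b)) * ?r w"
    proof (cases "w > 0")
      case True
      have "?l w * (Q * 1 * w powr (1 - 1))
        = Q powr (1 - b) * (exp (- w) * w powr (- b))"
        using True Q by (simp add: powr_mult powr_diff powr_minus field_simps)
      then show ?thesis using True Q by (simp add: ennreal_mult[symmetric] del: powr_one)
    qed simp
  qed
  also have "\<dots> = ennreal (Q powr (1 - b)) * ennreal (Gamma (1 - b))"
    using nn_integral_exp_powr[of "- b"] b by (subst nn_integral_cmult) auto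
  finally have I2: "?I \<le> ennreal (Gamma (1 - b) * Q powr (1 - b))"
    using G by (simp add: ennreal_mult[symmetric] mult.commute)
  show ?thesis
  proof (cases "\<sigma> \<le> Q")
    case True
    show ?thesis unfolding min_absorb1[OF True]
      by (intro order_trans[OF I1] ennreal_leI mult_right_mono) (use G in auto)
  next
    case False
    then have "Q \<le> \<sigma>" by simp
    show ?thesis unfolding min_absorb2[OF \<open>Q \<le> \<sigma>\<close>]
      by (intro order_trans[OF I2] ennreal_leI mult_right_mono) (use G in auto)
  qed
qed

text \<open>Beyond \<open>Q\<close>, one of the two exponentials is spent on
  \<open>(\<tau> / Q) powr b \<le> exp (\<tau> / Q)\<close> to restore the power of
  \<open>\<tau>\<close>. The other remains and makes the integral over all operational times finite.
  This is the origin of the 2 in the damping.\<close>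

lemma damped_power_ge:
  fixes b Q \<tau> :: real
  assumes b: "0 < b" "b < 1" and Q: "Q > 0" and \<tau>: "\<tau> > 0"
  shows "min \<tau> Q powr (- b) * exp (- (2 * \<tau> / Q)) \<le> \<tau> powr (- b) * exp (- (1 / Q) * \<tau>)"
proof (cases "\<tau> \<le> Q")
  case True
  have "exp (- (2 * \<tau> / Q)) \<le> exp (- (1 / Q) * \<tau>)" using Q \<tau> by (simp add: field_simps)
  then have "\<tau> powr (- b) * exp (- (2 * \<tau> / Q)) \<le> \<tau> powr (- b) * exp (- (1 / Q) * \<tau>)"
    by (intro mult_left_mono) auto
  then show ?thesis using True by (simp only: min_absorb1)
next
  case False
  define x where "x = \<tau> / Q"
  have x: "x > 1" "\<tau> = Q * x" using False Q by (auto simp: x_def)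
  have "x powr b \<le> x powr 1" using x b by (intro powr_mono) auto
  also have "\<dots> = x" using x by simp
  also have "x \<le> exp x" using exp_ge_add_one_self[of x] by linarith
  finally have "Q powr (- b) * exp (- (2 * x)) * x powr b \<le> Q powr (- b) * exp (- (2 * x)) * exp x"
    by (intro mult_left_mono) auto
  also have "\<dots> = Q powr (- b) * exp (- x)" by (simp add: mult.assoc exp_add[symmetric])
  finally have "Q powr (- b) * exp (- (2 * x)) \<le> Q powr (- b) * exp (- x) * x powr (- b)"
    using x by (simp only: powr_minus_divide times_divide_eq_right mult_1_right) (subst pos_le_divide_eq, simp_all)
  then show ?thesis using False Q x by (simp add: min_def powr_mult mult_ac)
qed

text \<open>The Harnack constant over the volume of the unit ball, as in
  \<open>heat_fun_le_local_mass\<close>; the last power of 2 comes from the radius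
  \<open>sqrt m / 2\<close> in \<open>profile_le\<close>.\<close>

definition growth_const :: "nat \<Rightarrow> real \<Rightarrow> real \<Rightarrow> real" where
  "growth_const n p r = 2 powr (real n / 2) * exp (1/4) / unit_ball_vol n * 2 powr (2 * r / (p - 1))"

section \<open>The supersolution and its estimates\<close>

context
  fixes \<alpha> T p r A B :: real and f :: "'a::euclidean_space \<Rightarrow> ennreal"
  assumes \<alpha>: "0 < \<alpha>" "\<alpha> < 1" and T: "T > 0" and r: "1 < r" "r < p" and A: "A \<ge> 0"
    and B: "B = growth_const DIM('a) p r * A"
    and f[measurable]: "f \<in> borel_measurable borel"
    and mass: "\<And>z \<rho>. 0 < \<rho> \<Longrightarrow> \<rho>\<^sup>2 < T powr \<alpha> \<Longrightarrow>
       (\<integral>\<^sup>+y\<in>ball z \<rho>. ennpowr (f y) r \<partial>lborel) \<le> ennreal (A * \<rho> powr (real DIM('a) - 2 * r / (p - 1)))"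
begin

interpretation L: prob_space "ml_law \<alpha>" by (rule prob_space_ml_law[OF \<alpha>])

definition profile :: "real \<Rightarrow> 'a \<Rightarrow> ennreal" where
  "profile \<sigma> = heat_fun \<sigma> (\<lambda>y. ennpowr (f y) r)"

text \<open>Up to a factor, \<open>profile \<sigma> powr (1 / r)\<close> is a supersolution of the classical heat equation with
  nonlinearity damped by \<open>exp (- 2 * \<sigma> / T powr \<alpha>)\<close>, for all times \<open>\<sigma>\<close>; without the damping
  one need not exist. By Hoelder the damping is absorbed into an exponential moment of \<open>\<theta>\<close>.\<close>

definition supersol :: "real \<Rightarrow> 'a \<Rightarrow> ennreal" where
  "supersol t x = 2 * (\<integral>\<^sup>+\<theta>. ennpowr (profile (t powr \<alpha> * \<theta>) x) (1 / r) \<partial>ml_law \<alpha>)"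

lemma B_nonneg: "B \<ge> 0"
  using A by (simp add: B growth_const_def)

lemma measurable_profile[measurable (raw)]:
  assumes [measurable]: "g \<in> borel_measurable M" "h \<in> borel_measurable M"
  shows "(\<lambda>z. profile (g z) (h z)) \<in> borel_measurable M"
  unfolding profile_def by measurable

lemma profile_le:
  assumes \<sigma>: "\<sigma> > 0"
  shows "profile \<sigma> x \<le> ennreal (B * min \<sigma> (T powr \<alpha>) powr (- (r / (p - 1))))"
proof -
  define m where "m = min \<sigma> (T powr \<alpha>)"
  define C where "C = 2 powr (real DIM('a) / 2) * exp (1/4)"
  define v where "v = unit_ball_vol (real DIM('a))"
  define N where "N = real DIM('a)"
  define e where "e = r / (p - 1)"
  have v: "v > 0" by (simp add: v_def)
  have m: "m > 0" "m \<le> \<sigma>" "m \<le> T powr \<alpha>" using \<sigma> T by (auto simp: m_def)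
  \<comment> \<open>Halving makes \<open>\<rho>\<^sup>2 = m / 4\<close> strictly smaller than
    \<open>T powr \<alpha>\<close>, as \<open>mass\<close> demands, even when
    \<open>m = T powr \<alpha>\<close>.\<close>
  define \<rho> where "\<rho> = sqrt m / 2"
  have \<rho>: "\<rho> > 0" "\<rho>\<^sup>2 = m / 4" using m by (auto simp: \<rho>_def power_divide)
  have "ennreal (v * \<rho> ^ DIM('a)) * profile \<sigma> x \<le> ennreal C * ennreal (A * \<rho> powr (N - 2 * e))"
    unfolding v_def C_def profile_def
  proof (rule heat_fun_le_local_mass)
    show "\<rho>\<^sup>2 \<le> \<sigma>" using \<rho> m by simp
    show "(\<integral>\<^sup>+y\<in>ball z \<rho>. ennpowr (f y) r \<partial>lborel) \<le> ennreal (A * \<rho> powr (N - 2 * e))" for z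
      using mass[of \<rho> z] \<rho> m by (simp add: N_def e_def)
  qed (use \<sigma> \<rho> in auto)
  also have "\<dots> = ennreal (C * (A * \<rho> powr (N - 2 * e)))" using A by (simp add: C_def ennreal_mult)
  finally have "profile \<sigma> x \<le> ennreal (C * (A * \<rho> powr (N - 2 * e)) / (v * \<rho> ^ DIM('a)))"
    using A v \<rho> by (intro ennreal_le_divide) (auto simp: C_def)
  also have "C * (A * \<rho> powr (N - 2 * e)) / (v * \<rho> ^ DIM('a)) = C / v * A * (\<rho> powr (- (2 * e)))"
  proof -
    have "\<rho> powr (N - 2 * e) = \<rho> ^ DIM('a) * \<rho> powr (- (2 * e))"
      using \<rho> powr_add[of \<rho> N "- (2 * e)"] by (simp add: N_def powr_realpow)
    then show ?thesis using \<rho> v by simp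
  qed
  also have "\<rho> powr (- (2 * e)) = 2 powr (2 * e) * m powr (- e)"
  proof -
    have rho: "\<rho> = m powr (1/2) / 2" using m by (simp add: \<rho>_def powr_half_sqrt)
    have "\<rho> powr (- (2 * e)) = (m powr (1/2)) powr (- (2 * e)) / 2 powr (- (2 * e))"
      unfolding rho by (simp add: powr_divide)
    also have "\<dots> = 2 powr (2 * e) * m powr (- e)" by (simp add: powr_powr powr_minus_divide)
    finally show ?thesis .
  qed
  also have "C / v * A * (2 powr (2 * e) * m powr (- e)) = B * m powr (- e)"
    by (simp add: B growth_const_def C_def v_def e_def)
  finally show ?thesis by (simp add: m_def e_def)
qed

lemma profile_cases:
  assumes \<sigma>: "\<sigma> > 0"
  obtains h where "h \<ge> 0" "profile \<sigma> x = ennreal h" "h \<le> B * min \<sigma> (T powr \<alpha>) powr (- (r / (p - 1)))"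
proof (cases "profile \<sigma> x")
  case (real h)
  have "B * min \<sigma> (T powr \<alpha>) powr (- (r / (p - 1))) \<ge> 0" using B_nonneg by simp
  then show ?thesis using that real profile_le[OF \<sigma>, of x] by simp
next
  case top
  then show ?thesis using profile_le[OF \<sigma>, of x] by (simp add: top_unique)
qed

text \<open>Jensen's inequality for the heat kernel, a probability density in \<open>y\<close>.
  Through it the \<open>r\<close>-th power of \<open>f\<close> controls the linear part of the
  equation.\<close>

lemma heat_fun_le_profile_root:
  assumes \<sigma>: "\<sigma> > 0"
  shows "heat_fun \<sigma> f x \<le> ennpowr (profile \<sigma> x) (1 / r)"
proof -
  define M where "M = density lborel (\<lambda>y. ennreal (heat_kernel \<sigma> (x - y)))"
  have "emeasure M (space M) \<le> ennreal 1"
    using nn_integral_heat_kernel_diff[OF \<sigma>, of x] by (simp add: M_def emeasure_density)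
  then have "ennpowr (\<integral>\<^sup>+y. f y \<partial>M) r \<le> ennreal (1 powr (r - 1)) * (\<integral>\<^sup>+y. ennpowr (f y) r \<partial>M)"
    using r by (intro nn_integral_jensen) (auto simp: M_def)
  then have "ennpowr (heat_fun \<sigma> f x) r \<le> profile \<sigma> x"
    by (simp add: M_def heat_fun_def profile_def nn_integral_density)
  then have "ennpowr (ennpowr (heat_fun \<sigma> f x) r) (1 / r) \<le> ennpowr (profile \<sigma> x) (1 / r)"
    using r by (intro ennpowr_mono) auto
  then show ?thesis using r by (simp add: ennpowr_ennpowr)
qed

text \<open>One factor of \<open>profile \<tau>\<close> is kept, because the heat semigroup acts
  linearly on it; the remaining power \<open>(p - r) / r\<close>, positive since
  \<open>r < p\<close>, is bounded by \<open>profile_le\<close> and yields the time weight with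
  exponent \<open>- b\<close>. As \<open>\<tau> \<le> T powr \<alpha> * \<theta>\<close>, the factor
  \<open>exp (- (2 * \<theta>))\<close> acts as a damping in \<open>\<tau>\<close>.\<close>

lemma profile_power_le:
  assumes \<tau>: "\<tau> > 0" "\<tau> \<le> T powr \<alpha> * \<theta>"
  defines "b \<equiv> (p - r) / (p - 1)"
  shows "ennpowr (ennpowr (profile \<tau> x) (1 / r)) p * ennreal (exp (- (2 * \<theta>)))
    \<le> ennreal (B powr ((p - r) / r)) * (ennreal (\<tau> powr (- b) * exp (- (1 / T powr \<alpha>) * \<tau>)) * profile \<tau> x)"
proof -
  define Q where "Q = T powr \<alpha>"
  have Q: "Q > 0" using T by (simp add: Q_def)
  define m where "m = min \<tau> Q"
  have m: "m > 0" using Q \<tau> by (simp add: m_def)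
  obtain h where h: "h \<ge> 0" "profile \<tau> x = ennreal h" "h \<le> B * m powr (- (r / (p - 1)))"
    using profile_cases[OF \<tau>(1), of x] unfolding m_def Q_def by metis
  have b: "0 < b" "b < 1" using r by (auto simp: b_def)
  have "h powr (p / r) = h * h powr ((p - r) / r)"
  proof (cases "h = 0")
    case False
    then show ?thesis using h r powr_add[of h 1 "(p - r) / r"] by (simp add: diff_divide_distrib)
  qed simp
  also have "\<dots> \<le> h * (B * m powr (- (r / (p - 1)))) powr ((p - r) / r)"
    using h r by (intro mult_left_mono powr_mono2) auto
  also have "(B * m powr (- (r / (p - 1)))) powr ((p - r) / r) = B powr ((p - r) / r) * m powr (- b)"
    using B_nonneg m r by (simp add: powr_mult powr_powr b_def)
  finally have "h powr (p / r) * exp (- (2 * \<theta>)) \<le> h * (B powr ((p - r) / r) * m powr (- b)) * exp (- (2 * \<theta>))"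
    by (intro mult_right_mono) auto
  also have "\<dots> \<le> h * (B powr ((p - r) / r) * m powr (- b)) * exp (- (2 * \<tau> / Q))"
    using h \<tau> Q by (intro mult_left_mono) (auto simp: Q_def field_simps)
  also have "\<dots> = B powr ((p - r) / r) * ((m powr (- b) * exp (- (2 * \<tau> / Q))) * h)" by (simp only: mult_ac)
  also have "\<dots> \<le> B powr ((p - r) / r) * ((\<tau> powr (- b) * exp (- (1 / Q) * \<tau>)) * h)"
    using damped_power_ge[OF b Q \<tau>(1)] h by (intro mult_left_mono mult_right_mono) (auto simp: m_def)
  finally have "ennreal (h powr (p / r) * exp (- (2 * \<theta>))) \<le> ennreal \<dots>" by (rule ennreal_leI)
  then show ?thesis using h by (simp add: powr_powr ennpowr_ennreal ennreal_mult' Q_def mult.assoc)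
qed

text \<open>The way back from \<open>profile\<close> to its root: the surplus power
  \<open>1 - 1 / r\<close> is bounded by \<open>profile_le\<close>, whose negative power of time
  cancels the positive one gained by integrating over operational time.\<close>

lemma profile_mult_le:
  assumes \<sigma>: "\<sigma> > 0" and C: "C \<ge> 0"
  shows "ennreal (C * min \<sigma> (T powr \<alpha>) powr ((r - 1) / (p - 1))) * profile \<sigma> x
    \<le> ennreal (C * B powr (1 - 1 / r)) * ennpowr (profile \<sigma> x) (1 / r)"
proof -
  define m where "m = min \<sigma> (T powr \<alpha>)"
  have m: "m > 0" using T \<sigma> by (simp add: m_def)
  obtain h where h: "h \<ge> 0" "profile \<sigma> x = ennreal h" "h \<le> B * m powr (- (r / (p - 1)))"
    using profile_cases[OF \<sigma>, of x] unfolding m_def by metis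
  have "h = h powr (1 / r) * h powr (1 - 1 / r)"
    using h by (cases "h = 0") (simp_all add: powr_add[symmetric])
  also have "\<dots> \<le> h powr (1 / r) * (B * m powr (- (r / (p - 1)))) powr (1 - 1 / r)"
    using h r by (intro mult_left_mono powr_mono2) auto
  also have "(B * m powr (- (r / (p - 1)))) powr (1 - 1 / r) = B powr (1 - 1 / r) * m powr (- ((r - 1) / (p - 1)))"
  proof -
    have "r / (p - 1) * (1 - 1 / r) = (r - 1) / (p - 1)" using r by (simp add: field_simps)
    then have "(m powr (- (r / (p - 1)))) powr (1 - 1 / r) = m powr (- ((r - 1) / (p - 1)))"
      unfolding powr_powr by (simp only: mult_minus_left)
    then show ?thesis using B_nonneg by (simp add: powr_mult)
  qed
  finally have "C * m powr ((r - 1) / (p - 1)) * h \<le> C * m powr ((r - 1) / (p - 1)) *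
      (h powr (1 / r) * (B powr (1 - 1 / r) * m powr (- ((r - 1) / (p - 1)))))"
    using C by (intro mult_left_mono) auto
  also have "\<dots> = C * B powr (1 - 1 / r) * h powr (1 / r)"
    using m by (simp add: powr_minus field_simps)
  finally have "ennreal (C * m powr ((r - 1) / (p - 1)) * h) \<le> ennreal \<dots>" by (rule ennreal_leI)
  then show ?thesis using h C by (simp add: ennpowr_ennreal ennreal_mult' m_def)
qed

text \<open>A crude bound for the proof of finiteness: it replaces the root by an expression to
  which the semigroup law applies.\<close>

lemma profile_root_le: "ennpowr (profile \<sigma> x) (1 / r) \<le> 1 + profile \<sigma> x"
proof (cases "profile \<sigma> x")
  case (real h)
  have "h powr (1 / r) \<le> 1 + h"
  proof (cases "h \<le> 1")
    case True
    then have "h powr (1 / r) \<le> 1" using real r by (intro powr_le1) auto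
    then show ?thesis using real by simp
  next
    case False
    then have "h powr (1 / r) \<le> h powr 1" using r by (intro powr_mono) auto
    then show ?thesis using False by simp
  qed
  then have "ennreal (h powr (1 / r)) \<le> ennreal (1 + h)" by (rule ennreal_leI)
  then show ?thesis using real by (simp add: ennpowr_ennreal ennreal_plus)
qed simp

text \<open>Bounding \<open>profile\<close> pointwise would call for the moment of order
  \<open>- 1 / (p - 1)\<close> of \<open>\<theta>\<close>, which need not be finite. Integrating
  against the heat kernel at time 1 moves every operational time beyond 1, where
  \<open>profile_le\<close> is uniform; so the Gaussian average is finite, and with it almost every
  value.\<close>

lemma supersol_finite:
  assumes t: "0 < t"
  shows "AE x in lborel. supersol t x < \<infinity>"
proof -
  let ?k = "\<lambda>x. ennreal (heat_kernel 1 (0 - x))"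
  let ?w = "\<lambda>\<theta> x. ennpowr (profile (t powr \<alpha> * \<theta>) x) (1 / r)"
  define Q where "Q = T powr \<alpha>"
  define c where "c = B * min 1 Q powr (- (r / (p - 1)))"
  have Q: "Q > 0" using T by (simp add: Q_def)
  have bound: "heat_fun 1 (profile \<sigma>) 0 \<le> ennreal c" if \<sigma>: "\<sigma> > 0" for \<sigma>
  proof -
    have "heat_fun 1 (profile \<sigma>) 0 = profile (1 + \<sigma>) 0"
      unfolding profile_def using \<sigma> by (intro heat_fun_semigroup) auto
    also have "\<dots> \<le> ennreal (B * min (1 + \<sigma>) Q powr (- (r / (p - 1))))"
      using profile_le[of "1 + \<sigma>" 0] \<sigma> by (simp add: Q_def)
    also have "\<dots> \<le> ennreal c"
      unfolding c_def using \<sigma> Q r B_nonneg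
      by (intro ennreal_leI mult_left_mono powr_mono2') auto
    finally show ?thesis .
  qed
  interpret LB: pair_sigma_finite "ml_law \<alpha>" "lborel :: 'a measure" ..
  have "(\<integral>\<^sup>+x. ?k x * supersol t x \<partial>lborel)
     = 2 * (\<integral>\<^sup>+x. (\<integral>\<^sup>+\<theta>. ?k x * ?w \<theta> x \<partial>ml_law \<alpha>) \<partial>lborel)"
    unfolding supersol_def by (simp add: nn_integral_cmult[symmetric] mult_ac)
  also have "(\<integral>\<^sup>+x. (\<integral>\<^sup>+\<theta>. ?k x * ?w \<theta> x \<partial>ml_law \<alpha>) \<partial>lborel)
     = (\<integral>\<^sup>+\<theta>. (\<integral>\<^sup>+x. ?k x * ?w \<theta> x \<partial>lborel) \<partial>ml_law \<alpha>)"
    by (rule LB.Fubini') measurable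
  also have "\<dots> \<le> (\<integral>\<^sup>+\<theta>. ennreal (1 + c) \<partial>ml_law \<alpha>)"
    using AE_ml_law_pos[of \<alpha>]
  proof (intro nn_integral_mono_AE, eventually_elim)
    case (elim \<theta>)
    have "(\<integral>\<^sup>+x. ?k x * ?w \<theta> x \<partial>lborel)
       \<le> (\<integral>\<^sup>+x. ?k x + ?k x * profile (t powr \<alpha> * \<theta>) x \<partial>lborel)"
    proof (intro nn_integral_mono)
      fix x
      have "?k x * ?w \<theta> x
        \<le> ?k x * (1 + profile (t powr \<alpha> * \<theta>) x)"
        by (intro mult_left_mono profile_root_le) auto
      then show "?k x * ?w \<theta> x
        \<le> ?k x + ?k x * profile (t powr \<alpha> * \<theta>) x"
        by (simp add: distrib_left)
    qed
    also have "\<dots> = 1 + heat_fun 1 (profile (t powr \<alpha> * \<theta>)) 0"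
      using nn_integral_heat_kernel_diff[of 1 "0::'a"]
      by (subst nn_integral_add) (simp_all add: heat_fun_def)
    also have "\<dots> \<le> 1 + ennreal c" using t elim by (intro add_left_mono bound) auto
    also have "\<dots> = ennreal (1 + c)" using B_nonneg by (simp add: c_def ennreal_plus)
    finally show ?case .
  qed
  also have "\<dots> = ennreal (1 + c)" by (simp add: L.emeasure_space_1[simplified])
  finally have "(\<integral>\<^sup>+x. ennreal (heat_kernel 1 (0 - x)) * supersol t x \<partial>lborel) \<le> 2 * ennreal (1 + c)"
    by (simp add: mult_left_mono)
  also have "\<dots> < \<infinity>" by (simp add: ennreal_mult_less_top)
  finally have fin: "(\<integral>\<^sup>+x. ennreal (heat_kernel 1 (0 - x)) * supersol t x \<partial>lborel) \<noteq> \<infinity>" by simp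
  have [measurable]: "supersol t \<in> borel_measurable borel" unfolding supersol_def by measurable
  have "AE x in lborel. ennreal (heat_kernel 1 (0 - x)) * supersol t x \<noteq> \<infinity>"
    using fin by (intro nn_integral_PInf_AE) auto
  then show ?thesis
  proof eventually_elim
    case (elim x)
    have "heat_kernel 1 (0 - x) > 0" by (simp add: heat_kernel_def)
    then show ?case using elim by (auto simp: ennreal_mult_eq_top_iff less_top)
  qed
qed

text \<open>The linear and the nonlinear part are each at most half of \<open>supersol\<close>,
  which explains the factor 2 in its definition and the \<open>2 powr p\<close> in
  \<open>small\<close>. That condition involves neither \<open>t\<close> nor \<open>T\<close>, in
  accordance with the scaling of the hypothesis.\<close>

lemma duhamel_supersol_le:
  assumes t: "0 < t" "t < T"
    and small: "2 powr p * ml_exp_bound \<alpha> (2 / (p - 1)) powr (p - 1) *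
      (Gamma ((r - 1) / (p - 1)) / Gamma (1 + (r - 1) / (p - 1)) + Gamma ((r - 1) / (p - 1)))
      * B powr ((p - 1) / r) \<le> 1"
  shows "duhamel \<alpha> p f supersol t x \<le> supersol t x"
proof -
  define Q where "Q = T powr \<alpha>"
  define K where "K = ml_exp_bound \<alpha> (2 / (p - 1))"
  define b where "b = (p - r) / (p - 1)"
  define C2 where "C2 = Gamma (1 - b) / Gamma (2 - b) + Gamma (1 - b)"
  define j where "j \<tau> = ennreal (\<tau> powr (- b) * exp (- (1 / Q) * \<tau>))" for \<tau>
  define D where "D = 2 powr p * K powr (p - 1) * B powr ((p - r) / r)"
  have p: "p > 1" using r by simp
  have Q: "Q > 0" using T by (simp add: Q_def)
  have K: "K > 0" by (simp add: K_def ml_exp_bound_def)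
  have b: "0 < b" "b < 1" "1 - b = (r - 1) / (p - 1)" using r by (auto simp: b_def field_simps)
  have b2: "2 - b = 1 + (r - 1) / (p - 1)" using b(3) by simp
  have C2: "C2 \<ge> 0" unfolding C2_def using b
    by (intro add_nonneg_nonneg divide_nonneg_nonneg less_imp_le[OF Gamma_real_pos]) auto
  have D: "D \<ge> 0" by (simp add: D_def)
  have [measurable]: "j \<in> borel_measurable borel" unfolding j_def by measurable
  define w where "w \<sigma> y = ennpowr (profile \<sigma> y) (1 / r)" for \<sigma> y
  let ?I = "\<lambda>s. (\<integral>\<^sup>+\<phi>. ennreal \<phi> * (\<integral>\<^sup>+\<theta>. j (s powr \<alpha> * \<theta>) * profile ((t - s) powr \<alpha> * \<phi> + s powr \<alpha> * \<theta>) x \<partial>ml_law \<alpha>) \<partial>ml_law \<alpha>)"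
  let ?W = "(\<integral>\<^sup>+\<theta>. w (t powr \<alpha> * \<theta>) x \<partial>ml_law \<alpha>)"
  let ?S = "\<lambda>s. S_fun \<alpha> (t - s) (\<lambda>y. ennpowr (supersol s y) p) x"
  let ?N = "ennreal \<alpha> * (\<integral>\<^sup>+s. ennreal ((t - s) powr (\<alpha> - 1)) * ?S s * indicator {0<..<t} s \<partial>lborel)"
  have Vw: "supersol s y = 2 * (\<integral>\<^sup>+\<theta>. w (s powr \<alpha> * \<theta>) y \<partial>ml_law \<alpha>)" for s y by (simp add: supersol_def w_def)
  have lin: "P_fun \<alpha> t f x \<le> ?W"
    unfolding P_fun_def w_def using AE_ml_law_pos[of \<alpha>]
    by (intro nn_integral_mono_AE, eventually_elim) (use t in \<open>auto intro!: heat_fun_le_profile_root\<close>)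
  \<comment> \<open>Hoelder with \<open>g = 2 * \<theta>\<close>: the moment of
    \<open>exp (2 / (p - 1) * \<theta>)\<close> is paid by \<open>K\<close>, and the factor
    \<open>exp (- (2 * \<theta>))\<close> gained is what \<open>profile_power_le\<close>
    consumes.\<close>
  have pow: "ennpowr (supersol s y) p \<le> ennreal D * (\<integral>\<^sup>+\<theta>. j (s powr \<alpha> * \<theta>) * profile (s powr \<alpha> * \<theta>) y \<partial>ml_law \<alpha>)"
    if s: "0 < s" "s < T" for s y
  proof -
    have sQ: "s powr \<alpha> \<le> Q" unfolding Q_def using s \<alpha> by (intro powr_mono2) auto
    have "ennpowr (supersol s y) p = ennreal (2 powr p) * ennpowr (\<integral>\<^sup>+\<theta>. w (s powr \<alpha> * \<theta>) y \<partial>ml_law \<alpha>) p"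
      using p ennpowr_ennreal[of 2 p] by (simp add: Vw ennpowr_mult)
    also have "\<dots> \<le> ennreal (2 powr p) * (ennreal (K powr (p - 1)) *
        (\<integral>\<^sup>+\<theta>. ennpowr (w (s powr \<alpha> * \<theta>) y) p * ennreal (exp (- (2 * \<theta>))) \<partial>ml_law \<alpha>))"
    proof (intro mult_left_mono nn_integral_weighted_jensen)
      have "(\<integral>\<^sup>+\<theta>. ennreal (exp (2 / (p - 1) * \<theta>)) \<partial>ml_law \<alpha>) \<le> ennreal K"
        unfolding K_def using p by (intro ml_law_exp_moment \<alpha>) simp
      then show "(\<integral>\<^sup>+\<theta>. ennreal (exp (2 * \<theta> / (p - 1))) \<partial>ml_law \<alpha>) \<le> ennreal K" by simp
    qed (use p K in \<open>simp_all add: w_def\<close>)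
    also have "\<dots> \<le> ennreal (2 powr p) * (ennreal (K powr (p - 1)) *
        (\<integral>\<^sup>+\<theta>. ennreal (B powr ((p - r) / r)) * (j (s powr \<alpha> * \<theta>) * profile (s powr \<alpha> * \<theta>) y) \<partial>ml_law \<alpha>))"
    proof (intro mult_left_mono nn_integral_mono_AE)
      show "AE \<theta> in ml_law \<alpha>. ennpowr (w (s powr \<alpha> * \<theta>) y) p * ennreal (exp (- (2 * \<theta>)))
        \<le> ennreal (B powr ((p - r) / r)) * (j (s powr \<alpha> * \<theta>) * profile (s powr \<alpha> * \<theta>) y)"
        using AE_ml_law_pos[of \<alpha>]
      proof eventually_elim
        case (elim \<theta>)
        have "s powr \<alpha> * \<theta> \<le> T powr \<alpha> * \<theta>" using sQ elim by (intro mult_right_mono) (auto simp: Q_def)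
        then show ?case unfolding w_def j_def b_def Q_def using elim s by (intro profile_power_le) auto
      qed
    qed auto
    also have "\<dots> = ennreal D * (\<integral>\<^sup>+\<theta>. j (s powr \<alpha> * \<theta>) * profile (s powr \<alpha> * \<theta>) y \<partial>ml_law \<alpha>)"
      by (subst nn_integral_cmult) (auto simp: D_def ennreal_mult mult.assoc)
    finally show ?thesis .
  qed
  interpret LB: pair_sigma_finite "lborel :: 'a measure" "ml_law \<alpha>" ..
  \<comment> \<open>The semigroup law applies for each pair \<open>\<phi>\<close>,
    \<open>\<theta>\<close>: the outer heat flow lengthens \<open>profile\<close> to the sum of the
    two operational times, the form that \<open>ml_convolution_identity\<close> expects.\<close>
  have S: "?S s
     \<le> ennreal D * ?I s"
    if s: "0 < s" "s < t" for s
  proof -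
    have "?S s
      \<le> (\<integral>\<^sup>+\<phi>. ennreal D * (ennreal \<phi> * (\<integral>\<^sup>+\<theta>. j (s powr \<alpha> * \<theta>) * profile ((t - s) powr \<alpha> * \<phi> + s powr \<alpha> * \<theta>) x \<partial>ml_law \<alpha>)) \<partial>ml_law \<alpha>)"
      unfolding S_fun_def
      using AE_ml_law_pos[of \<alpha>]
    proof (intro nn_integral_mono_AE, eventually_elim)
      case (elim \<phi>)
      define \<rho> where "\<rho> = (t - s) powr \<alpha> * \<phi>"
      have \<rho>: "\<rho> > 0" using elim s by (simp add: \<rho>_def)
      let ?H = "\<lambda>y \<theta>. ennreal D * (ennreal (heat_kernel \<rho> (x - y)) * (j (s powr \<alpha> * \<theta>) * profile (s powr \<alpha> * \<theta>) y))"
      have "heat_fun \<rho> (\<lambda>y. ennpowr (supersol s y) p) x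
        \<le> heat_fun \<rho> (\<lambda>y. ennreal D * (\<integral>\<^sup>+\<theta>. j (s powr \<alpha> * \<theta>) * profile (s powr \<alpha> * \<theta>) y \<partial>ml_law \<alpha>)) x"
        using s t by (intro heat_fun_mono pow) auto
      also have "\<dots> = (\<integral>\<^sup>+y. (\<integral>\<^sup>+\<theta>. ?H y \<theta> \<partial>ml_law \<alpha>) \<partial>lborel)"
        unfolding heat_fun_def by (intro nn_integral_cong) (simp add: nn_integral_cmult mult_ac)
      also have "\<dots> = (\<integral>\<^sup>+\<theta>. (\<integral>\<^sup>+y. ?H y \<theta> \<partial>lborel) \<partial>ml_law \<alpha>)"
        by (rule LB.Fubini'[symmetric]) measurable
      also have "\<dots> = (\<integral>\<^sup>+\<theta>. ennreal D * (j (s powr \<alpha> * \<theta>) * profile (\<rho> + s powr \<alpha> * \<theta>) x) \<partial>ml_law \<alpha>)"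
        using AE_ml_law_pos[of \<alpha>]
      proof (intro nn_integral_cong_AE, eventually_elim)
        case (elim \<theta>)
        have "(\<integral>\<^sup>+y. ?H y \<theta> \<partial>lborel)
          = (\<integral>\<^sup>+y. (ennreal D * j (s powr \<alpha> * \<theta>)) * (ennreal (heat_kernel \<rho> (x - y)) * profile (s powr \<alpha> * \<theta>) y) \<partial>lborel)"
          by (intro nn_integral_cong) (simp only: mult_ac)
        also have "\<dots> = ennreal D * j (s powr \<alpha> * \<theta>) * heat_fun \<rho> (profile (s powr \<alpha> * \<theta>)) x"
          unfolding heat_fun_def by (rule nn_integral_cmult) measurable
        also have "heat_fun \<rho> (profile (s powr \<alpha> * \<theta>)) x = profile (\<rho> + s powr \<alpha> * \<theta>) x"
          unfolding profile_def using elim s \<rho> by (intro heat_fun_semigroup) auto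
        finally show ?case by (simp only: mult.assoc)
      qed
      also have "\<dots> = ennreal D * (\<integral>\<^sup>+\<theta>. j (s powr \<alpha> * \<theta>) * profile (\<rho> + s powr \<alpha> * \<theta>) x \<partial>ml_law \<alpha>)"
        by (rule nn_integral_cmult) measurable
      finally have "ennreal \<phi> * heat_fun \<rho> (\<lambda>y. ennpowr (supersol s y) p) x
        \<le> ennreal \<phi> * (ennreal D * (\<integral>\<^sup>+\<theta>. j (s powr \<alpha> * \<theta>) * profile (\<rho> + s powr \<alpha> * \<theta>) x \<partial>ml_law \<alpha>))"
        by (rule mult_left_mono) simp
      then show ?case by (simp only: \<rho>_def mult_ac)
    qed
    also have "\<dots> = ennreal D * ?I s"
      by (rule nn_integral_cmult) measurable
    finally show ?thesis .
  qed
  have "?N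
    \<le> ennreal \<alpha> * (\<integral>\<^sup>+s. ennreal ((t - s) powr (\<alpha> - 1)) * (ennreal D * ?I s) * indicator {0<..<t} s \<partial>lborel)"
  proof (intro mult_left_mono nn_integral_mono)
    fix s
    show "ennreal ((t - s) powr (\<alpha> - 1)) * ?S s * indicator {0<..<t} s
      \<le> ennreal ((t - s) powr (\<alpha> - 1)) * (ennreal D * ?I s) * indicator {0<..<t} s"
      using S[of s] by (cases "s \<in> {0<..<t}") (auto intro: mult_left_mono)
  qed auto
  also have "\<dots> = (\<integral>\<^sup>+s. ennreal D * (ennreal (\<alpha> * (t - s) powr (\<alpha> - 1)) * indicator {0<..<t} s * ?I s) \<partial>lborel)"
    using \<alpha> by (subst nn_integral_cmult[symmetric], measurable) (intro nn_integral_cong, simp add: ennreal_mult mult_ac)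
  also have "\<dots> = ennreal D * (\<integral>\<^sup>+s. ennreal (\<alpha> * (t - s) powr (\<alpha> - 1)) * indicator {0<..<t} s * ?I s \<partial>lborel)"
    by (rule nn_integral_cmult) measurable
  \<comment> \<open>From here on the fractional structure is gone: the inner integral over
    \<open>\<tau>\<close> is a classical one, and no further constant depending on
    \<open>\<alpha>\<close> arises.\<close>
  also have "\<dots> = ennreal D * (\<integral>\<^sup>+\<theta>. (\<integral>\<^sup>+\<tau>. j \<tau> * indicator {0<..<t powr \<alpha> * \<theta>} \<tau> \<partial>lborel) * profile (t powr \<alpha> * \<theta>) x \<partial>ml_law \<alpha>)"
    unfolding j_def using t Q b by (subst ml_convolution_identity[OF \<alpha>, where G = "\<lambda>\<sigma>. profile \<sigma> x"]) auto
  also have "\<dots> \<le> ennreal D * (\<integral>\<^sup>+\<theta>. ennreal (C2 * B powr (1 - 1 / r)) * w (t powr \<alpha> * \<theta>) x \<partial>ml_law \<alpha>)"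
  proof (intro mult_left_mono nn_integral_mono_AE)
    show "AE \<theta> in ml_law \<alpha>. (\<integral>\<^sup>+\<tau>. j \<tau> * indicator {0<..<t powr \<alpha> * \<theta>} \<tau> \<partial>lborel) * profile (t powr \<alpha> * \<theta>) x
      \<le> ennreal (C2 * B powr (1 - 1 / r)) * w (t powr \<alpha> * \<theta>) x"
      using AE_ml_law_pos[of \<alpha>]
    proof eventually_elim
      case (elim \<theta>)
      define \<sigma> where "\<sigma> = t powr \<alpha> * \<theta>"
      have \<sigma>: "\<sigma> > 0" using elim t by (simp add: \<sigma>_def)
      have "(\<integral>\<^sup>+\<tau>. j \<tau> * indicator {0<..<\<sigma>} \<tau> \<partial>lborel) * profile \<sigma> x \<le> ennreal (C2 * min \<sigma> Q powr (1 - b)) * profile \<sigma> x"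
        unfolding j_def C2_def using b Q \<sigma> by (intro mult_right_mono nn_integral_damped_power_le) auto
      also have "\<dots> \<le> ennreal (C2 * B powr (1 - 1 / r)) * w \<sigma> x"
        unfolding b(3) Q_def w_def by (rule profile_mult_le[OF \<sigma> C2])
      finally show ?case by (simp add: \<sigma>_def)
    qed
  qed auto
  also have "\<dots> = ennreal (D * (C2 * B powr (1 - 1 / r))) * ?W"
    using D C2 by (subst nn_integral_cmult) (auto simp: w_def ennreal_mult mult.assoc)
  also have "\<dots> \<le> ennreal 1 * ?W"
  proof (intro mult_right_mono ennreal_leI)
    have "D * (C2 * B powr (1 - 1 / r)) = 2 powr p * K powr (p - 1) * C2 * (B powr ((p - r) / r) * B powr (1 - 1 / r))"
      by (simp add: D_def mult_ac)
    also have "B powr ((p - r) / r) * B powr (1 - 1 / r) = B powr ((p - 1) / r)"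
      using r by (simp add: powr_add[symmetric] field_simps)
    also have "2 powr p * K powr (p - 1) * C2 * B powr ((p - 1) / r) \<le> 1"
      using small unfolding C2_def b(3) b2 K_def .
    finally show "D * (C2 * B powr (1 - 1 / r)) \<le> 1" .
  qed auto
  finally have nonlin: "?N
    \<le> ?W" by simp
  have "duhamel \<alpha> p f supersol t x \<le> ?W + ?W"
    unfolding duhamel_def by (intro add_mono lin nonlin)
  also have "\<dots> = supersol t x" by (simp add: Vw mult_2)
  finally show ?thesis .
qed

end

section \<open>Existence for small Morrey norm\<close>

lemma ex_solution_if_local_mass_small:
  fixes \<alpha> T p r A :: real and f :: "'a::euclidean_space \<Rightarrow> ennreal"
  assumes \<alpha>: "0 < \<alpha>" "\<alpha> < 1" and T: "T > 0" and r: "1 < r" "r < p" and A: "A \<ge> 0"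
    and f: "f \<in> borel_measurable lebesgue"
    and mass: "\<And>z \<rho>. 0 < \<rho> \<Longrightarrow> \<rho>\<^sup>2 < T powr \<alpha> \<Longrightarrow>
       (\<integral>\<^sup>+y\<in>ball z \<rho>. ennpowr (f y) r \<partial>lebesgue) \<le> ennreal (A * \<rho> powr (real DIM('a) - 2 * r / (p - 1)))"
    and small: "2 powr p * ml_exp_bound \<alpha> (2 / (p - 1)) powr (p - 1) *
      (Gamma ((r - 1) / (p - 1)) / Gamma (1 + (r - 1) / (p - 1)) + Gamma ((r - 1) / (p - 1)))
      * (growth_const DIM('a) p r * A) powr ((p - 1) / r) \<le> 1"
  shows "\<exists>u. is_solution \<alpha> p (fun_measure f) (ereal T) u"
proof -
  \<comment> \<open>The estimates are carried out for a Borel version \<open>g\<close>; the measure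
    and the ball integrals see \<open>f\<close> only up to null sets.\<close>
  obtain g where [measurable]: "g \<in> borel_measurable borel" and fg: "AE x in lborel. f x = g x"
    using completion_ex_borel_measurable[OF f] by auto
  have fm: "fun_measure f = fun_measure g"
    unfolding fun_measure_def using f fg
    by (intro density_cong) (auto intro!: AE_completion measurable_completion)
  have mass_g: "(\<integral>\<^sup>+y\<in>ball z \<rho>. ennpowr (g y) r \<partial>lborel) \<le> ennreal (A * \<rho> powr (real DIM('a) - 2 * r / (p - 1)))"
    if "0 < \<rho>" "\<rho>\<^sup>2 < T powr \<alpha>" for z \<rho>
  proof -
    have "(\<integral>\<^sup>+y\<in>ball z \<rho>. ennpowr (g y) r \<partial>lborel) = (\<integral>\<^sup>+y\<in>ball z \<rho>. ennpowr (f y) r \<partial>lborel)"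
      using fg by (intro nn_integral_cong_AE, eventually_elim) simp
    then show ?thesis using mass[OF that, of z] by (simp add: nn_integral_completion)
  qed
  have p: "p > 0" using r by simp
  note ctx = \<alpha> T r A refl[of "growth_const DIM('a) p r * A"] \<open>g \<in> borel_measurable borel\<close> mass_g
  let ?V = "supersol \<alpha> r g"
  obtain u where um[measurable]: "(\<lambda>(t, x). u t x) \<in> borel_measurable (borel \<Otimes>\<^sub>M borel)"
    and uV: "\<And>t x. 0 < t \<Longrightarrow> t < T \<Longrightarrow> u t x \<le> ?V t x"
    and u: "\<And>t x. u t x = duhamel \<alpha> p g u t x"
  proof (rule ex_fixed_point_below_supersolution[OF \<alpha> p \<open>g \<in> borel_measurable borel\<close>, of T ?V])
    show "duhamel \<alpha> p g ?V t x \<le> ?V t x" if "0 < t" "t < T" for t x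
      using duhamel_supersol_le[OF ctx that small] .
  qed blast
  \<comment> \<open>Holds for every \<open>t\<close> and \<open>x\<close>, so the exceptional null
    set of the solution stems from finiteness alone.\<close>
  have eq: "u t x = P_op \<alpha> t (fun_measure f) x + ennreal \<alpha> * (\<integral>\<^sup>+ s\<in>{0<..<t}. ennreal ((t - s) powr (\<alpha> - 1)) *
             S_op \<alpha> (t - s) (fun_measure (\<lambda>y. ennpowr (u s y) p)) x \<partial>lebesgue)" for t x
  proof -
    have "S_op \<alpha> (t - s) (fun_measure (\<lambda>y. ennpowr (u s y) p)) x = S_fun \<alpha> (t - s) (\<lambda>y. ennpowr (u s y) p) x" for s
      by (rule S_op_fun_measure[OF \<alpha>]) measurable
    then show ?thesis
      unfolding fm P_op_fun_measure[OF \<alpha> \<open>g \<in> borel_measurable borel\<close>]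
      by (subst u) (simp add: duhamel_def nn_integral_completion)
  qed
  have um': "(\<lambda>(t, x). u t x) \<in> borel_measurable borel" using um by (simp only: borel_prod)
  define D where "D = {t. 0 < t \<and> ereal t < ereal T} \<times> (UNIV :: 'a set)"
  have D: "D = {0<..<T} \<times> UNIV" by (auto simp: D_def)
  have "open D" unfolding D by (intro open_Times) auto
  then have Ds: "D \<in> sets lebesgue" by simp
  \<comment> \<open>\<open>supersol_finite\<close> speaks of one fixed time; null sections at every
    time make the exceptional set in the product null.\<close>
  have "AE z in lborel. z \<in> D \<longrightarrow> (case z of (t, x) \<Rightarrow> u t x < \<infinity>)"
    unfolding lborel_prod[symmetric]
  proof (rule lborel_pair.AE_pair_measure)
    have [measurable]: "D \<in> sets (borel \<Otimes>\<^sub>M borel)" using \<open>open D\<close> by (subst borel_prod) simp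
    show "{z \<in> space (lborel \<Otimes>\<^sub>M lborel). z \<in> D \<longrightarrow> (case z of (t, x) \<Rightarrow> u t x < \<infinity>)} \<in> sets (lborel \<Otimes>\<^sub>M lborel)"
      by measurable
    show "AE t in lborel. AE x in lborel. (t, x) \<in> D \<longrightarrow> (case (t, x) of (t, x) \<Rightarrow> u t x < \<infinity>)"
    proof (rule AE_I2)
      fix t
      show "AE x in lborel. (t, x) \<in> D \<longrightarrow> (case (t, x) of (t, x) \<Rightarrow> u t x < \<infinity>)"
      proof (cases "0 < t \<and> t < T")
        case True
        have "AE x in lborel. ?V t x < \<infinity>" using supersol_finite[OF ctx] True by blast
        then show ?thesis
          by eventually_elim (use uV[of t] True in \<open>auto intro: le_less_trans\<close>)
      qed (auto simp: D)
    qed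
  qed
  then have "AE z in lebesgue. z \<in> D \<longrightarrow> (case z of (t, x) \<Rightarrow> u t x < \<infinity>)" by (rule AE_completion)
  then have fin: "AE z in lebesgue_on D. (case z of (t, x) \<Rightarrow> u t x < \<infinity>)"
    using Ds by (subst AE_restrict_space_iff) auto
  have "is_solution \<alpha> p (fun_measure f) (ereal T) u"
    unfolding is_solution_def D_def[symmetric]
  proof
    show "(\<lambda>(t, x). u t x) \<in> borel_measurable (lebesgue_on D)"
      using um' by (intro measurable_restrict_space1 measurable_completion) simp
    show "AE (t, x) in lebesgue_on D. u t x < \<infinity> \<and> u t x = P_op \<alpha> t (fun_measure f) x +
          ennreal \<alpha> * (\<integral>\<^sup>+ s\<in>{0<..<t}. ennreal ((t - s) powr (\<alpha> - 1)) *
             S_op \<alpha> (t - s) (fun_measure (\<lambda>y. ennpowr (u s y) p)) x \<partial>lebesgue)"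
      using fin by (rule eventually_mono) (unfold split_beta, intro conjI, assumption, rule eq)
  qed
  then show ?thesis by blast
qed

text \<open>Hoelder on the ball, as Jensen's inequality with exponent \<open>r / q\<close> for
  Lebesgue measure restricted to the ball, whose mass is \<open>v\<close>.\<close>

lemma nn_integral_ball_ennpowr_le:
  fixes f :: "'a::euclidean_space \<Rightarrow> ennreal"
  assumes f: "f \<in> borel_measurable lebesgue" and q: "0 < q" "q < r" and \<rho>: "\<rho> > 0" and M: "M \<ge> 0"
    and le: "ennpowr (\<integral>\<^sup>+y\<in>ball z \<rho>. ennpowr (f y) r \<partial>lebesgue) (1 / r) \<le> ennreal M"
  shows "(\<integral>\<^sup>+y\<in>ball z \<rho>. ennpowr (f y) q \<partial>lebesgue) \<le> ennreal ((unit_ball_vol DIM('a) * \<rho> ^ DIM('a)) powr (1 - q / r) * M powr q)"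
proof -
  define v where "v = unit_ball_vol (real DIM('a)) * \<rho> ^ DIM('a)"
  have v: "v > 0" using \<rho> by (simp add: v_def)
  define L where "L = lebesgue_on (ball z \<rho>)"
  have [measurable]: "f \<in> borel_measurable L" unfolding L_def using f by (rule measurable_restrict_space1)
  have setint: "(\<integral>\<^sup>+y\<in>ball z \<rho>. g y \<partial>lebesgue) = (\<integral>\<^sup>+y. g y \<partial>L)" for g :: "'a \<Rightarrow> ennreal"
    unfolding L_def by (subst nn_integral_restrict_space) auto
  define F where "F = (\<integral>\<^sup>+y. ennpowr (f y) r \<partial>L)"
  have "ennpowr (ennpowr F (1 / r)) r \<le> ennpowr (ennreal M) r"
    using le q unfolding setint F_def by (intro ennpowr_mono) auto
  then have F: "F \<le> ennreal (M powr r)" using q M by (simp add: ennpowr_ennpowr ennpowr_ennreal)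
  have "emeasure L (space L) = ennreal v"
    unfolding L_def using \<rho> by (subst emeasure_restrict_space) (auto simp: emeasure_completion emeasure_ball v_def)
  then have "ennpowr (\<integral>\<^sup>+y. ennpowr (f y) q \<partial>L) (r / q) \<le> ennreal (v powr (r / q - 1)) * (\<integral>\<^sup>+y. ennpowr (ennpowr (f y) q) (r / q) \<partial>L)"
    using q v by (intro nn_integral_jensen) auto
  also have "\<dots> = ennreal (v powr (r / q - 1)) * F" using q by (simp add: ennpowr_ennpowr F_def)
  also have "\<dots> \<le> ennreal (v powr (r / q - 1) * M powr r)"
    using F by (simp add: ennreal_mult mult_left_mono)
  finally have "ennpowr (ennpowr (\<integral>\<^sup>+y. ennpowr (f y) q \<partial>L) (r / q)) (q / r) \<le> ennpowr (ennreal (v powr (r / q - 1) * M powr r)) (q / r)"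
    using q by (intro ennpowr_mono) auto
  also have "ennpowr (ennpowr (\<integral>\<^sup>+y. ennpowr (f y) q \<partial>L) (r / q)) (q / r) = (\<integral>\<^sup>+y. ennpowr (f y) q \<partial>L)"
    using q by (simp add: ennpowr_ennpowr)
  also have "ennpowr (ennreal (v powr (r / q - 1) * M powr r)) (q / r) = ennreal (v powr (1 - q / r) * M powr q)"
  proof -
    have "(r / q - 1) * (q / r) = 1 - q / r" "r * (q / r) = q" using q by (simp_all add: field_simps)
    then show ?thesis by (simp add: ennpowr_ennreal powr_mult powr_powr del: times_divide_eq_right)
  qed
  finally show ?thesis by (simp add: setint v_def)
qed

section \<open>The threshold constant and its limit as \<alpha> tends to 1\<close>

lemma tendsto_ml_exp_bound:
  assumes "c > 0"
  shows "((\<lambda>\<alpha>. ml_exp_bound \<alpha> c) \<longlongrightarrow> 2 * exp (c * exp 2)) (at_left 1)"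
proof -
  have "((\<lambda>\<alpha>. 2 * exp (c * exp 2 * (2 * c * exp 2) powr ((1 - \<alpha>) / \<alpha>))) \<longlongrightarrow> 2 * exp (c * exp 2 * (2 * c * exp 2) powr ((1 - 1) / 1))) (at_left 1)"
    using assms by (intro tendsto_intros) auto
  then show ?thesis using assms by (simp add: ml_exp_bound_def)
qed

theorem theorem1p3:
  fixes p r :: real
  assumes "p > 1 + 2 / real CARD('n::finite)" and "r > 1"
  shows "\<exists>\<gamma>\<^sub>3 :: real \<Rightarrow> real.
    (\<forall>\<alpha>. 0 < \<alpha> \<and> \<alpha> < 1 \<longrightarrow> \<gamma>\<^sub>3 \<alpha> > 0) \<and>
    (\<forall>\<alpha> T. \<forall>\<mu> :: real ^ 'n \<Rightarrow> ennreal.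
       0 < \<alpha> \<and> \<alpha> < 1 \<and> T > 0 \<and> \<mu> \<in> borel_measurable lebesgue \<and>
       (\<forall>\<sigma>. 0 < \<sigma> \<and> \<sigma> < T powr (\<alpha> / 2) \<longrightarrow>
          (SUP z. ennpowr (\<integral>\<^sup>+ y\<in>ball z \<sigma>. ennpowr (\<mu> y) r \<partial>lebesgue) (1 / r))
            \<le> ennreal (\<gamma>\<^sub>3 \<alpha> * \<sigma> powr (real CARD('n) / r - 2 / (p - 1)))) \<longrightarrow>
       (\<exists>u. is_solution \<alpha> p (fun_measure \<mu>) (ereal T) u)) \<and>
    0 < Limsup (at_left 1) (\<lambda>\<alpha>. ereal (\<gamma>\<^sub>3 \<alpha>)) \<and>
    Limsup (at_left 1) (\<lambda>\<alpha>. ereal (\<gamma>\<^sub>3 \<alpha>)) < \<infinity>"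
proof -
  have p: "p > 1" using assms(1) by (rule order_less_trans[rotated]) simp
  define N where "N = CARD('n)"
  \<comment> \<open>By Hoelder on balls the hypothesis passes to smaller exponents; \<open>q < p\<close> is needed for the supersolution.\<close>
  define q where "q = (1 + min r p) / 2"
  have q: "1 < q" "q < r" "q < p" using p assms(2) by (auto simp: q_def min_def)
  define v where "v = unit_ball_vol (real N)"
  define C where "C = growth_const N p q * v powr (1 - q / r)"
  define E where "E = 2 powr p * (Gamma ((q - 1) / (p - 1)) / Gamma (1 + (q - 1) / (p - 1)) + Gamma ((q - 1) / (p - 1)))"
  define K where "K \<alpha> = ml_exp_bound \<alpha> (2 / (p - 1))" for \<alpha>
  \<comment> \<open>Chosen so that \<open>\<gamma> \<alpha> = c / K \<alpha>\<close> turns the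
    smallness condition into an equality, with all dependence on \<alpha> confined to
    \<open>K\<close>.\<close>
  define c where "c = E powr (- 1 / (p - 1)) * C powr (- 1 / q)"
  define \<gamma> where "\<gamma> \<alpha> = c / K \<alpha>" for \<alpha>
  have v: "v > 0" by (simp add: v_def)
  have G: "growth_const N p q > 0" by (simp add: growth_const_def)
  have C: "C > 0" using G v by (simp add: C_def)
  have "(q - 1) / (p - 1) > 0" using q by simp
  then have "Gamma ((q - 1) / (p - 1)) > 0" "Gamma (1 + (q - 1) / (p - 1)) > 0"
    by (intro Gamma_real_pos; linarith)+
  then have E: "E > 0" unfolding E_def by (intro mult_pos_pos add_pos_pos divide_pos_pos) auto
  have c: "c > 0" using C E by (simp add: c_def)
  have K: "K \<alpha> > 0" for \<alpha> by (simp add: K_def ml_exp_bound_def)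
  have \<gamma>pos: "\<gamma> \<alpha> > 0" for \<alpha> using c K by (simp add: \<gamma>_def)
  have sol: "\<exists>u. is_solution \<alpha> p (fun_measure \<mu>) (ereal T) u"
    if \<alpha>: "0 < \<alpha>" "\<alpha> < 1" and T: "T > 0" and \<mu>: "\<mu> \<in> borel_measurable lebesgue"
      and hyp: "\<And>\<sigma>. 0 < \<sigma> \<Longrightarrow> \<sigma> < T powr (\<alpha> / 2) \<Longrightarrow>
          (SUP z. ennpowr (\<integral>\<^sup>+ y\<in>ball z \<sigma>. ennpowr (\<mu> y) r \<partial>lebesgue) (1 / r))
            \<le> ennreal (\<gamma> \<alpha> * \<sigma> powr (real CARD('n) / r - 2 / (p - 1)))"
    for \<alpha> T and \<mu> :: "real ^ 'n \<Rightarrow> ennreal"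
  proof (rule ex_solution_if_local_mass_small[OF \<alpha> T q(1,3)])
    define A where "A = v powr (1 - q / r) * \<gamma> \<alpha> powr q"
    show "A \<ge> 0" by (simp add: A_def)
    show "\<mu> \<in> borel_measurable lebesgue" by (rule \<mu>)
    fix z :: "real ^ 'n" and \<rho> :: real assume \<rho>: "0 < \<rho>" "\<rho>\<^sup>2 < T powr \<alpha>"
    have "(T powr (\<alpha> / 2))\<^sup>2 = T powr \<alpha>" using T by (simp add: powr_realpow[symmetric] powr_powr)
    then have "\<rho> < T powr (\<alpha> / 2)" using \<rho> by (metis power2_less_imp_less powr_ge_zero)
    then have "ennpowr (\<integral>\<^sup>+ y\<in>ball z \<rho>. ennpowr (\<mu> y) r \<partial>lebesgue) (1 / r) \<le> ennreal (\<gamma> \<alpha> * \<rho> powr (real N / r - 2 / (p - 1)))"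
      using hyp[OF \<rho>(1)] unfolding N_def by (meson SUP_upper UNIV_I order_trans)
    from nn_integral_ball_ennpowr_le[OF \<mu> _ q(2) \<rho>(1) _ this]
    have "(\<integral>\<^sup>+ y\<in>ball z \<rho>. ennpowr (\<mu> y) q \<partial>lebesgue)
      \<le> ennreal ((v * \<rho> ^ N) powr (1 - q / r) * (\<gamma> \<alpha> * \<rho> powr (real N / r - 2 / (p - 1))) powr q)"
      using q \<gamma>pos[of \<alpha>] by (simp add: v_def N_def less_imp_le)
    also have "(v * \<rho> ^ N) powr (1 - q / r) * (\<gamma> \<alpha> * \<rho> powr (real N / r - 2 / (p - 1))) powr q
      = A * \<rho> powr (real N - 2 * q / (p - 1))"
    proof -
      have "\<rho> ^ N = \<rho> powr N" using \<rho> by (simp add: powr_realpow)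
      \<comment> \<open>Hoelder preserves the critical scaling: the exponent of the radius belonging
        to \<open>r\<close> becomes the one belonging to \<open>q\<close>.\<close>
      moreover have "real N * (1 - q / r) + (real N / r - 2 / (p - 1)) * q = real N - 2 * q / (p - 1)"
        by (simp add: algebra_simps)
      ultimately show ?thesis
        using v \<rho> less_imp_le[OF \<gamma>pos[of \<alpha>]] by (simp add: A_def powr_mult powr_powr mult_ac flip: powr_add)
    qed
    finally show "(\<integral>\<^sup>+ y\<in>ball z \<rho>. ennpowr (\<mu> y) q \<partial>lebesgue) \<le> ennreal (A * \<rho> powr (real DIM(real ^ 'n) - 2 * q / (p - 1)))"
      by (simp add: N_def)
  next
    have "(growth_const N p q * (v powr (1 - q / r) * \<gamma> \<alpha> powr q)) powr ((p - 1) / q) = (C * \<gamma> \<alpha> powr q) powr ((p - 1) / q)"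
      by (simp add: C_def mult.assoc)
    also have "\<dots> = C powr ((p - 1) / q) * \<gamma> \<alpha> powr (p - 1)"
      using C q by (simp add: powr_mult powr_powr)
    also have "\<gamma> \<alpha> powr (p - 1) = E powr (- 1) * C powr (- ((p - 1) / q)) / K \<alpha> powr (p - 1)"
      using E C K[of \<alpha>] p by (simp add: \<gamma>_def c_def powr_divide powr_mult powr_powr)
    finally have "E * K \<alpha> powr (p - 1) * (growth_const N p q * (v powr (1 - q / r) * \<gamma> \<alpha> powr q)) powr ((p - 1) / q) = 1"
      using E C K[of \<alpha>] by (simp add: powr_minus field_simps)
    then show "2 powr p * ml_exp_bound \<alpha> (2 / (p - 1)) powr (p - 1) *
      (Gamma ((q - 1) / (p - 1)) / Gamma (1 + (q - 1) / (p - 1)) + Gamma ((q - 1) / (p - 1)))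
      * (growth_const DIM(real ^ 'n) p q * (v powr (1 - q / r) * \<gamma> \<alpha> powr q)) powr ((p - 1) / q) \<le> 1"
      by (simp add: N_def E_def K_def mult_ac)
  qed
  \<comment> \<open>\<open>K\<close> converges to a positive number, so the limsup is a limit and
    equals \<open>L\<close>.\<close>
  define L where "L = c / (2 * exp (2 / (p - 1) * exp 2))"
  have "(\<gamma> \<longlongrightarrow> L) (at_left 1)"
    unfolding \<gamma>_def L_def K_def using p by (intro tendsto_divide tendsto_const tendsto_ml_exp_bound) auto
  then have "((\<lambda>\<alpha>. ereal (\<gamma> \<alpha>)) \<longlongrightarrow> ereal L) (at_left 1)" by simp
  then have "Limsup (at_left 1) (\<lambda>\<alpha>. ereal (\<gamma> \<alpha>)) = ereal L"
    by (intro lim_imp_Limsup) (auto simp: trivial_limit_at_left_real)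
  moreover have "L > 0" using c by (simp add: L_def)
  ultimately show ?thesis using \<gamma>pos sol by (intro exI[of _ \<gamma>]) auto
qed

end
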